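(* Let $(\mathcal{S},\mathcal{A},P,r)$ be a weakly communicating MDP with finite $\mathcal{S},\mathcal{A}$ ($S,A$ their sizes), unknown $P$ and known $r:\mathcal{S}\times\mathcal{A}\to[0,1]$. Fix $\delta\in(0,1)$ and an integer $n\ge1$ and run the following Empirical Span Penalization algorithm. Draw $n$ i.i.d. samples from each $P(\cdot\mid s,a)$ and form the empirical kernel $\widehat P$. For $i=2,\dots,\lceil\log_2n\rceil$: set $M_i=2^i$, choose $\gamma_i$ with $\frac1{1-\gamma_i}=\max\{\frac{\sqrt{nM_i}}{2\sqrt2\,\alpha(\delta,n)},1\}$, obtain $(\widetilde\pi_i,\widetilde V_i,\tilde r_i)$ from the Span-Constrained Planning algorithm applied to $(\widehat P,r,\gamma_i)$ with span bound $M_i$ and target error $\frac1n$, and set $\Phi(i)=(1-\gamma_i)\min_s\widetilde V_i(s)-\alpha(\delta,n)\sqrt{\frac{M_i+1}{n}}$. Let $\widehat i\in\arg\max_i\Phi(i)$ and output $\widehat\pi=\widetilde\pi_{\widehat i}$ and $\widehat\rho=\max\{\Phi(\widehat i),0\}\mathbf 1$. Then for an absolute constant $C_4$, with probability at least $1-\delta$, elementwise $$\rho^{\widehat\pi}\ \ge\ \widehat\rho\ \ge\ \sup_{\pi:\ \rho^\pi\text{ constant}}\Big\{\rho^\pi-C_4\,\alpha(\delta,n)\sqrt{\frac{\|h^\pi\|_{\mathrm{sp}}+1}{n}}\,\mathbf 1\Big\}.$$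
   Context: Span-Constrained Planning on a DMDP $(Q,r,\gamma)$ with span bound $M$ and target error $\varepsilon$: with $\mathcal{T}_\gamma(V)(s)=\max_a(r(s,a)+\gamma Q_{sa}V)$ and $\mathrm{Clip}_M(V)=\min\{V,(M+\min_{s'}V(s'))\mathbf 1\}$, iterate $V^0=\mathbf 0$, $V^{t+1}=\mathrm{Clip}_M(\mathcal{T}_\gamma(V^t))$ for $T=\lceil\log(\frac3{(1-\gamma)^2\varepsilon})/(1-\gamma)\rceil$ steps; return $\widehat\pi(s)\in\arg\max_a r(s,a)+\gamma Q_{sa}V^T$, the vector $V^T$, and $\tilde r(s,a)=\min\{\min_sV^T(s)+M-\gamma Q_{sa}V^T,r(s,a)\}$. Policies are stationary Markovian; the supremum ranges over policies $\pi$ whose gain vector $\rho^\pi$ has all entries equal. Gain $\rho^\pi(s)=\lim_T\frac1T\mathbb{E}^\pi_s[\sum_{t<T}r(S_t,A_t)]$, bias $h^\pi(s)=\mathrm{C}\text{-}\lim_T\mathbb{E}^\pi_s[\sum_{t<T}(r(S_t,A_t)-\rho^\pi(S_t))]$, $\|x\|_{\mathrm{sp}}=\max x-\min x$. $\alpha(\delta,n)=96\sqrt{\log(24SAn^5/\delta)}\log_2(\log_2(n+4))$. *)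

theory Defs
  imports "HOL-Probability.Probability"
begin

text \<open>States are 0..S-1, actions 0..A-1 (natural numbers).
  A real-valued kernel K s a s' is the probability of moving from s to s' under action a.
  A (stationary Markovian, possibly randomized) policy pol s a is the probability of action a in state s.\<close>

definition is_policy :: "nat \<Rightarrow> nat \<Rightarrow> (nat \<Rightarrow> nat \<Rightarrow> real) \<Rightarrow> bool" where
  "is_policy S A pol \<longleftrightarrow> (\<forall>s<S. (\<forall>a<A. 0 \<le> pol s a) \<and> (\<Sum>a<A. pol s a) = 1)"

definition det_policy :: "(nat \<Rightarrow> nat) \<Rightarrow> nat \<Rightarrow> nat \<Rightarrow> real" where
  "det_policy d s a = (if a = d s then 1 else 0)"

definition pol_kernel :: "nat \<Rightarrow> (nat \<Rightarrow> nat \<Rightarrow> nat \<Rightarrow> real) \<Rightarrow> (nat \<Rightarrow> nat \<Rightarrow> real) \<Rightarrow> nat \<Rightarrow> nat \<Rightarrow> real" where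
  "pol_kernel A K pol s s' = (\<Sum>a<A. pol s a * K s a s')"

definition pol_reward :: "nat \<Rightarrow> (nat \<Rightarrow> nat \<Rightarrow> real) \<Rightarrow> (nat \<Rightarrow> nat \<Rightarrow> real) \<Rightarrow> nat \<Rightarrow> real" where
  "pol_reward A r pol s = (\<Sum>a<A. pol s a * r s a)"

definition kstep :: "nat \<Rightarrow> (nat \<Rightarrow> nat \<Rightarrow> real) \<Rightarrow> (nat \<Rightarrow> real) \<Rightarrow> nat \<Rightarrow> real" where
  "kstep S Pm v = (\<lambda>s. \<Sum>s'<S. Pm s s' * v s')"

text \<open>kpow S Pm t v = Pm^t v, so kpow ... t v s = E_s[v(S_t)].\<close>
definition kpow :: "nat \<Rightarrow> (nat \<Rightarrow> nat \<Rightarrow> real) \<Rightarrow> nat \<Rightarrow> (nat \<Rightarrow> real) \<Rightarrow> nat \<Rightarrow> real" where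
  "kpow S Pm t v = (kstep S Pm ^^ t) v"

definition gain :: "nat \<Rightarrow> nat \<Rightarrow> (nat \<Rightarrow> nat \<Rightarrow> nat \<Rightarrow> real) \<Rightarrow> (nat \<Rightarrow> nat \<Rightarrow> real)
    \<Rightarrow> (nat \<Rightarrow> nat \<Rightarrow> real) \<Rightarrow> nat \<Rightarrow> real" where
  "gain S A K r pol s =
     lim (\<lambda>T. (\<Sum>t<T. kpow S (pol_kernel A K pol) t (pol_reward A r pol) s) / real T)"

definition bias :: "nat \<Rightarrow> nat \<Rightarrow> (nat \<Rightarrow> nat \<Rightarrow> nat \<Rightarrow> real) \<Rightarrow> (nat \<Rightarrow> nat \<Rightarrow> real)
    \<Rightarrow> (nat \<Rightarrow> nat \<Rightarrow> real) \<Rightarrow> nat \<Rightarrow> real" where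
  "bias S A K r pol s =
     lim (\<lambda>N. (\<Sum>T\<in>{1..N}. \<Sum>t<T. kpow S (pol_kernel A K pol) t
                 (\<lambda>x. pol_reward A r pol x - gain S A K r pol x) s) / real N)"

definition span :: "nat \<Rightarrow> (nat \<Rightarrow> real) \<Rightarrow> real" where
  "span S v = Max (v ` {..<S}) - Min (v ` {..<S})"

definition accessible :: "nat \<Rightarrow> nat \<Rightarrow> (nat \<Rightarrow> nat \<Rightarrow> nat \<Rightarrow> real) \<Rightarrow> nat \<Rightarrow> nat \<Rightarrow> bool" where
  "accessible S A K s s' \<longleftrightarrow> (\<exists>d. (\<forall>x<S. d x < A) \<and>
      (\<exists>t. kpow S (pol_kernel A K (det_policy d)) t (\<lambda>x. if x = s' then 1 else 0) s > 0))"

text \<open>A state is transient for a finite chain iff its expected number of visits is finite.\<close>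
definition transient :: "nat \<Rightarrow> (nat \<Rightarrow> nat \<Rightarrow> real) \<Rightarrow> nat \<Rightarrow> bool" where
  "transient S Pm s \<longleftrightarrow> summable (\<lambda>t. kpow S Pm t (\<lambda>x. if x = s then 1 else 0) s)"

definition weakly_communicating :: "nat \<Rightarrow> nat \<Rightarrow> (nat \<Rightarrow> nat \<Rightarrow> nat \<Rightarrow> real) \<Rightarrow> bool" where
  "weakly_communicating S A K \<longleftrightarrow> (\<exists>C \<subseteq> {..<S}.
      (\<forall>s\<in>C. \<forall>s'\<in>C. accessible S A K s s') \<and>
      (\<forall>s\<in>{..<S} - C. \<forall>pol. is_policy S A pol \<longrightarrow> transient S (pol_kernel A K pol) s))"

definition bellman :: "nat \<Rightarrow> nat \<Rightarrow> (nat \<Rightarrow> nat \<Rightarrow> nat \<Rightarrow> real) \<Rightarrow> (nat \<Rightarrow> nat \<Rightarrow> real) \<Rightarrow> real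
    \<Rightarrow> (nat \<Rightarrow> real) \<Rightarrow> nat \<Rightarrow> real" where
  "bellman S A K r \<gamma> V s = Max ((\<lambda>a. r s a + \<gamma> * (\<Sum>s'<S. K s a s' * V s')) ` {..<A})"

definition clip :: "nat \<Rightarrow> real \<Rightarrow> (nat \<Rightarrow> real) \<Rightarrow> nat \<Rightarrow> real" where
  "clip S M V s = min (V s) (M + Min (V ` {..<S}))"

definition plan_iters :: "real \<Rightarrow> real \<Rightarrow> nat" where
  "plan_iters \<gamma> \<epsilon> = nat \<lceil>ln (3 / ((1 - \<gamma>)^2 * \<epsilon>)) / (1 - \<gamma>)\<rceil>"

definition plan_V :: "nat \<Rightarrow> nat \<Rightarrow> (nat \<Rightarrow> nat \<Rightarrow> nat \<Rightarrow> real) \<Rightarrow> (nat \<Rightarrow> nat \<Rightarrow> real) \<Rightarrow> real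
    \<Rightarrow> real \<Rightarrow> real \<Rightarrow> nat \<Rightarrow> real" where
  "plan_V S A K r \<gamma> M \<epsilon> = ((clip S M \<circ> bellman S A K r \<gamma>) ^^ plan_iters \<gamma> \<epsilon>) (\<lambda>_. 0)"

text \<open>Greedy policy w.r.t. V^T; ties broken by a selector sel s X \<in> X.\<close>
definition plan_pol :: "(nat \<Rightarrow> nat set \<Rightarrow> nat) \<Rightarrow> nat \<Rightarrow> nat \<Rightarrow> (nat \<Rightarrow> nat \<Rightarrow> nat \<Rightarrow> real)
    \<Rightarrow> (nat \<Rightarrow> nat \<Rightarrow> real) \<Rightarrow> real \<Rightarrow> real \<Rightarrow> real \<Rightarrow> nat \<Rightarrow> nat" where
  "plan_pol sel S A K r \<gamma> M \<epsilon> s =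
     (let V = plan_V S A K r \<gamma> M \<epsilon>;
          q = (\<lambda>a. r s a + \<gamma> * (\<Sum>s'<S. K s a s' * V s'))
      in sel s {a. a < A \<and> (\<forall>b<A. q b \<le> q a)})"

definition alpha :: "nat \<Rightarrow> nat \<Rightarrow> real \<Rightarrow> nat \<Rightarrow> real" where
  "alpha S A \<delta> n = 96 * sqrt (ln (24 * real S * real A * real n ^ 5 / \<delta>))
                      * log 2 (log 2 (real n + 4))"

definition emp_kernel :: "nat \<Rightarrow> (nat \<times> nat \<times> nat \<Rightarrow> nat) \<Rightarrow> nat \<Rightarrow> nat \<Rightarrow> nat \<Rightarrow> real" where
  "emp_kernel n X s a s' = real (card {j. j < n \<and> X (s, a, j) = s'}) / real n"

definition esp_M :: "nat \<Rightarrow> real" where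
  "esp_M i = 2 ^ i"

definition esp_gamma :: "nat \<Rightarrow> nat \<Rightarrow> real \<Rightarrow> nat \<Rightarrow> nat \<Rightarrow> real" where
  "esp_gamma S A \<delta> n i =
     1 - 1 / max (sqrt (real n * esp_M i) / (2 * sqrt 2 * alpha S A \<delta> n)) 1"

definition esp_index_set :: "nat \<Rightarrow> nat set" where
  "esp_index_set n = {2 .. nat \<lceil>log 2 (real n)\<rceil>}"

definition esp_Phi :: "nat \<Rightarrow> nat \<Rightarrow> (nat \<Rightarrow> nat \<Rightarrow> real) \<Rightarrow> real \<Rightarrow> nat \<Rightarrow> (nat \<times> nat \<times> nat \<Rightarrow> nat)
    \<Rightarrow> nat \<Rightarrow> real" where
  "esp_Phi S A r \<delta> n X i =
     (let \<gamma> = esp_gamma S A \<delta> n i;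
          V = plan_V S A (emp_kernel n X) r \<gamma> (esp_M i) (1 / real n)
      in (1 - \<gamma>) * Min (V ` {..<S}) - alpha S A \<delta> n * sqrt ((esp_M i + 1) / real n))"

text \<open>Selected index; if the index range is empty (n \<le> 2) we fall back to i = 2 (convention).\<close>
definition esp_ihat :: "(nat set \<Rightarrow> nat) \<Rightarrow> nat \<Rightarrow> nat \<Rightarrow> (nat \<Rightarrow> nat \<Rightarrow> real) \<Rightarrow> real \<Rightarrow> nat
    \<Rightarrow> (nat \<times> nat \<times> nat \<Rightarrow> nat) \<Rightarrow> nat" where
  "esp_ihat isel S A r \<delta> n X =
     (let I = esp_index_set n
      in if I = {} then 2
         else isel {i \<in> I. \<forall>j\<in>I. esp_Phi S A r \<delta> n X j \<le> esp_Phi S A r \<delta> n X i})"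

definition esp_policy :: "(nat \<Rightarrow> nat \<Rightarrow> nat set \<Rightarrow> nat) \<Rightarrow> (nat set \<Rightarrow> nat) \<Rightarrow> nat \<Rightarrow> nat
    \<Rightarrow> (nat \<Rightarrow> nat \<Rightarrow> real) \<Rightarrow> real \<Rightarrow> nat \<Rightarrow> (nat \<times> nat \<times> nat \<Rightarrow> nat) \<Rightarrow> nat \<Rightarrow> nat" where
  "esp_policy asel isel S A r \<delta> n X =
     (let i = esp_ihat isel S A r \<delta> n X
      in plan_pol (asel i) S A (emp_kernel n X) r (esp_gamma S A \<delta> n i) (esp_M i) (1 / real n))"

text \<open>Scalar value of the output gain estimate rho_hat = max(Phi(ihat),0) * 1 (0 when n \<le> 2).\<close>
definition esp_rho :: "(nat set \<Rightarrow> nat) \<Rightarrow> nat \<Rightarrow> nat \<Rightarrow> (nat \<Rightarrow> nat \<Rightarrow> real) \<Rightarrow> real \<Rightarrow> nat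
    \<Rightarrow> (nat \<times> nat \<times> nat \<Rightarrow> nat) \<Rightarrow> real" where
  "esp_rho isel S A r \<delta> n X =
     (if esp_index_set n = {} then 0
      else max (esp_Phi S A r \<delta> n X (esp_ihat isel S A r \<delta> n X)) 0)"

definition sample_pmf :: "nat \<Rightarrow> nat \<Rightarrow> nat \<Rightarrow> (nat \<Rightarrow> nat \<Rightarrow> nat pmf) \<Rightarrow> (nat \<times> nat \<times> nat \<Rightarrow> nat) pmf" where
  "sample_pmf S A n P = Pi_pmf ({..<S} \<times> {..<A} \<times> {..<n}) undefined (\<lambda>(s, a, j). P s a)"

definition kernel_of :: "(nat \<Rightarrow> nat \<Rightarrow> nat pmf) \<Rightarrow> nat \<Rightarrow> nat \<Rightarrow> nat \<Rightarrow> real" where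
  "kernel_of P s a s' = pmf (P s a) s'"

end

theory Submission
  imports Defs
begin

text \<open>Since \<open>V\<close> depends on all samples, its deviation \<open>(Q - P) V\<close> at a pair \<open>(s, a)\<close> is controlled by
  leaving out that pair: if the row is replaced by a constant \<open>u\<close>, the clipped iteration no longer
  depends on the samples at \<open>(s, a)\<close>, and for \<open>u\<close> close to \<open>(Q V)(s, a)\<close> it has almost the same
  fixed point. Bernstein's inequality and a union bound over a grid of values \<open>u\<close> then give
  \<open>|(Q - P) V| \<lesssim> \<surd>(Var(V) L / n) + M L / n\<close>. In the stationary regime of the greedy policy the mean
  variance of \<open>V\<close> telescopes to \<open>O(M)\<close>, so its gain is at least \<open>(1 - \<gamma>) min V - O(\<surd>(M L / n))\<close>.

  Conversely, let \<open>pol\<close> have constant gain \<open>\<rho>\<close> and bias \<open>h\<close>. By the Poisson equation its discounted value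
  under \<open>Q\<close> is \<open>\<rho> / (1 - \<gamma>) + h\<close> up to the discounted sum of \<open>(Q - P) h\<close>, whose variance telescopes
  in the same way. The choice of \<open>\<gamma>\<close> makes this error smaller than \<open>M\<close> as soon as \<open>M\<close> is a few times
  \<open>span h + 1\<close>, so this value is a subsolution of the clipped Bellman equation and lies below
  \<open>V\<close>.\<close>

section \<open>Ergodic averages and the Poisson equation\<close>

text \<open>\<open>gain\<close> and \<open>bias\<close> are defined through \<open>lim\<close>,
  which carries no information until convergence is known, and the chain of a policy may be periodic
  or have several recurrent classes. All limits are therefore derived from an algebraic splitting of
  a vector into a harmonic part and an increment \<open>y - P y\<close>, whose sums telescope.

  The range of V is a priori bounded only by the horizon 1 / (1 - \<gamma>), and variance estimates
  at this scale are too large. Clipping reduces the range to M, and the remaining square root of a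
  variance is affordable only on average along a chain. For the lower bound on the gain that chain
  runs under P, the kernel whose variance occurs in Bernstein's inequality. For the comparison
  policy it runs under Q while the variance still refers to P; this mismatch is why h^2 enters as a
  second test function.

  The factor n^5 inside the logarithm covers a count of events: at most n levels, and for each level
  and pair n^3 + 1 grid values of u and two further test functions. The factor 96 in
  \<open>alpha\<close> turns a penalty below 1 into smallness of sqrt (M L / n).\<close>

definition stoch :: "nat \<Rightarrow> (nat \<Rightarrow> nat \<Rightarrow> real) \<Rightarrow> bool" where
  "stoch S Pm \<longleftrightarrow> (\<forall>s<S. (\<forall>s'<S. 0 \<le> Pm s s') \<and> (\<Sum>s'<S. Pm s s') = 1)"

lemma kstep_cong:
  "(\<And>s. s < S \<Longrightarrow> f s = g s) \<Longrightarrow> kstep S Pm f s = kstep S Pm g s"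
  by (auto simp: kstep_def intro!: sum.cong)

lemma kstep_add: "kstep S Pm (\<lambda>s. f s + g s) s = kstep S Pm f s + kstep S Pm g s"
  by (simp add: kstep_def algebra_simps sum.distrib)

lemma kstep_diff: "kstep S Pm (\<lambda>s. f s - g s) s = kstep S Pm f s - kstep S Pm g s"
  by (simp add: kstep_def algebra_simps sum_subtractf)

lemma kstep_scale: "kstep S Pm (\<lambda>s. c * f s) s = c * kstep S Pm f s"
  by (simp add: kstep_def sum_distrib_left algebra_simps)

lemma kstep_sum:
  "kstep S Pm (\<lambda>s. \<Sum>j\<in>J. f j s) s = (\<Sum>j\<in>J. kstep S Pm (f j) s)"
  by (simp add: kstep_def sum_distrib_left sum.swap[of _ J])

lemma kstep_const: "stoch S Pm \<Longrightarrow> s < S \<Longrightarrow> kstep S Pm (\<lambda>_. c) s = c"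
  by (simp add: kstep_def stoch_def flip: sum_distrib_right)

lemma kstep_mono:
  assumes "stoch S Pm" "s < S" "\<And>s. s < S \<Longrightarrow> f s \<le> g s"
  shows "kstep S Pm f s \<le> kstep S Pm g s"
  unfolding kstep_def using assms
  by (intro sum_mono mult_left_mono) (auto simp: stoch_def)

lemma kpow_0 [simp]: "kpow S Pm 0 f = f"
  by (simp add: kpow_def)

lemma kpow_Suc: "kpow S Pm (Suc t) f = kstep S Pm (kpow S Pm t f)"
  by (simp add: kpow_def)

lemma kpow_Suc2: "kpow S Pm (Suc t) f = kpow S Pm t (kstep S Pm f)"
  by (simp add: kpow_def funpow_swap1)

lemma kpow_cong:
  assumes "\<And>s. s < S \<Longrightarrow> f s = g s" "s < S"
  shows "kpow S Pm t f s = kpow S Pm t g s"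
  using assms(2)
proof (induction t arbitrary: s)
  case (Suc t)
  then show ?case unfolding kpow_Suc by (intro kstep_cong)
qed (use assms in simp)

lemma kpow_add: "kpow S Pm t (\<lambda>s. f s + g s) s = kpow S Pm t f s + kpow S Pm t g s"
  by (induction t arbitrary: f g s)
     (simp, subst kpow_Suc2, simp add: kstep_add kpow_Suc2[abs_def] ext[OF kstep_add])

lemma kpow_scale: "kpow S Pm t (\<lambda>s. c * f s) s = c * kpow S Pm t f s"
  by (induction t arbitrary: f s) (simp_all add: kpow_Suc2 ext[OF kstep_scale])

lemma kpow_const: "stoch S Pm \<Longrightarrow> s < S \<Longrightarrow> kpow S Pm t (\<lambda>_. c) s = c"
proof (induction t arbitrary: s)
  case (Suc t)
  then have "kpow S Pm (Suc t) (\<lambda>_. c) s = kstep S Pm (\<lambda>_. c) s"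
    unfolding kpow_Suc by (intro kstep_cong) auto
  then show ?case using Suc.prems by (simp add: kstep_const)
qed simp

lemma kpow_mono:
  assumes "stoch S Pm" "\<And>s. s < S \<Longrightarrow> f s \<le> g s" "s < S"
  shows "kpow S Pm t f s \<le> kpow S Pm t g s"
  using assms(3)
proof (induction t arbitrary: s)
  case (Suc t)
  then show ?case unfolding kpow_Suc using assms by (intro kstep_mono)
qed (use assms in simp)

lemma kpow_bounds:
  assumes "stoch S Pm" "\<And>s. s < S \<Longrightarrow> a \<le> f s" "\<And>s. s < S \<Longrightarrow> f s \<le> b" "s < S"
  shows "a \<le> kpow S Pm t f s" "kpow S Pm t f s \<le> b"
  using kpow_mono[OF assms(1), of "\<lambda>_. a" f s t] kpow_mono[OF assms(1), of f "\<lambda>_. b" s t]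
    kpow_const[OF assms(1,4)] assms by auto

lemma finite_bound:
  fixes f :: "nat \<Rightarrow> real"
  obtains b where "b \<ge> 0" "\<And>s. s < S \<Longrightarrow> \<bar>f s\<bar> \<le> b"
proof
  show "(\<Sum>s<S. \<bar>f s\<bar>) \<ge> 0" by (simp add: sum_nonneg)
  show "\<bar>f s\<bar> \<le> (\<Sum>s<S. \<bar>f s\<bar>)" if "s < S" for s
    using that by (intro member_le_sum) auto
qed

lemma kpow_bounded:
  assumes "stoch S Pm"
  obtains b where "b \<ge> 0" "\<And>s t. s < S \<Longrightarrow> \<bar>kpow S Pm t f s\<bar> \<le> b"
proof -
  obtain b where b: "b \<ge> 0" "\<And>s. s < S \<Longrightarrow> \<bar>f s\<bar> \<le> b" using finite_bound by metis
  have "\<bar>kpow S Pm t f s\<bar> \<le> b" if "s < S" for s t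
    using kpow_bounds[OF assms, of "-b" f b s t] b(2) that
    by (simp add: abs_le_iff) (metis abs_le_iff neg_le_iff_le minus_minus)
  with b(1) that show ?thesis by blast
qed

lemma kpow_telescope:
  "(\<Sum>t<T. kpow S Pm t (\<lambda>x. y x - kstep S Pm y x) s) = y s - kpow S Pm T y s"
proof (induction T)
  case (Suc T)
  have "kpow S Pm T (\<lambda>x. y x + (-1) * kstep S Pm y x) s = kpow S Pm T y s - kpow S Pm (Suc T) y s"
    by (simp only: kpow_add kpow_scale kpow_Suc2)
  then show ?case using Suc by simp
qed simp

section \<open>Linear algebra of \<open>I - P\<close>: harmonic part and increment\<close>

lemma homogeneous_system:
  fixes c :: "nat \<Rightarrow> nat \<Rightarrow> real"
  assumes "finite J" "card J > m"
  shows "\<exists>x. (\<exists>j\<in>J. x j \<noteq> 0) \<and> (\<forall>i<m. (\<Sum>j\<in>J. c i j * x j) = 0)"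
  using assms
proof (induction m arbitrary: J c)
  case 0
  then obtain j where "j \<in> J" by fastforce
  then show ?case by (intro exI[of _ "\<lambda>_. 1"]) auto
next
  case (Suc m)
  \<comment> \<open>Pivot for the last equation. If all its coefficients vanish, any
    \<open>p\<close> serves: division by zero is zero, so the elimination below changes nothing and
    \<open>z = 0\<close>.\<close>
  obtain p where p: "p \<in> J" "(\<exists>j\<in>J. c m j \<noteq> 0) \<Longrightarrow> c m p \<noteq> 0"
    using Suc.prems by (metis card.empty equals0I less_nat_zero_code)
  let ?J = "J - {p}"
  have J: "finite ?J" "card ?J > m" using Suc.prems p by auto
  have split: "(\<Sum>j\<in>J. g j) = g p + (\<Sum>j\<in>?J. g j)" for g :: "nat \<Rightarrow> real"
    using Suc.prems p by (simp add: sum.remove)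
  obtain x where x: "\<exists>j\<in>?J. x j \<noteq> 0"
    "\<And>i. i < m \<Longrightarrow> (\<Sum>j\<in>?J. (c i j - c i p * c m j / c m p) * x j) = 0"
    using Suc.IH[OF J, of "\<lambda>i j. c i j - c i p * c m j / c m p"] by blast
  define z where "z = - (\<Sum>j\<in>?J. c m j * x j) / c m p"
  define y where "y = x(p := z)"
  have y: "(\<Sum>j\<in>J. c i j * y j) = c i p * z + (\<Sum>j\<in>?J. c i j * x j)" for i
    unfolding split by (simp add: y_def)
  have "(\<Sum>j\<in>J. c i j * y j) = 0" if "i < Suc m" for i
  proof (cases "c m p = 0")
    case True
    then have "\<forall>j\<in>J. c m j = 0" using p by blast
    then show ?thesis using x(2)[of i] that True unfolding y z_def
      by (cases "i = m") (auto simp: p)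
  next
    case False
    have "(\<Sum>j\<in>?J. (c i j - c i p * c m j / c m p) * x j)
        = (\<Sum>j\<in>?J. c i j * x j) - c i p / c m p * (\<Sum>j\<in>?J. c m j * x j)"
      by (simp add: sum_distrib_left sum_subtractf algebra_simps)
    then show ?thesis using x(2)[of i] that False unfolding y z_def
      by (cases "i = m") (auto simp: field_simps)
  qed
  moreover have "\<exists>j\<in>J. y j \<noteq> 0" using x(1) unfolding y_def by auto
  ultimately show ?case by blast
qed

definition defect :: "nat \<Rightarrow> (nat \<Rightarrow> nat \<Rightarrow> real) \<Rightarrow> (nat \<Rightarrow> real) \<Rightarrow> nat \<Rightarrow> real" where
  "defect S Pm f = (\<lambda>s. f s - kstep S Pm f s)"

lemma defect_scale: "defect S Pm (\<lambda>s. c * f s) = (\<lambda>s. c * defect S Pm f s)"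
  by (auto simp: defect_def kstep_scale algebra_simps)

lemma defect_sum: "defect S Pm (\<lambda>s. \<Sum>j\<in>J. f j s) = (\<lambda>s. \<Sum>j\<in>J. defect S Pm (f j) s)"
  by (auto simp: defect_def kstep_sum sum_subtractf)

text \<open>For harmonic \<open>u = (I - P) z\<close>, the sum of \<open>P^t u\<close> over t < T
  equals both \<open>T u\<close> and, by telescoping, \<open>z - P^T z\<close>. The latter stays
  bounded in T, which forces \<open>u = 0\<close>.\<close>

lemma defect_defect_eq_0:
  assumes P: "stoch S Pm" and 0: "\<And>s. s < S \<Longrightarrow> defect S Pm (defect S Pm z) s = 0" and s: "s < S"
  shows "defect S Pm z s = 0"
proof -
  let ?u = "defect S Pm z"
  have u: "kpow S Pm t ?u s = ?u s" if "s < S" for s t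
    using that
  proof (induction t arbitrary: s)
    case (Suc t)
    have "kpow S Pm (Suc t) ?u s = kstep S Pm ?u s"
      unfolding kpow_Suc by (rule kstep_cong) (rule Suc.IH)
    then show ?case using 0[OF Suc.prems] by (simp add: defect_def)
  qed simp
  obtain b where b: "b \<ge> 0" "\<And>s t. s < S \<Longrightarrow> \<bar>kpow S Pm t z s\<bar> \<le> b"
    using kpow_bounded[OF P] by metis
  have "real T * \<bar>?u s\<bar> \<le> 2 * b" for T
  proof -
    have "real T * ?u s = (\<Sum>t<T. kpow S Pm t ?u s)" using u[OF s] by simp
    also have "\<dots> = z s - kpow S Pm T z s"
      unfolding defect_def by (rule kpow_telescope)
    finally have "\<bar>real T * ?u s\<bar> \<le> \<bar>z s\<bar> + \<bar>kpow S Pm T z s\<bar>" by simp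
    then show ?thesis using b(2)[OF s, of 0] b(2)[OF s, of T] by (simp add: abs_mult)
  qed
  then have "\<not> \<bar>?u s\<bar> > 0" using ex_less_of_nat_mult[of "\<bar>?u s\<bar>" "2 * b"] by (meson not_le)
  then show ?thesis by simp
qed

lemma defect_funpow_eq_0:
  assumes P: "stoch S Pm" and 0: "\<And>s. s < S \<Longrightarrow> (defect S Pm ^^ k) z s = 0" and s: "s < S"
  shows "defect S Pm z s = 0"
  using 0 s
proof (induction k arbitrary: z s)
  case 0
  then show ?case by (simp add: defect_def kstep_def)
next
  case (Suc k)
  show ?case
    by (rule defect_defect_eq_0[OF P _ Suc.prems(2)], rule Suc.IH)
       (use Suc.prems in \<open>simp_all add: funpow_swap1\<close>)
qed

text \<open>A linear dependency among the vectors \<open>(I - P)\<^sup>j x\<close>, divided by its lowest power of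
  \<open>I - P\<close>, yields the decomposition, because \<open>I - P\<close> and its powers have the same kernel.\<close>

lemma stoch_decomposition:
  assumes P: "stoch S Pm"
  obtains k y where "\<And>s. s < S \<Longrightarrow> kstep S Pm k s = k s"
    "\<And>s. s < S \<Longrightarrow> x s = k s + (y s - kstep S Pm y s)"
proof -
  let ?D = "defect S Pm"
  have "\<exists>c. (\<exists>j\<in>{..S}. c j \<noteq> 0) \<and> (\<forall>s<S. (\<Sum>j\<in>{..S}. (?D ^^ j) x s * c j) = 0)"
    by (rule homogeneous_system) simp_all
  then obtain c where
    "(\<exists>j\<in>{..S}. c j \<noteq> 0) \<and> (\<forall>s<S. (\<Sum>j\<in>{..S}. (?D ^^ j) x s * c j) = 0)" ..
  then have c: "\<exists>j\<in>{..S}. c j \<noteq> 0" "\<And>s. s < S \<Longrightarrow> (\<Sum>j\<le>S. (?D ^^ j) x s * c j) = 0"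
    by simp_all
  define k where "k = (LEAST j. c j \<noteq> 0)"
  have "\<exists>j. c j \<noteq> 0" using c(1) by (rule bexE) (rule exI)
  then have "c k \<noteq> 0" unfolding k_def by (rule LeastI_ex)
  moreover have "c j = 0" if "j < k" for j using not_less_Least[OF that[unfolded k_def]] by simp
  ultimately have k: "c k \<noteq> 0" "\<And>j. j < k \<Longrightarrow> c j = 0" .
  have kS: "k \<le> S"
  proof (rule ccontr)
    assume "\<not> k \<le> S"
    then show False using c(1) k(2) by fastforce
  qed
  \<comment> \<open>The dependency with its lowest power of \<open>I - P\<close> divided out; hence
    \<open>(I - P)^k w = 0\<close>, and \<open>w\<close> is harmonic.\<close>
  define w where "w = (\<lambda>s. \<Sum>j\<in>{k..S}. c j * (?D ^^ (j - k)) x s)"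
  have pow_w: "(?D ^^ m) w s = (\<Sum>j\<in>{k..S}. c j * (?D ^^ (m + (j - k))) x s)" for m s
  proof (induction m arbitrary: s)
    case (Suc m)
    have "(?D ^^ Suc m) w = ?D (\<lambda>s. \<Sum>j\<in>{k..S}. c j * (?D ^^ (m + (j - k))) x s)"
    proof -
      have "(?D ^^ m) w = (\<lambda>s. \<Sum>j\<in>{k..S}. c j * (?D ^^ (m + (j - k))) x s)"
        by (rule ext) (rule Suc.IH)
      then show ?thesis by (simp only: funpow.simps o_apply)
    qed
    then show ?case by (simp add: defect_sum defect_scale)
  qed (simp add: w_def)
  have "(?D ^^ k) w s = 0" if "s < S" for s
  proof -
    have "(?D ^^ k) w s = (\<Sum>j\<in>{k..S}. c j * (?D ^^ j) x s)"
      unfolding pow_w by (intro sum.cong) auto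
    also have "\<dots> = (\<Sum>j\<le>S. (?D ^^ j) x s * c j)"
      by (rule sum.mono_neutral_cong_left) (use k(2) in \<open>auto simp: not_le\<close>)
    finally show ?thesis using c(2) that by simp
  qed
  then have Dw: "?D w s = 0" if "s < S" for s using defect_funpow_eq_0[OF P] that by blast
  \<comment> \<open>Solves the definition of \<open>w\<close> for \<open>x\<close>: the terms with j
    > k all contain a factor \<open>I - P\<close>, and one such factor is pulled out of
    each.\<close>
  define y where "y = (\<lambda>s. \<Sum>j\<in>{Suc k..S}. (- c j / c k) * (?D ^^ (j - Suc k)) x s)"
  have "x s = w s / c k + ?D y s" for s
  proof -
    have "w s = c k * x s + (\<Sum>j\<in>{Suc k..S}. c j * (?D ^^ (j - k)) x s)"
      unfolding w_def using kS by (simp add: sum.atLeast_Suc_atMost)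
    moreover have "?D ((?D ^^ (j - Suc k)) x) = (?D ^^ (j - k)) x" if "j \<in> {Suc k..S}" for j
    proof -
      have "j - k = Suc (j - Suc k)" using that by auto
      then show ?thesis by simp
    qed
    then have "?D y s = (\<Sum>j\<in>{Suc k..S}. (- c j / c k) * (?D ^^ (j - k)) x s)"
      unfolding y_def defect_sum defect_scale
      by (intro sum.cong refl) simp
    moreover have "c k * (\<Sum>j\<in>{Suc k..S}. (- c j / c k) * (?D ^^ (j - k)) x s) 
        = - (\<Sum>j\<in>{Suc k..S}. c j * (?D ^^ (j - k)) x s)"
      using k(1) by (simp add: sum_distrib_left sum_negf)
    ultimately show ?thesis using k(1) by (simp add: field_simps)
  qed
  moreover have "kstep S Pm (\<lambda>s. w s / c k) s = w s / c k" if "s < S" for s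
    using Dw[OF that] kstep_scale[of S Pm "1 / c k" w s] by (simp add: defect_def)
  ultimately show ?thesis using that[of "\<lambda>s. w s / c k" y] by (simp add: defect_def)
qed

section \<open>Long-run averages of a finite chain\<close>

definition cesaro :: "nat \<Rightarrow> (nat \<Rightarrow> nat \<Rightarrow> real) \<Rightarrow> (nat \<Rightarrow> real) \<Rightarrow> nat \<Rightarrow> real" where
  "cesaro S Pm f s = lim (\<lambda>T. (\<Sum>t<T. kpow S Pm t f s) / real T)"

lemma bounded_over_real_tendsto_0:
  fixes a :: "nat \<Rightarrow> real"
  assumes "\<And>T. \<bar>a T\<bar> \<le> b"
  shows "(\<lambda>T. a T / real T) \<longlonglongrightarrow> 0"
proof (rule Lim_null_comparison)
  show "(\<lambda>T. b / real T) \<longlonglongrightarrow> 0" by (rule lim_const_over_n)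
  show "\<forall>\<^sub>F T in sequentially. norm (a T / real T) \<le> b / real T"
    using assms by (intro always_eventually) (auto simp: divide_right_mono)
qed

text \<open>The harmonic part contributes exactly \<open>T * k s\<close> to the partial sum, and the
  increment telescopes to something bounded, so division by T leaves \<open>k s\<close>. Periodic
  chains are covered.\<close>

lemma cesaro_tendsto_harmonic:
  assumes P: "stoch S Pm" and k: "\<And>s. s < S \<Longrightarrow> kstep S Pm k s = k s"
    and f: "\<And>s. s < S \<Longrightarrow> f s = k s + (y s - kstep S Pm y s)" and s: "s < S"
  shows "(\<lambda>T. (\<Sum>t<T. kpow S Pm t f s) / real T) \<longlonglongrightarrow> k s"
proof -
  have kk: "kpow S Pm t k s = k s" if "s < S" for s t
    using that
  proof (induction t arbitrary: s)
    case (Suc t)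
    have "kpow S Pm (Suc t) k s = kstep S Pm k s"
      unfolding kpow_Suc by (rule kstep_cong) (rule Suc.IH)
    then show ?case using k[OF Suc.prems] by simp
  qed simp
  obtain b where b: "b \<ge> 0" "\<And>s t. s < S \<Longrightarrow> \<bar>kpow S Pm t y s\<bar> \<le> b"
    using kpow_bounded[OF P] by metis
  have sum: "(\<Sum>t<T. kpow S Pm t f s) = real T * k s + (y s - kpow S Pm T y s)" for T
  proof -
    have "(\<Sum>t<T. kpow S Pm t f s)
        = (\<Sum>t<T. kpow S Pm t (\<lambda>s. k s + (y s - kstep S Pm y s)) s)"
      by (intro sum.cong refl kpow_cong) (use f s in auto)
    also have "\<dots> = (\<Sum>t<T. k s) + (\<Sum>t<T. kpow S Pm t (\<lambda>s. y s - kstep S Pm y s) s)"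
      using kk[OF s] by (simp add: kpow_add sum.distrib)
    finally show ?thesis by (simp add: kpow_telescope)
  qed
  have "(\<lambda>T. (y s - kpow S Pm T y s) / real T) \<longlonglongrightarrow> 0"
  proof (rule bounded_over_real_tendsto_0)
    show "\<bar>y s - kpow S Pm T y s\<bar> \<le> 2 * b" for T
      using b(2)[OF s, of T] b(2)[OF s, of 0] unfolding kpow_0 by linarith
  qed
  from tendsto_add[OF tendsto_const[of "k s"] this]
  have "(\<lambda>T. k s + (y s - kpow S Pm T y s) / real T) \<longlonglongrightarrow> k s" by simp
  moreover have "\<forall>\<^sub>F T in sequentially. k s + (y s - kpow S Pm T y s) / real T
      = (\<Sum>t<T. kpow S Pm t f s) / real T"
    using eventually_gt_at_top[of 0] by eventually_elim (simp add: sum field_simps)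
  ultimately show ?thesis by (rule Lim_transform_eventually)
qed

lemma cesaro_tendsto:
  assumes "stoch S Pm" "s < S"
  shows "(\<lambda>T. (\<Sum>t<T. kpow S Pm t f s) / real T) \<longlonglongrightarrow> cesaro S Pm f s"
proof -
  obtain k y where ky: "\<And>s. s < S \<Longrightarrow> kstep S Pm k s = k s"
    "\<And>s. s < S \<Longrightarrow> f s = k s + (y s - kstep S Pm y s)"
    using stoch_decomposition[OF assms(1), of f] by blast
  have lim: "(\<lambda>T. (\<Sum>t<T. kpow S Pm t f s) / real T) \<longlonglongrightarrow> k s"
    using assms(1) ky assms(2) by (rule cesaro_tendsto_harmonic)
  then have "cesaro S Pm f s = k s" unfolding cesaro_def by (rule limI)
  with lim show ?thesis by simp
qed

text \<open>Uniqueness of limits identifies the harmonic part of any splitting with the average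
  itself.\<close>

lemma cesaro_decomposition:
  assumes "stoch S Pm"
  obtains y where "\<And>s. s < S \<Longrightarrow> f s = cesaro S Pm f s + (y s - kstep S Pm y s)"
    "\<And>s. s < S \<Longrightarrow> kstep S Pm (cesaro S Pm f) s = cesaro S Pm f s"
proof -
  obtain k y where ky: "\<And>s. s < S \<Longrightarrow> kstep S Pm k s = k s"
    "\<And>s. s < S \<Longrightarrow> f s = k s + (y s - kstep S Pm y s)"
    using stoch_decomposition[OF assms] by blast
  have k: "cesaro S Pm f s = k s" if "s < S" for s
    using LIMSEQ_unique[OF cesaro_tendsto[OF assms that] cesaro_tendsto_harmonic[OF assms ky that]] .
  show ?thesis
    by (rule that[of y]) (use ky k kstep_cong[of S "cesaro S Pm f" k Pm] in auto)
qed

lemma cesaro_add: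
  assumes "stoch S Pm" "s < S"
  shows "cesaro S Pm (\<lambda>s. f s + g s) s = cesaro S Pm f s + cesaro S Pm g s"
  by (rule LIMSEQ_unique[OF cesaro_tendsto[OF assms]])
     (use tendsto_add[OF cesaro_tendsto[OF assms, of f] cesaro_tendsto[OF assms, of g]]
      in \<open>simp add: kpow_add sum.distrib add_divide_distrib\<close>)

lemma cesaro_scale:
  assumes "stoch S Pm" "s < S"
  shows "cesaro S Pm (\<lambda>s. c * f s) s = c * cesaro S Pm f s"
proof (rule LIMSEQ_unique[OF cesaro_tendsto[OF assms]])
  have "(\<Sum>t<T. kpow S Pm t (\<lambda>s. c * f s) s) / real T = c * ((\<Sum>t<T. kpow S Pm t f s) / real T)" for T
    unfolding kpow_scale by (simp add: sum_distrib_left)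
  then show "(\<lambda>T. (\<Sum>t<T. kpow S Pm t (\<lambda>s. c * f s) s) / real T) \<longlonglongrightarrow> c * cesaro S Pm f s"
    using tendsto_mult[OF tendsto_const[of c] cesaro_tendsto[OF assms, of f]] by presburger
qed

lemma cesaro_mono:
  assumes "stoch S Pm" "s < S" "\<And>s. s < S \<Longrightarrow> f s \<le> g s"
  shows "cesaro S Pm f s \<le> cesaro S Pm g s"
proof (rule LIMSEQ_le[OF cesaro_tendsto[OF assms(1,2)] cesaro_tendsto[OF assms(1,2)]])
  have "(\<Sum>t<T. kpow S Pm t f s) / real T \<le> (\<Sum>t<T. kpow S Pm t g s) / real T" for T
    by (intro divide_right_mono sum_mono kpow_mono) (use assms in simp_all)
  then show "\<exists>N. \<forall>T\<ge>N. (\<Sum>t<T. kpow S Pm t f s) / real T \<le> (\<Sum>t<T. kpow S Pm t g s) / real T"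
    by blast
qed

lemma cesaro_const:
  assumes "stoch S Pm" "s < S"
  shows "cesaro S Pm (\<lambda>_. c) s = c"
  by (rule LIMSEQ_unique[OF cesaro_tendsto[OF assms] cesaro_tendsto_harmonic[where y = "\<lambda>_. 0" and k = "\<lambda>_. c"]])
     (use assms in \<open>auto simp: kstep_const\<close>)

lemma cesaro_kstep:
  assumes "stoch S Pm" "s < S"
  shows "cesaro S Pm (kstep S Pm f) s = cesaro S Pm f s"
proof -
  have "cesaro S Pm (\<lambda>s. (- 1) * kstep S Pm f s + f s) s = 0"
    by (rule LIMSEQ_unique[OF cesaro_tendsto[OF assms] cesaro_tendsto_harmonic[where y = f and k = "\<lambda>_. 0"]])
       (use assms in \<open>auto simp: kstep_def\<close>)
  then show ?thesis by (simp only: cesaro_add[OF assms] cesaro_scale[OF assms])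
qed

text \<open>The inner sums are \<open>y - P^T y\<close>, so averaging them over T subtracts the
  average of \<open>y\<close>. Since T runs from 1 to N, the average is taken of \<open>P y\<close>;
  stationarity makes it that of \<open>y\<close>.\<close>

lemma cesaro_of_cumulative:
  assumes P: "stoch S Pm" and s: "s < S" and f: "\<And>s. s < S \<Longrightarrow> f s = y s - kstep S Pm y s"
  shows "(\<lambda>N. (\<Sum>T\<in>{1..N}. \<Sum>t<T. kpow S Pm t f s) / real N) \<longlonglongrightarrow> y s - cesaro S Pm y s"
proof -
  have inner: "(\<Sum>t<T. kpow S Pm t f s) = y s - kpow S Pm T y s" for T
  proof -
    have "(\<Sum>t<T. kpow S Pm t f s) = (\<Sum>t<T. kpow S Pm t (\<lambda>x. y x - kstep S Pm y x) s)"
      by (intro sum.cong refl kpow_cong) (use f s in auto)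
    then show ?thesis by (simp add: kpow_telescope)
  qed
  have *: "(\<Sum>T\<in>{1..N}. \<Sum>t<T. kpow S Pm t f s)
      = real N * y s - (\<Sum>T<N. kpow S Pm T (kstep S Pm y) s)" for N
  proof -
    have "(\<Sum>T\<in>{1..N}. kpow S Pm T y s) = (\<Sum>T<N. kpow S Pm T (kstep S Pm y) s)"
      unfolding One_nat_def sum.atLeast1_atMost_eq kpow_Suc2 ..
    then show ?thesis unfolding inner by (simp add: sum_subtractf)
  qed
  have "\<forall>\<^sub>F N in sequentially. y s - (\<Sum>T<N. kpow S Pm T (kstep S Pm y) s) / real N
      = (\<Sum>T\<in>{1..N}. \<Sum>t<T. kpow S Pm t f s) / real N"
    unfolding * using eventually_gt_at_top[of 0] by eventually_elim (simp add: diff_divide_distrib)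
  moreover have "(\<lambda>N. y s - (\<Sum>T<N. kpow S Pm T (kstep S Pm y) s) / real N)
      \<longlonglongrightarrow> y s - cesaro S Pm y s"
    using cesaro_tendsto[OF P s, of "kstep S Pm y"] cesaro_kstep[OF P s]
    by (intro tendsto_diff tendsto_const) simp
  ultimately show ?thesis by (rule Lim_transform_eventually[rotated])
qed

lemma gain_eq_cesaro: "gain S A K r pol = cesaro S (pol_kernel A K pol) (pol_reward A r pol)"
  by (auto simp: gain_def cesaro_def)

text \<open>Any potential \<open>y\<close> whose increment is reward minus gain satisfies the
  equation. The \<open>bias\<close> is such a potential corrected by its own average, and that
  average is harmonic, so it cancels in \<open>h - P h\<close>.\<close>

lemma poisson_equation:
  assumes P: "stoch S (pol_kernel A K pol)" and const: "\<And>s. s < S \<Longrightarrow> gain S A K r pol s = \<rho>"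
    and s: "s < S"
  shows "bias S A K r pol s - kstep S (pol_kernel A K pol) (bias S A K r pol) s
    = pol_reward A r pol s - \<rho>"
proof (rule cesaro_decomposition[OF P, of "pol_reward A r pol"])
  let ?P = "pol_kernel A K pol"
  fix y assume y: "\<And>s. s < S \<Longrightarrow>
      pol_reward A r pol s = cesaro S ?P (pol_reward A r pol) s + (y s - kstep S ?P y s)"
  have bias: "bias S A K r pol s = y s - cesaro S ?P y s" if "s < S" for s
    unfolding bias_def
    by (rule limI, rule cesaro_of_cumulative[OF P that]) (use y in \<open>simp add: gain_eq_cesaro\<close>)
  have harm: "kstep S ?P (cesaro S ?P y) s = cesaro S ?P y s"
    using cesaro_decomposition[OF P, of y] s by blast
  have "kstep S ?P (bias S A K r pol) s = kstep S ?P (\<lambda>s. y s - cesaro S ?P y s) s"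
    by (rule kstep_cong) (rule bias)
  also have "\<dots> = kstep S ?P y s - cesaro S ?P y s"
    by (simp add: kstep_diff harm)
  finally show ?thesis using bias[OF s] y[OF s] const[OF s] by (simp add: gain_eq_cesaro)
qed

lemma stoch_pol_kernel:
  assumes "is_policy S A pol" "\<And>a. a < A \<Longrightarrow> stoch S (\<lambda>s. K s a)"
  shows "stoch S (pol_kernel A K pol)"
proof -
  have "(\<Sum>s'<S. pol_kernel A K pol s s') = 1" if "s < S" for s
  proof -
    have "(\<Sum>s'<S. pol_kernel A K pol s s') = (\<Sum>a<A. pol s a * (\<Sum>s'<S. K s a s'))"
      unfolding pol_kernel_def sum_distrib_left by (rule sum.swap)
    also have "\<dots> = (\<Sum>a<A. pol s a)"
      using assms(2) that by (intro sum.cong) (auto simp: stoch_def)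
    finally show ?thesis using assms(1) that by (simp add: is_policy_def)
  qed
  then show ?thesis using assms unfolding stoch_def
    by (auto simp: pol_kernel_def is_policy_def intro!: sum_nonneg mult_nonneg_nonneg)
qed

lemma kstep_pol_kernel:
  "kstep S (pol_kernel A K pol) f s = (\<Sum>a<A. pol s a * kstep S (\<lambda>s. K s a) f s)"
  unfolding kstep_def pol_kernel_def sum_distrib_left sum_distrib_right
  by (subst sum.swap) (simp add: mult.assoc)

lemma is_policy_det: "(\<And>s. s < S \<Longrightarrow> d s < A) \<Longrightarrow> is_policy S A (det_policy d)"
  by (auto simp: is_policy_def det_policy_def)

lemma kstep_det_kernel:
  "d s < A \<Longrightarrow> kstep S (pol_kernel A K (det_policy d)) f s = kstep S (\<lambda>s. K s (d s)) f s"
  unfolding kstep_pol_kernel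
  by (simp add: det_policy_def if_distrib[of "\<lambda>x. x * _"] sum.delta kstep_def cong: if_cong)

lemma pol_reward_det: "d s < A \<Longrightarrow> pol_reward A r (det_policy d) s = r s (d s)"
  by (simp add: pol_reward_def det_policy_def if_distrib[of "\<lambda>x. x * _"] sum.delta cong: if_cong)

section \<open>Bernstein bounds for the empirical kernel\<close>

text \<open>For negative arguments the Taylor bound \<open>1 + y + y^2 / 2 \<le> exp y\<close> is
  inverted, and its left side times \<open>1 - y + y^2\<close> is at least 1. Asking only for
  \<open>x \<le> 1\<close> lets the moment estimate work with a one-sided range bound.\<close>

lemma exp_le_quadratic:
  fixes x :: real
  assumes "x \<le> 1"
  shows "exp x \<le> 1 + x + x\<^sup>2"
proof (cases "x \<ge> 0")
  case True
  then show ?thesis using exp_bound assms by simp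
next
  case False
  define y where "y = - x"
  have y: "y > 0" using False by (simp add: y_def)
  have "1 + y + y\<^sup>2 / 2 \<le> exp y" using exp_lower_Taylor_quadratic[of y] y by simp
  then have "exp (- y) \<le> 1 / (1 + y + y\<^sup>2 / 2)"
    using y by (simp add: exp_minus inverse_eq_divide frac_le add_pos_nonneg)
  also have "\<dots> \<le> 1 - y + y\<^sup>2"
  proof -
    have "(1 - y + y\<^sup>2) * (1 + y + y\<^sup>2 / 2) = 1 + y\<^sup>2 / 2 + y ^ 3 / 2 + y ^ 4 / 2"
      by (simp add: field_simps power2_eq_square power3_eq_cube power4_eq_xxxx)
    also have "\<dots> \<ge> 1" using y by simp
    finally show ?thesis using y by (simp add: pos_divide_le_eq add_pos_nonneg)
  qed
  finally show ?thesis by (simp add: y_def)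
qed

definition pvar :: "nat \<Rightarrow> (nat \<Rightarrow> real) \<Rightarrow> (nat \<Rightarrow> real) \<Rightarrow> real" where
  "pvar S p f = (\<Sum>x<S. p x * (f x)\<^sup>2) - (\<Sum>x<S. p x * f x)\<^sup>2"

lemma pvar_eq:
  assumes "(\<Sum>x<S. p x) = 1" and m: "m = (\<Sum>x<S. p x * f x)"
  shows "pvar S p f = (\<Sum>x<S. p x * (f x - m)\<^sup>2)"
proof -
  have "(\<Sum>x<S. p x * (f x - m)\<^sup>2)
      = (\<Sum>x<S. p x * (f x)\<^sup>2) - 2 * m * (\<Sum>x<S. p x * f x) + m\<^sup>2 * (\<Sum>x<S. p x)"
    by (simp add: power2_diff algebra_simps sum.distrib sum_subtractf sum_distrib_left sum_distrib_right)
  then show ?thesis unfolding pvar_def using assms by (simp add: power2_eq_square algebra_simps)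
qed

lemma pvar_nonneg:
  assumes "\<And>x. x < S \<Longrightarrow> 0 \<le> p x" "(\<Sum>x<S. p x) = 1"
  shows "0 \<le> pvar S p f"
  unfolding pvar_eq[OF assms(2) refl] using assms(1) by (intro sum_nonneg mult_nonneg_nonneg) auto

lemma pvar_uminus: "pvar S p (\<lambda>x. - f x) = pvar S p f"
  by (simp add: pvar_def sum_negf)

lemma expectation_pmf_sum:
  fixes p :: "nat pmf" and g :: "nat \<Rightarrow> real"
  assumes "set_pmf p \<subseteq> {..<S}"
  shows "measure_pmf.expectation p g = (\<Sum>x<S. pmf p x * g x)"
  using assms by (subst integral_measure_pmf_real[where A = "{..<S}"]) (auto simp: mult.commute)

text \<open>The linear term of the quadratic bound vanishes because \<open>m\<close> is the mean,
  and the quadratic one is the variance times \<open>l^2\<close>.\<close>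

lemma mgf_bound:
  fixes p :: "nat pmf"
  assumes p: "set_pmf p \<subseteq> {..<S}" and m: "m = (\<Sum>x<S. pmf p x * f x)"
    and l: "0 \<le> l" "\<And>x. x < S \<Longrightarrow> l * (f x - m) \<le> 1"
  shows "measure_pmf.expectation p (\<lambda>x. exp (l * (f x - m))) \<le> exp (l\<^sup>2 * pvar S (pmf p) f)"
proof -
  have one: "(\<Sum>x<S. pmf p x) = 1" using p by (intro sum_pmf_eq_1) auto
  have "measure_pmf.expectation p (\<lambda>x. exp (l * (f x - m))) = (\<Sum>x<S. pmf p x * exp (l * (f x - m)))"
    by (rule expectation_pmf_sum[OF p])
  also have "\<dots> \<le> (\<Sum>x<S. pmf p x * (1 + l * (f x - m) + (l * (f x - m))\<^sup>2))"
    using l(2) by (intro sum_mono mult_left_mono exp_le_quadratic) auto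
  also have "\<dots> = (\<Sum>x<S. pmf p x) + l * ((\<Sum>x<S. pmf p x * f x) - m * (\<Sum>x<S. pmf p x))
      + l\<^sup>2 * (\<Sum>x<S. pmf p x * (f x - m)\<^sup>2)"
    unfolding power_mult_distrib
    by (simp add: distrib_left right_diff_distrib sum.distrib sum_subtractf sum_distrib_left mult.left_commute mult.commute mult.assoc)
  also have "\<dots> = 1 + l\<^sup>2 * pvar S (pmf p) f"
    unfolding one pvar_eq[OF one m] m[symmetric] by simp
  also have "\<dots> \<le> exp (l\<^sup>2 * pvar S (pmf p) f)" by (rule exp_ge_add_one_self)
  finally show ?thesis .
qed

text \<open>Chernoff's method with \<open>l = min (1/B) (sqrt (L / (n Var)))\<close>.\<close>

lemma bernstein_one_sided:
  fixes p :: "nat pmf" and J :: "'a set"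
  assumes p: "set_pmf p \<subseteq> {..<S}" and J: "finite J" "card J = n" and n: "n \<ge> 1"
    and B: "0 < B" "\<And>x y. x < S \<Longrightarrow> y < S \<Longrightarrow> f x - f y \<le> B" and L: "0 < L"
  shows "measure_pmf.prob (Pi_pmf J d (\<lambda>_. p))
    {Y. (\<Sum>j\<in>J. f (Y j)) / n - (\<Sum>x<S. pmf p x * f x)
        > 2 * sqrt (pvar S (pmf p) f * L / n) + 2 * B * L / n} \<le> exp (- L)"
proof -
  let ?M = "Pi_pmf J d (\<lambda>_. p)"
  define m where "m = (\<Sum>x<S. pmf p x * f x)"
  define v where "v = pvar S (pmf p) f"
  define t where "t = n * (2 * sqrt (v * L / n) + 2 * B * L / n)"
  have one: "(\<Sum>x<S. pmf p x) = 1" using p by (intro sum_pmf_eq_1) auto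
  have v: "v \<ge> 0" unfolding v_def using one by (intro pvar_nonneg) auto
  have t: "t = 2 * sqrt (n * v * L) + 2 * B * L"
  proof -
    have "real n * sqrt (v * L / n) = sqrt (n * v * L)"
      using n by (simp add: real_sqrt_divide real_sqrt_mult field_simps)
    then show ?thesis using n by (simp add: t_def algebra_simps)
  qed
  have fm: "f x - m \<le> B" if "x < S" for x
  proof -
    have "f x - m = (\<Sum>y<S. pmf p y * (f x - f y))"
      using one by (simp add: m_def algebra_simps sum_subtractf flip: sum_distrib_left)
    also have "\<dots> \<le> (\<Sum>y<S. pmf p y * B)"
      using B(2) that by (intro sum_mono mult_left_mono) auto
    also have "\<dots> = B" using one by (simp flip: sum_distrib_right)
    finally show ?thesis .
  qed
  \<comment> \<open>In either case \<open>n * (l^2 * v)\<close> is at most \<open>L\<close> and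
    \<open>l * t\<close> at least \<open>2 * L\<close>: the square-root term of \<open>t\<close>
    supplies the latter when the variance dominates, the linear term \<open>2 * B * L\<close>
    otherwise.\<close>
  obtain l where l: "0 \<le> l" "l * B \<le> 1" "n * (l\<^sup>2 * v) - l * t \<le> - L"
  proof (cases "B\<^sup>2 * L \<le> n * v")
    case True
    then have nv: "n * v > 0" using B(1) L by (smt (verit) mult_pos_pos zero_less_power)
    let ?l = "sqrt (L / (n * v))"
    have "(?l * B)\<^sup>2 \<le> 1\<^sup>2" using True nv L by (simp add: power_mult_distrib field_simps)
    then have "?l * B \<le> 1" by (rule power2_le_imp_le) simp
    moreover have "sqrt (L / w) * sqrt (w * L) = L" if "w > 0" for w
      using that L unfolding real_sqrt_mult[symmetric] by (simp add: power2_eq_square[symmetric])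
    from this[OF nv] have "?l * sqrt (n * v * L) = L" .
    then have "?l * t \<ge> 2 * L" unfolding t using B L nv
      by (simp add: distrib_left mult.left_commute[of ?l 2] del: real_sqrt_mult)
    moreover have "?l\<^sup>2 = L / (n * v)" using nv L by (intro real_sqrt_pow2 divide_nonneg_pos) auto
    then have "n * (?l\<^sup>2 * v) = L" using nv by auto
    ultimately show ?thesis using that[of ?l] nv L by simp
  next
    case False
    have "n * ((1 / B)\<^sup>2 * v) \<le> L"
      using False B(1) by (simp add: power_divide field_simps)
    moreover have "(1 / B) * t \<ge> 2 * L" unfolding t using B(1) v L
      by (simp add: add_divide_distrib)
    ultimately show ?thesis using that[of "1 / B"] B(1) by simp
  qed
  have fin: "finite (set_pmf ?M)"
  proof -
    have "finite (set_pmf p)" using p finite_subset by blast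
    then show ?thesis unfolding set_Pi_pmf[OF J(1)] using J(1) by (intro finite_PiE_dflt) auto
  qed
  let ?Z = "\<lambda>Y. \<Sum>j\<in>J. f (Y j) - m"
  have "measure_pmf.prob ?M {Y. (\<Sum>j\<in>J. f (Y j)) / n - m > 2 * sqrt (v * L / n) + 2 * B * L / n}
      \<le> measure_pmf.expectation ?M (\<lambda>Y. exp (l * ?Z Y - l * t))"
  proof -
    have "measure_pmf.expectation ?M
        (indicator {Y. (\<Sum>j\<in>J. f (Y j)) / n - m > 2 * sqrt (v * L / n) + 2 * B * L / n})
      \<le> measure_pmf.expectation ?M (\<lambda>Y. exp (l * ?Z Y - l * t))"
    proof (rule integral_mono)
      fix Y
      show "indicator {Y. (\<Sum>j\<in>J. f (Y j)) / n - m > 2 * sqrt (v * L / n) + 2 * B * L / n} Y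
          \<le> exp (l * ?Z Y - l * t)"
      proof (cases "(\<Sum>j\<in>J. f (Y j)) / n - m > 2 * sqrt (v * L / n) + 2 * B * L / n")
        case True
        then have "t \<le> n * ((\<Sum>j\<in>J. f (Y j)) / n - m)"
          unfolding t_def by (intro mult_left_mono) auto
        also have "\<dots> = ?Z Y" using n J by (simp add: sum_subtractf field_simps)
        finally have "l * t \<le> l * ?Z Y" using l(1) by (rule mult_left_mono)
        then show ?thesis by (simp add: indicator_def)
      qed simp
    qed (use fin in \<open>auto intro: integrable_measure_pmf_finite\<close>)
    then show ?thesis by simp
  qed
  also have "\<dots> = exp (- l * t) * measure_pmf.expectation ?M (\<lambda>Y. \<Prod>j\<in>J. exp (l * (f (Y j) - m)))"
    by (simp add: exp_diff exp_minus divide_inverse sum_distrib_left exp_sum[OF J(1)] mult.commute)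
  also have "measure_pmf.expectation ?M (\<lambda>Y. \<Prod>j\<in>J. exp (l * (f (Y j) - m)))
      = (\<Prod>j\<in>J. measure_pmf.expectation p (\<lambda>x. exp (l * (f x - m))))"
    by (rule expectation_prod_Pi_pmf[OF J(1)])
       (use p finite_subset in \<open>auto intro!: integrable_measure_pmf_finite\<close>)
  also have "\<dots> \<le> (\<Prod>j\<in>J. exp (l\<^sup>2 * v))"
  proof (intro prod_mono conjI)
    show "measure_pmf.expectation p (\<lambda>x. exp (l * (f x - m))) \<le> exp (l\<^sup>2 * v)"
      unfolding v_def
    proof (rule mgf_bound[OF p m_def l(1)])
      show "l * (f x - m) \<le> 1" if "x < S" for x
        using mult_left_mono[OF fm[OF that] l(1)] l(2) by linarith
    qed
  qed (auto intro: integral_nonneg_AE)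
  also have "(\<Prod>j\<in>J. exp (l\<^sup>2 * v)) = exp (n * (l\<^sup>2 * v))"
    using J(2) by (simp add: exp_of_nat_mult)
  also have "exp (- l * t) * exp (n * (l\<^sup>2 * v)) = exp (n * (l\<^sup>2 * v) - l * t)"
    by (simp add: exp_diff exp_minus field_simps)
  also have "\<dots> \<le> exp (- L)" using l(3) by simp
  finally show ?thesis by (simp add: m_def v_def)
qed

lemma bernstein:
  fixes p :: "nat pmf" and J :: "'a set"
  assumes p: "set_pmf p \<subseteq> {..<S}" and J: "finite J" "card J = n" and n: "n \<ge> 1"
    and B: "0 < B" "\<And>x y. x < S \<Longrightarrow> y < S \<Longrightarrow> f x - f y \<le> B" and L: "0 < L"
  shows "measure_pmf.prob (Pi_pmf J d (\<lambda>_. p))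
    {Y. \<bar>(\<Sum>j\<in>J. f (Y j)) / n - (\<Sum>x<S. pmf p x * f x)\<bar>
        > 2 * sqrt (pvar S (pmf p) f * L / n) + 2 * B * L / n} \<le> 2 * exp (- L)"
proof -
  let ?e = "2 * sqrt (pvar S (pmf p) f * L / n) + 2 * B * L / n"
  let ?M = "Pi_pmf J d (\<lambda>_. p)"
  let ?A = "\<lambda>f. {Y. (\<Sum>j\<in>J. f (Y j)) / n - (\<Sum>x<S. pmf p x * f x) > ?e}"
  have 1: "measure_pmf.prob ?M (?A f) \<le> exp (- L)"
    by (rule bernstein_one_sided[OF p J n B L])
  have 2: "measure_pmf.prob ?M (?A (\<lambda>x. - f x)) \<le> exp (- L)"
    using bernstein_one_sided[OF p J n B(1) _ L, of "\<lambda>x. - f x" d] B(2)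
    unfolding pvar_uminus by fastforce
  have "measure_pmf.prob ?M {Y. \<bar>(\<Sum>j\<in>J. f (Y j)) / n - (\<Sum>x<S. pmf p x * f x)\<bar> > ?e}
      \<le> measure_pmf.prob ?M (?A f \<union> ?A (\<lambda>x. - f x))"
    by (rule measure_pmf.finite_measure_mono) (auto simp: sum_negf)
  also have "\<dots> \<le> measure_pmf.prob ?M (?A f) + measure_pmf.prob ?M (?A (\<lambda>x. - f x))"
    by (rule measure_Un_le) auto
  finally show ?thesis using 1 2 by linarith
qed

text \<open>Integrating over the second component last turns a statement about a random function
  into one about a fixed function; a uniform conditional bound survives the averaging.\<close>

lemma prob_pair_pmf_le:
  assumes "\<And>b. b \<in> set_pmf N \<Longrightarrow> measure_pmf.prob M {a. (a, b) \<in> Z} \<le> c" "0 \<le> c"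
  shows "measure_pmf.prob (pair_pmf M N) Z \<le> c"
proof -
  have "emeasure (pair_pmf M N) Z = (\<integral>\<^sup>+b. emeasure M {a. (a, b) \<in> Z} \<partial>N)"
  proof -
    have "emeasure (pair_pmf M N) Z = (\<integral>\<^sup>+x. indicator Z x \<partial>pair_pmf M N)" by simp
    also have "\<dots> = (\<integral>\<^sup>+x. indicator Z x \<partial>map_pmf (\<lambda>(x, y). (y, x)) (pair_pmf N M))"
      by (subst pair_commute_pmf) (rule refl)
    also have "\<dots> = (\<integral>\<^sup>+b. \<integral>\<^sup>+a. indicator Z (a, b) \<partial>M \<partial>N)"
      by (simp add: nn_integral_pair_pmf' case_prod_unfold)
    also have "\<dots> = (\<integral>\<^sup>+b. emeasure M {a. (a, b) \<in> Z} \<partial>N)"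
    proof (rule nn_integral_cong)
      fix b
      have "(\<integral>\<^sup>+a. indicator Z (a, b) \<partial>M) = (\<integral>\<^sup>+a. indicator {a. (a, b) \<in> Z} a \<partial>M)"
        by (intro nn_integral_cong) (simp add: indicator_def)
      then show "(\<integral>\<^sup>+a. indicator Z (a, b) \<partial>M) = emeasure M {a. (a, b) \<in> Z}" by simp
    qed
    finally show ?thesis .
  qed
  also have "\<dots> \<le> (\<integral>\<^sup>+b. ennreal c \<partial>N)"
    using assms by (intro nn_integral_mono_AE) (auto simp: AE_measure_pmf_iff measure_pmf.emeasure_eq_measure intro!: ennreal_leI)
  also have "\<dots> = ennreal c" by (simp add: measure_pmf.emeasure_space_1[simplified])
  finally show ?thesis using assms(2) by (simp add: measure_pmf.emeasure_eq_measure)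
qed

lemma emp_kernel_average:
  assumes "n \<ge> 1" "\<And>j. j < n \<Longrightarrow> X (s, a, j) < S"
  shows "(\<Sum>s'<S. emp_kernel n X s a s' * f s') = (\<Sum>j<n. f (X (s, a, j))) / n"
proof -
  have "(\<Sum>s'<S. emp_kernel n X s a s' * f s')
      = (\<Sum>s'<S. \<Sum>j<n. if X (s, a, j) = s' then f s' else 0) / n"
  proof -
    have "real (card {j. j < n \<and> X (s, a, j) = s'}) * f s' = (\<Sum>j<n. if X (s, a, j) = s' then f s' else 0)" for s'
      by (simp add: sum.If_cases Int_def)
    then show ?thesis by (simp add: emp_kernel_def sum_divide_distrib)
  qed
  also have "(\<Sum>s'<S. \<Sum>j<n. if X (s, a, j) = s' then f s' else 0) = (\<Sum>j<n. f (X (s, a, j)))"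
    by (subst sum.swap, rule sum.cong) (use assms(2) in \<open>auto simp: sum.delta'\<close>)
  finally show ?thesis .
qed

lemma sample_pmf_range:
  assumes "X \<in> set_pmf (sample_pmf S A n P)" "\<And>s a. s < S \<Longrightarrow> a < A \<Longrightarrow> set_pmf (P s a) \<subseteq> {..<S}"
    "s < S" "a < A" "j < n"
  shows "X (s, a, j) < S"
proof -
  have "X (s, a, j) \<in> set_pmf (P s a)"
    using assms(1,3-5) unfolding sample_pmf_def by (subst (asm) set_Pi_pmf) (auto simp: PiE_dflt_def)
  then show ?thesis using assms(2)[OF assms(3,4)] by auto
qed

text \<open>The samples outside the block of \<open>(s, a)\<close> determine \<open>G X\<close>.
  Conditionally on them \<open>G X\<close> is a fixed function and the block still consists of n
  independent draws from \<open>P s a\<close>, so the bound for a fixed function applies.\<close>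

lemma bernstein_leave_one_out:
  assumes P: "\<And>s a. s < S \<Longrightarrow> a < A \<Longrightarrow> set_pmf (P s a) \<subseteq> {..<S}" and sa: "s < S" "a < A"
    and n: "n \<ge> 1" and L: "0 < L" and B: "0 < B"
    and G: "\<And>X x y. x < S \<Longrightarrow> y < S \<Longrightarrow> X \<in> set_pmf (sample_pmf S A n P) \<Longrightarrow> G X x - G X y \<le> B"
    and indep: "\<And>X X'. (\<And>s' a' j. (s', a') \<noteq> (s, a) \<Longrightarrow> X (s', a', j) = X' (s', a', j)) \<Longrightarrow> G X = G X'"
  shows "measure_pmf.prob (sample_pmf S A n P)
    {X. \<bar>(\<Sum>x<S. emp_kernel n X s a x * G X x) - (\<Sum>x<S. pmf (P s a) x * G X x)\<bar>
      > 2 * sqrt (pvar S (pmf (P s a)) (G X) * L / n) + 2 * B * L / n} \<le> 2 * exp (- L)"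
    (is "measure_pmf.prob _ ?Bad \<le> _")
proof -
  define I where "I = {..<S} \<times> {..<A} \<times> {..<n}"
  define J where "J = {s} \<times> {a} \<times> {..<n}"
  define p where "p = (\<lambda>(s, a, j :: nat). P s a)"
  let ?N = "pair_pmf (Pi_pmf J undefined p) (Pi_pmf (I - J) undefined p)"
  define mix where "mix = (\<lambda>(Y :: nat \<times> nat \<times> nat \<Rightarrow> nat, Z) x. if x \<in> J then Y x else Z x)"
  have J: "finite J" "card J = n" by (auto simp: J_def card_cartesian_product)
  have I: "finite I" "I = J \<union> (I - J)" using sa by (auto simp: I_def J_def)
  have sample: "sample_pmf S A n P = map_pmf mix ?N"
  proof -
    have "sample_pmf S A n P = Pi_pmf (J \<union> (I - J)) undefined p"
      unfolding sample_pmf_def p_def I(2)[symmetric] by (simp add: I_def)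
    also have "\<dots> = map_pmf mix ?N"
      unfolding mix_def using I J by (subst Pi_pmf_union) auto
    finally show ?thesis .
  qed
  have pJ: "Pi_pmf J undefined p = Pi_pmf J undefined (\<lambda>_. P s a)"
    by (rule Pi_pmf_cong) (auto simp: J_def p_def)
  \<comment> \<open>An arbitrary filling of the block: it names the common value of \<open>G\<close>
    and supplies the sample at which its range bound is read off.\<close>
  obtain Y0 where Y0: "Y0 \<in> set_pmf (Pi_pmf J undefined p)" using set_pmf_not_empty by fastforce
  \<comment> \<open>Restricting to the support loses no probability and guarantees that all samples
    are states.\<close>
  have "measure_pmf.prob ?N 
      (mix -` ?Bad \<inter> set_pmf ?N)
      \<le> 2 * exp (- L)"
  proof (rule prob_pair_pmf_le)
    fix Z assume Z: "Z \<in> set_pmf (Pi_pmf (I - J) undefined p)"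
    have in_sample: "mix (Y, Z) \<in> set_pmf (sample_pmf S A n P)" if "Y \<in> set_pmf (Pi_pmf J undefined p)" for Y
      unfolding sample using Z that by auto
    define g where "g = G (mix (Y0, Z))"
    have g: "G (mix (Y, Z)) = g" for Y
      unfolding g_def by (rule indep) (auto simp: mix_def J_def)
    have "{Y. (Y, Z) \<in> (mix -` ?Bad \<inter> set_pmf ?N)}
      \<subseteq> {Y. \<bar>(\<Sum>j\<in>J. g (Y j)) / n - (\<Sum>x<S. pmf (P s a) x * g x)\<bar>
        > 2 * sqrt (pvar S (pmf (P s a)) g * L / n) + 2 * B * L / n}"
    proof safe
      fix Y assume Y: "(Y, Z) \<in> set_pmf ?N"
        and bad: "\<bar>(\<Sum>x<S. emp_kernel n (mix (Y, Z)) s a x * G (mix (Y, Z)) x)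
            - (\<Sum>x<S. pmf (P s a) x * G (mix (Y, Z)) x)\<bar>
          > 2 * sqrt (pvar S (pmf (P s a)) (G (mix (Y, Z))) * L / n) + 2 * B * L / n"
      have "(\<Sum>x<S. emp_kernel n (mix (Y, Z)) s a x * g x) = (\<Sum>j<n. g (mix (Y, Z) (s, a, j))) / n"
        by (rule emp_kernel_average[OF n]) (use sample_pmf_range[OF in_sample P sa] Y in auto)
      also have "(\<Sum>j<n. g (mix (Y, Z) (s, a, j))) = (\<Sum>j\<in>J. g (Y j))"
        by (rule sum.reindex_bij_witness[of _ "\<lambda>(s, a, j). j" "\<lambda>j. (s, a, j)"])
           (auto simp: J_def mix_def)
      finally show "\<bar>(\<Sum>j\<in>J. g (Y j)) / n - (\<Sum>x<S. pmf (P s a) x * g x)\<bar>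
        > 2 * sqrt (pvar S (pmf (P s a)) g * L / n) + 2 * B * L / n"
        using bad unfolding g by simp
    qed
    then have "measure_pmf.prob (Pi_pmf J undefined p)
        {Y. (Y, Z) \<in> (mix -` ?Bad \<inter> set_pmf ?N)}
      \<le> measure_pmf.prob (Pi_pmf J undefined p)
        {Y. \<bar>(\<Sum>j\<in>J. g (Y j)) / n - (\<Sum>x<S. pmf (P s a) x * g x)\<bar>
          > 2 * sqrt (pvar S (pmf (P s a)) g * L / n) + 2 * B * L / n}"
      by (rule measure_pmf.finite_measure_mono) simp
    also have "\<dots> \<le> 2 * exp (- L)"
      unfolding pJ
      by (rule bernstein[OF P[OF sa] J n B _ L]) (use G[OF _ _ in_sample[OF Y0]] in \<open>auto simp: g_def\<close>)
    finally show "measure_pmf.prob (Pi_pmf J undefined p)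
        {Y. (Y, Z) \<in> (mix -` ?Bad \<inter> set_pmf ?N)}
      \<le> 2 * exp (- L)" .
  qed simp
  moreover have "measure_pmf.prob (sample_pmf S A n P) ?Bad = measure_pmf.prob ?N (mix -` ?Bad)"
    unfolding sample by simp
  ultimately show ?thesis unfolding measure_Int_set_pmf by simp
qed

section \<open>Clipped value iteration\<close>

lemma lessThan_nonempty: "N \<ge> 1 \<Longrightarrow> {..<N} \<noteq> ({} :: nat set)"
  by (auto simp: lessThan_empty_iff)

lemma Min_image_le: "s < S \<Longrightarrow> Min (f ` {..<S}) \<le> f s" for f :: "nat \<Rightarrow> real"
  by (rule Min_le) auto

lemma Max_image_ge: "s < S \<Longrightarrow> f s \<le> Max (f ` {..<S})" for f :: "nat \<Rightarrow> real"
  by (rule Max_ge) auto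

lemma Min_image_ge: "S \<ge> 1 \<Longrightarrow> (\<And>s. s < S \<Longrightarrow> c \<le> f s) \<Longrightarrow> c \<le> Min (f ` {..<S})"
  for f :: "nat \<Rightarrow> real"
  using lessThan_nonempty[of S] by (subst Min_ge_iff) auto

lemma Max_image_le: "S \<ge> 1 \<Longrightarrow> (\<And>s. s < S \<Longrightarrow> f s \<le> c) \<Longrightarrow> Max (f ` {..<S}) \<le> c"
  for f :: "nat \<Rightarrow> real"
  using lessThan_nonempty[of S] by (subst Max_le_iff) auto

lemma Max_image_le_shift:
  fixes f g :: "nat \<Rightarrow> real"
  assumes "A \<ge> 1" "\<And>a. a < A \<Longrightarrow> f a \<le> g a + d"
  shows "Max (f ` {..<A}) \<le> Max (g ` {..<A}) + d"
  using assms(1)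
proof (rule Max_image_le)
  show "f a \<le> Max (g ` {..<A}) + d" if "a < A" for a
    using assms(2)[OF that] Max_image_ge[OF that, of g] by linarith
qed

lemma Min_image_le_shift:
  fixes f g :: "nat \<Rightarrow> real"
  assumes "A \<ge> 1" "\<And>a. a < A \<Longrightarrow> f a \<le> g a + d"
  shows "Min (f ` {..<A}) \<le> Min (g ` {..<A}) + d"
proof -
  have "Min (f ` {..<A}) - d \<le> Min (g ` {..<A})"
    using assms(1)
  proof (rule Min_image_ge)
    show "Min (f ` {..<A}) - d \<le> g a" if "a < A" for a
      using assms(2)[OF that] Min_image_le[OF that, of f] by linarith
  qed
  then show ?thesis by simp
qed

lemma Min_image_attained:
  fixes f :: "nat \<Rightarrow> real"
  assumes "S \<ge> 1"
  obtains s where "s < S" "Min (f ` {..<S}) = f s"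
proof -
  have "Min (f ` {..<S}) \<in> f ` {..<S}" using lessThan_nonempty[OF assms] by (intro Min_in) auto
  then show ?thesis using that by auto
qed

definition plan_op :: "nat \<Rightarrow> nat \<Rightarrow> (nat \<Rightarrow> nat \<Rightarrow> nat \<Rightarrow> real) \<Rightarrow> (nat \<Rightarrow> nat \<Rightarrow> real) \<Rightarrow> real \<Rightarrow> real
    \<Rightarrow> (nat \<Rightarrow> real) \<Rightarrow> nat \<Rightarrow> real" where
  "plan_op S A K r \<gamma> M V = clip S M (bellman S A K r \<gamma> V)"

lemma plan_V_eq: "plan_V S A K r \<gamma> M \<epsilon> = (plan_op S A K r \<gamma> M ^^ plan_iters \<gamma> \<epsilon>) (\<lambda>_. 0)"
proof -
  have "clip S M \<circ> bellman S A K r \<gamma> = plan_op S A K r \<gamma> M" by (auto simp: plan_op_def)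
  then show ?thesis by (simp only: plan_V_def)
qed

text \<open>Rows may have mass below one: the leave-one-out construction zeroes a row.\<close>

locale span_planning =
  fixes S A :: nat and K :: "nat \<Rightarrow> nat \<Rightarrow> nat \<Rightarrow> real" and r :: "nat \<Rightarrow> nat \<Rightarrow> real" and \<gamma> M :: real
  assumes S: "S \<ge> 1" and A: "A \<ge> 1"
    and K_nonneg: "\<And>s a s'. s < S \<Longrightarrow> a < A \<Longrightarrow> s' < S \<Longrightarrow> 0 \<le> K s a s'"
    and K_le_1: "\<And>s a. s < S \<Longrightarrow> a < A \<Longrightarrow> (\<Sum>s'<S. K s a s') \<le> 1"
    and \<gamma>: "0 \<le> \<gamma>" "\<gamma> < 1" and M: "0 \<le> M"
begin

abbreviation F where "F \<equiv> plan_op S A K r \<gamma> M"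

text \<open>A row of mass at most one turns a shift by \<open>d\<close> into a shift by at most
  \<open>d\<close> because \<open>d\<close> is nonnegative; two-sided bounds come from applying this
  in both directions.\<close>

lemma backup_shift:
  assumes "\<And>s. s < S \<Longrightarrow> V s \<le> W s + d" "0 \<le> d" "s < S" "a < A"
  shows "r s a + \<gamma> * (\<Sum>s'<S. K s a s' * V s') \<le> r s a + \<gamma> * (\<Sum>s'<S. K s a s' * W s') + \<gamma> * d"
proof -
  have "(\<Sum>s'<S. K s a s' * V s') \<le> (\<Sum>s'<S. K s a s' * (W s' + d))"
    using assms K_nonneg by (intro sum_mono mult_left_mono) auto
  also have "\<dots> = (\<Sum>s'<S. K s a s' * W s') + d * (\<Sum>s'<S. K s a s')"
    by (simp add: algebra_simps sum.distrib sum_distrib_left)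
  also have "\<dots> \<le> (\<Sum>s'<S. K s a s' * W s') + d"
    using mult_left_mono[OF K_le_1[OF assms(3,4)] assms(2)] by simp
  finally show ?thesis using mult_left_mono[OF _ \<gamma>(1)] by (fastforce simp: algebra_simps)
qed

text \<open>The one-sided form contains monotonicity (\<open>d = 0\<close>) and the contraction
  property at once. Clipping preserves it: both arguments of its minimum are shifted by at most
  \<open>\<gamma> * d\<close>.\<close>

lemma F_shift:
  assumes "\<And>s. s < S \<Longrightarrow> V s \<le> W s + d" "0 \<le> d" "s < S"
  shows "F V s \<le> F W s + \<gamma> * d"
proof -
  have B: "bellman S A K r \<gamma> V s \<le> bellman S A K r \<gamma> W s + \<gamma> * d" if "s < S" for s
    unfolding bellman_def by (rule Max_image_le_shift[OF A]) (rule backup_shift[OF assms(1,2) that])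
  have "Min (bellman S A K r \<gamma> V ` {..<S}) \<le> Min (bellman S A K r \<gamma> W ` {..<S}) + \<gamma> * d"
    using S B by (rule Min_image_le_shift)
  then show ?thesis using B[OF assms(3)] by (simp add: plan_op_def clip_def min_def)
qed

lemma F_pow_shift:
  assumes "\<And>s. s < S \<Longrightarrow> V s \<le> W s + d" "0 \<le> d" "s < S"
  shows "(F ^^ t) V s \<le> (F ^^ t) W s + \<gamma> ^ t * d"
  using assms(3)
proof (induction t arbitrary: s)
  case (Suc t)
  have "F ((F ^^ t) V) s \<le> F ((F ^^ t) W) s + \<gamma> * (\<gamma> ^ t * d)"
    by (rule F_shift) (use Suc assms \<gamma> in auto)
  then show ?case by (simp add: mult.assoc)
qed (use assms in simp)

lemma F_pow_lipschitz:
  assumes "\<And>s. s < S \<Longrightarrow> \<bar>V s - W s\<bar> \<le> d" "0 \<le> d" "s < S"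
  shows "\<bar>(F ^^ t) V s - (F ^^ t) W s\<bar> \<le> \<gamma> ^ t * d"
proof -
  have "V s \<le> W s + d" "W s \<le> V s + d" if "s < S" for s using assms(1)[OF that] by auto
  then have "(F ^^ t) V s \<le> (F ^^ t) W s + \<gamma> ^ t * d" "(F ^^ t) W s \<le> (F ^^ t) V s + \<gamma> ^ t * d"
    using assms(2,3) by (intro F_pow_shift; simp)+
  then show ?thesis by (simp add: abs_le_iff)
qed

text \<open>Summing a geometric series keeps the whole orbit of an approximate fixed point close to
  it; the argument can thus do without exact fixed points.\<close>

lemma F_pow_near:
  assumes "\<And>s. s < S \<Longrightarrow> \<bar>F V s - V s\<bar> \<le> d" "0 \<le> d" "s < S"
  shows "\<bar>(F ^^ t) V s - V s\<bar> \<le> d / (1 - \<gamma>)"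
  using assms(3)
proof (induction t arbitrary: s)
  case 0
  then show ?case using assms \<gamma> by simp
next
  case (Suc t)
  have "\<bar>F ((F ^^ t) V) s - F V s\<bar> \<le> \<gamma> * (d / (1 - \<gamma>))"
    using F_pow_lipschitz[of "(F ^^ t) V" V "d / (1 - \<gamma>)" s 1] Suc assms \<gamma> by simp
  then have "\<bar>F ((F ^^ t) V) s - V s\<bar> \<le> \<gamma> * (d / (1 - \<gamma>)) + d"
    using assms(1)[OF Suc.prems] by linarith
  also have "\<dots> = d / (1 - \<gamma>)" using \<gamma> by (simp add: field_simps)
  finally show ?case by simp
qed

text \<open>As \<open>M\<close> is nonnegative, the cap lies above the minimum, so clipping keeps
  the minimum while limiting every entry to \<open>M\<close> plus it.\<close>

lemma F_span:
  assumes "s < S" "s' < S"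
  shows "F V s \<le> F V s' + M"
proof -
  have "F V s \<le> M + Min (bellman S A K r \<gamma> V ` {..<S})"
    by (simp add: plan_op_def clip_def)
  also have "Min (bellman S A K r \<gamma> V ` {..<S}) \<le> F V s'"
    using Min_image_le[OF assms(2)] M by (simp add: plan_op_def clip_def)
  finally show ?thesis by simp
qed

lemma F_pow_span:
  assumes "s < S" "s' < S"
  shows "(F ^^ t) (\<lambda>_. 0) s \<le> (F ^^ t) (\<lambda>_. 0) s' + M"
proof (cases t)
  case (Suc k)
  then show ?thesis using F_span[OF assms, of "(F ^^ k) (\<lambda>_. 0)"] by simp
qed (use M in simp)

lemma F_le_backup:
  assumes "s < S" "\<And>b. b < A \<Longrightarrow> r s b + \<gamma> * (\<Sum>s'<S. K s b s' * V s') \<le> q"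
  shows "F V s \<le> q"
proof -
  have "F V s \<le> bellman S A K r \<gamma> V s" by (simp add: plan_op_def clip_def)
  also have "\<dots> \<le> q" unfolding bellman_def using A assms(2) by (rule Max_image_le)
  finally show ?thesis .
qed

text \<open>Every entry of \<open>bellman U\<close> is at least some \<open>U s'\<close>, hence at
  least \<open>U s - M\<close> by the span condition, so the cap of the clip lies above
  \<open>U s\<close>.\<close>

lemma subsolution_F:
  assumes sub: "\<And>s. s < S \<Longrightarrow> U s \<le> bellman S A K r \<gamma> U s"
    and span: "\<And>s s'. s < S \<Longrightarrow> s' < S \<Longrightarrow> U s \<le> U s' + M" and s: "s < S"
  shows "U s \<le> F U s"
proof -
  have "U s - M \<le> Min (bellman S A K r \<gamma> U ` {..<S})"
    using S by (rule Min_image_ge) (use sub span[OF s] in \<open>smt (verit)\<close>)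
  then show ?thesis using sub[OF s] by (simp add: plan_op_def clip_def)
qed

lemma subsolution_F_pow:
  assumes "\<And>s. s < S \<Longrightarrow> U s \<le> F U s" "s < S"
  shows "U s \<le> (F ^^ t) U s"
  using assms(2)
proof (induction t arbitrary: s)
  case (Suc t)
  have "F U s \<le> F ((F ^^ t) U) s + \<gamma> * 0"
    by (rule F_shift) (use Suc in auto)
  then show ?case using assms(1)[OF Suc.prems] by simp
qed simp

context
  assumes r: "\<And>s a. s < S \<Longrightarrow> a < A \<Longrightarrow> 0 \<le> r s a \<and> r s a \<le> 1"
begin

lemma F_bounds:
  assumes "\<And>s. s < S \<Longrightarrow> 0 \<le> V s \<and> V s \<le> b" "0 \<le> b" "s < S"
  shows "0 \<le> F V s \<and> F V s \<le> 1 + \<gamma> * b"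
proof -
  have q: "0 \<le> r s a + \<gamma> * (\<Sum>s'<S. K s a s' * V s')" "r s a + \<gamma> * (\<Sum>s'<S. K s a s' * V s') \<le> 1 + \<gamma> * b"
    if "s < S" "a < A" for s a
  proof -
    show "0 \<le> r s a + \<gamma> * (\<Sum>s'<S. K s a s' * V s')"
      using r[OF that] assms(1) K_nonneg[OF that] \<gamma> by (auto intro!: add_nonneg_nonneg mult_nonneg_nonneg sum_nonneg)
    show "r s a + \<gamma> * (\<Sum>s'<S. K s a s' * V s') \<le> 1 + \<gamma> * b"
      using backup_shift[of V "\<lambda>_. 0" b s a] assms r[OF that] that by auto
  qed
  have B: "0 \<le> bellman S A K r \<gamma> V s" if "s < S" for s
  proof -
    have "0 \<le> r s 0 + \<gamma> * (\<Sum>s'<S. K s 0 s' * V s')" using q(1)[OF that] A by simp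
    also have "\<dots> \<le> bellman S A K r \<gamma> V s"
      unfolding bellman_def using A by (intro Max_image_ge) simp
    finally show ?thesis .
  qed
  have "0 \<le> Min (bellman S A K r \<gamma> V ` {..<S})"
    using S by (rule Min_image_ge) (rule B)
  then have "0 \<le> F V s" using B[OF assms(3)] M by (simp add: plan_op_def clip_def)
  moreover have "F V s \<le> 1 + \<gamma> * b" by (rule F_le_backup[OF assms(3)]) (rule q(2)[OF assms(3)])
  ultimately show ?thesis ..
qed

lemma F_pow_bounds:
  assumes "s < S"
  shows "0 \<le> (F ^^ t) (\<lambda>_. 0) s \<and> (F ^^ t) (\<lambda>_. 0) s \<le> 1 / (1 - \<gamma>)"
  using assms
proof (induction t arbitrary: s)
  case (Suc t)
  have "0 \<le> F ((F ^^ t) (\<lambda>_. 0)) s \<and> F ((F ^^ t) (\<lambda>_. 0)) s \<le> 1 + \<gamma> * (1 / (1 - \<gamma>))"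
    by (rule F_bounds) (use Suc \<gamma> in auto)
  moreover have "1 + \<gamma> * (1 / (1 - \<gamma>)) = 1 / (1 - \<gamma>)" using \<gamma> by (simp add: field_simps)
  ultimately show ?case by simp
qed (use \<gamma> in simp)

text \<open>Commuting \<open>F\<close> through the iteration makes the residual the
  \<open>t\<close>-fold contraction of the distance between \<open>F 0\<close> and 0, which rewards
  in [0, 1] keep at most 1.\<close>

lemma F_pow_residual:
  assumes "s < S"
  shows "\<bar>F ((F ^^ t) (\<lambda>_. 0)) s - (F ^^ t) (\<lambda>_. 0) s\<bar> \<le> \<gamma> ^ t"
proof -
  have "\<bar>(F ^^ t) (F (\<lambda>_. 0)) s - (F ^^ t) (\<lambda>_. 0) s\<bar> \<le> \<gamma> ^ t * 1"
    by (rule F_pow_lipschitz) (use F_bounds[of "\<lambda>_. 0" 0] assms in auto)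
  then show ?thesis by (simp only: funpow_swap1 mult_1_right)
qed

end

end

section \<open>Leave-one-out perturbation of the planning operator\<close>

definition zero_row :: "nat \<Rightarrow> nat \<Rightarrow> (nat \<Rightarrow> nat \<Rightarrow> nat \<Rightarrow> real) \<Rightarrow> nat \<Rightarrow> nat \<Rightarrow> nat \<Rightarrow> real" where
  "zero_row s0 a0 K s a s' = (if s = s0 \<and> a = a0 then 0 else K s a s')"

text \<open>Combined with \<open>zero_row\<close> and \<open>c = \<gamma> * u\<close>, the backup at
  the pair becomes \<open>r s a + \<gamma> * u\<close> for every V: the expected next value is
  replaced by the constant \<open>u\<close>.\<close>

definition add_reward :: "nat \<Rightarrow> nat \<Rightarrow> real \<Rightarrow> (nat \<Rightarrow> nat \<Rightarrow> real) \<Rightarrow> nat \<Rightarrow> nat \<Rightarrow> real" where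
  "add_reward s0 a0 c r s a = (if s = s0 \<and> a = a0 then r s a + c else r s a)"

lemma planning_zero_row:
  assumes "span_planning S A K \<gamma> M"
  shows "span_planning S A (zero_row s0 a0 K) \<gamma> M"
proof -
  interpret span_planning S A K r \<gamma> M by (rule assms)
  show ?thesis
  proof
    show "(\<Sum>s'<S. zero_row s0 a0 K s a s') \<le> 1" if "s < S" "a < A" for s a
      using K_le_1[OF that] unfolding zero_row_def
      by (cases "s = s0 \<and> a = a0") (simp_all only: if_True if_False simp_thms, simp)
  qed (use S A \<gamma> M K_nonneg in \<open>auto simp: zero_row_def\<close>)
qed

text \<open>At \<open>V\<close> the two operators differ by at most \<epsilon>, and \<open>V\<close>
  is fixed by its own operator up to \<open>\<gamma> ^ t\<close>, so it is nearly fixed by the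
  modified one. The second \<open>\<gamma> ^ t\<close> pays for starting the modified iteration at 0
  instead of at \<open>V\<close>.\<close>

lemma leave_one_out_near:
  assumes P: "span_planning S A K \<gamma> M" and s0: "s0 < S" "a0 < A"
    and r: "\<And>s a. s < S \<Longrightarrow> a < A \<Longrightarrow> 0 \<le> r s a \<and> r s a \<le> 1"
    and V: "V = (plan_op S A K r \<gamma> M ^^ t) (\<lambda>_. 0)"
    and V': "V' = (plan_op S A (zero_row s0 a0 K) (add_reward s0 a0 (\<gamma> * u) r) \<gamma> M ^^ t) (\<lambda>_. 0)"
    and u: "\<bar>(\<Sum>s'<S. K s0 a0 s' * V s') - u\<bar> \<le> \<epsilon>" and s: "s < S"
  shows "\<bar>V s - V' s\<bar> \<le> (2 * \<gamma> ^ t + \<epsilon>) / (1 - \<gamma>)"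
proof -
  interpret P: span_planning S A K r \<gamma> M by (rule P)
  let ?K = "zero_row s0 a0 K" and ?r = "add_reward s0 a0 (\<gamma> * u) r"
  interpret P': span_planning S A ?K ?r \<gamma> M by (rule planning_zero_row[OF P])
  have e: "\<epsilon> \<ge> 0" using u by linarith
  have q: "\<bar>(r s a + \<gamma> * (\<Sum>s'<S. K s a s' * V s')) - (?r s a + \<gamma> * (\<Sum>s'<S. ?K s a s' * V s'))\<bar> \<le> \<epsilon>"
    if "a < A" for s a
  proof (cases "s = s0 \<and> a = a0")
    case True
    have "(r s a + \<gamma> * (\<Sum>s'<S. K s a s' * V s')) - (?r s a + \<gamma> * (\<Sum>s'<S. ?K s a s' * V s'))
      = \<gamma> * ((\<Sum>s'<S. K s0 a0 s' * V s') - u)"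
      using True by (simp add: zero_row_def add_reward_def algebra_simps)
    moreover have "\<gamma> * \<bar>(\<Sum>s'<S. K s0 a0 s' * V s') - u\<bar> \<le> 1 * \<epsilon>"
      using u P.\<gamma> by (intro mult_mono) auto
    ultimately show ?thesis using P.\<gamma> by (simp add: abs_mult)
  next
    case False
    then show ?thesis using e by (auto simp: zero_row_def add_reward_def)
  qed
  have B1: "bellman S A K r \<gamma> V s \<le> bellman S A ?K ?r \<gamma> V s + \<epsilon>" for s
    unfolding bellman_def using P.A q by (intro Max_image_le_shift) (auto simp: abs_le_iff algebra_simps)
  have B2: "bellman S A ?K ?r \<gamma> V s \<le> bellman S A K r \<gamma> V s + \<epsilon>" for s
    unfolding bellman_def using P.A q by (intro Max_image_le_shift) (auto simp: abs_le_iff algebra_simps)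
  have FF: "\<bar>P'.F V s - P.F V s\<bar> \<le> \<epsilon>" for s
  proof -
    have "Min (bellman S A K r \<gamma> V ` {..<S}) \<le> Min (bellman S A ?K ?r \<gamma> V ` {..<S}) + \<epsilon>"
      using P.S B1 by (rule Min_image_le_shift)
    moreover have "Min (bellman S A ?K ?r \<gamma> V ` {..<S}) \<le> Min (bellman S A K r \<gamma> V ` {..<S}) + \<epsilon>"
      using P.S B2 by (rule Min_image_le_shift)
    ultimately show ?thesis using B1[of s] B2[of s]
      unfolding plan_op_def clip_def min_def by (simp add: abs_le_iff split: if_splits)
  qed
  have res: "\<bar>P'.F V s - V s\<bar> \<le> \<gamma> ^ t + \<epsilon>" if "s < S" for s
    using FF[of s] P.F_pow_residual[OF r that, of t] unfolding V[symmetric] by fastforce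
  have "\<bar>(P'.F ^^ t) V s - V s\<bar> \<le> (\<gamma> ^ t + \<epsilon>) / (1 - \<gamma>)"
    by (rule P'.F_pow_near) (use res s e P.\<gamma> in auto)
  moreover have "\<bar>(P'.F ^^ t) V s - V' s\<bar> \<le> \<gamma> ^ t * (1 / (1 - \<gamma>))"
    unfolding V' by (rule P'.F_pow_lipschitz) (use P.F_pow_bounds[OF r, of _ t] s P.\<gamma> in \<open>auto simp: V\<close>)
  ultimately have "\<bar>V s - V' s\<bar> \<le> (\<gamma> ^ t + \<epsilon>) / (1 - \<gamma>) + \<gamma> ^ t * (1 / (1 - \<gamma>))" by linarith
  also have "\<dots> = (2 * \<gamma> ^ t + \<epsilon>) / (1 - \<gamma>)" by (simp add: add_divide_distrib)
  finally show ?thesis .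
qed

text \<open>From \<open>\<gamma> \<le> exp (\<gamma> - 1)\<close> the contraction over
  \<open>T\<close> steps is at most \<open>exp (- T * (1 - \<gamma>))\<close>, and rounding up makes
  \<open>T * (1 - \<gamma>)\<close> at least the logarithm in \<open>plan_iters\<close>.\<close>

lemma plan_iters_error:
  assumes "0 \<le> \<gamma>" "\<gamma> < 1" "0 < \<epsilon>" 
  shows "\<gamma> ^ plan_iters \<gamma> \<epsilon> \<le> (1 - \<gamma>)\<^sup>2 * \<epsilon> / 3"
proof -
  let ?x = "3 / ((1 - \<gamma>)\<^sup>2 * \<epsilon>)" and ?T = "plan_iters \<gamma> \<epsilon>"
  have x: "?x > 0" using assms by simp
  have "\<gamma> \<le> exp (\<gamma> - 1)" using exp_ge_add_one_self[of "\<gamma> - 1"] by simp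
  then have "\<gamma> ^ ?T \<le> exp (\<gamma> - 1) ^ ?T" using assms by (intro power_mono)
  also have "\<dots> = exp (real ?T * (\<gamma> - 1))" by (simp add: exp_of_nat_mult)
  also have "\<dots> \<le> exp (- ln ?x)"
  proof -
    have "ln ?x / (1 - \<gamma>) \<le> real ?T" unfolding plan_iters_def by linarith
    then have "ln ?x \<le> real ?T * (1 - \<gamma>)" using assms by (simp add: pos_divide_le_eq)
    then show ?thesis by (simp add: algebra_simps)
  qed
  also have "\<dots> = inverse ?x" using x by (simp add: exp_minus)
  finally show ?thesis by simp
qed

section \<open>Gain of the greedy policy\<close>

text \<open>Linearises the square root of a variance, so that averaging operators, which are linear
  and monotone, can be applied to the bound; the weight \<open>c\<close> is tuned at each
  use.\<close>

lemma am_gm_sqrt: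
  fixes x y c :: real
  assumes "0 \<le> x" "0 \<le> y" "0 < c"
  shows "2 * sqrt (x * y) \<le> x * y / c + c"
proof -
  have "0 \<le> (sqrt (x * y) - c)\<^sup>2" by simp
  then have "2 * sqrt (x * y) * c \<le> x * y + c * c"
    using assms by (simp add: power2_diff power2_eq_square[of c])
  then show ?thesis using assms by (simp add: field_simps)
qed

lemma kstep_bounds:
  assumes "stoch S Pm" "s < S" "\<And>s. s < S \<Longrightarrow> 0 \<le> f s \<and> f s \<le> b"
  shows "0 \<le> kstep S Pm f s" "kstep S Pm f s \<le> b"
  using kstep_mono[OF assms(1,2), of "\<lambda>_. 0" f] kstep_mono[OF assms(1,2), of f "\<lambda>_. b"]
    kstep_const[OF assms(1,2)] assms(3) by auto

lemma gain_nonneg: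
  assumes "stoch S (pol_kernel A P pol)" "s < S" "\<And>s. s < S \<Longrightarrow> 0 \<le> pol_reward A r pol s"
  shows "0 \<le> gain S A P r pol s"
  using cesaro_mono[OF assms(1,2), of "\<lambda>_. 0"] cesaro_const[OF assms(1,2)] assms(3)
  unfolding gain_eq_cesaro by fastforce

lemma gain_le_1:
  assumes "stoch S (pol_kernel A P pol)" "s < S" "\<And>s. s < S \<Longrightarrow> pol_reward A r pol s \<le> 1"
  shows "gain S A P r pol s \<le> 1"
  using cesaro_mono[OF assms(1,2), of _ "\<lambda>_. 1"] cesaro_const[OF assms(1,2)] assms(3)
  unfolding gain_eq_cesaro by fastforce

text \<open>Under the stationary limit \<open>E\<close> the variance of \<open>v\<close> telescopes to
  \<open>E[(v - Pv) (v + Pv)] \<le> 2 M E[1 + D + e]\<close>, so the mean deviation \<open>x = E[D]\<close> satisfies a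
  self-bounding inequality.\<close>

lemma gain_ge_value:
  fixes q \<gamma> e m l M :: real
  assumes P: "\<And>a. a < A \<Longrightarrow> stoch S (\<lambda>s. P s a)" and d: "\<And>s. s < S \<Longrightarrow> d s < A"
    and r: "\<And>s a. s < S \<Longrightarrow> a < A \<Longrightarrow> 0 \<le> r s a \<and> r s a \<le> 1"
    and \<gamma>: "0 \<le> \<gamma>" "\<gamma> < 1" and m: "0 \<le> m"
    and v: "\<And>s. s < S \<Longrightarrow> 0 \<le> v s \<and> v s \<le> M"
    and sub: "\<And>s. s < S \<Longrightarrow> v s + (1 - \<gamma>) * m \<le> r s (d s) + \<gamma> * (\<Sum>s'<S. Q s (d s) s' * v s') + e"
    and dev: "\<And>s. s < S \<Longrightarrow> \<bar>(\<Sum>s'<S. Q s (d s) s' * v s') - (\<Sum>s'<S. P s (d s) s' * v s')\<bar>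
       \<le> sqrt (8 * pvar S (P s (d s)) v * l) + 3 * M * l"
    and l: "0 < l" and M: "0 < M" and q: "q = sqrt (M * l)" "q \<le> 1 / 96" and e: "0 \<le> e" "e \<le> q" and s: "s < S"
  shows "(1 - \<gamma>) * m - 8 * q \<le> gain S A P r (det_policy d) s"
proof -
  define PP where "PP = pol_kernel A P (det_policy d)"
  have PP: "stoch S PP" unfolding PP_def
    by (intro stoch_pol_kernel is_policy_det P d)
  have ks: "kstep S PP f s = (\<Sum>s'<S. P s (d s) s' * f s')" if "s < S" for f s
    unfolding PP_def using kstep_det_kernel[of d s A, OF d[OF that]] by (simp add: kstep_def)
  define E where "E = (\<lambda>f. cesaro S PP f s)"
  have Eadd: "E (\<lambda>s. f s + g s) = E f + E g" and Escale: "E (\<lambda>s. c * f s) = c * E f"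
    and Econst: "E (\<lambda>_. c) = c" and Ek: "E (kstep S PP f) = E f" for f g c
    unfolding E_def by (rule cesaro_add[OF PP s] cesaro_scale[OF PP s] cesaro_const[OF PP s] cesaro_kstep[OF PP s])+
  have Emono: "E f \<le> E g" if "\<And>s. s < S \<Longrightarrow> f s \<le> g s" for f g
    unfolding E_def using PP s that by (rule cesaro_mono)
  define D where "D = (\<lambda>s. \<bar>(\<Sum>s'<S. Q s (d s) s' * v s') - kstep S PP v s\<bar>)"
  define W where "W = (\<lambda>s. kstep S PP (\<lambda>s. (v s)\<^sup>2) s + (- 1) * (kstep S PP v s)\<^sup>2)"
  have q0: "q > 0" using q l M by simp
  have qq: "q * q = M * l" using q(1) l M by simp
  have W: "W s = pvar S (P s (d s)) v" if "s < S" for s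
    using that by (simp add: W_def pvar_def ks)
  have rd: "0 \<le> r s (d s)" "r s (d s) \<le> 1" if "s < S" for s
    using r[OF that d[OF that]] by auto
  \<comment> \<open>Weight \<open>2 * q\<close> in \<open>am_gm_sqrt\<close>: as
    \<open>q * q = M * l\<close>, the variance gets the coefficient \<open>q / M\<close>, which
    turns the later bound of order \<open>M\<close> on its mean into one of order
    \<open>q\<close>.\<close>
  have D_le: "D s \<le> (q / M) * W s + (2 * q + 3 * (q * q))" if s: "s < S" for s
  proof -
    have W0: "0 \<le> W s" unfolding W[OF s]
      using P[OF d[OF s]] s by (intro pvar_nonneg) (auto simp: stoch_def)
    have "D s \<le> sqrt (8 * W s * l) + 3 * M * l"
      using dev[OF s] by (simp add: D_def ks[OF s] W[OF s])
    also have "sqrt (8 * W s * l) = 2 * sqrt (W s * (2 * l))"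
      by (subst real_sqrt_four[symmetric], subst real_sqrt_mult[symmetric]) (simp add: mult.commute)
    also have "\<dots> \<le> W s * (2 * l) / (2 * q) + 2 * q"
      using W0 l q0 by (intro am_gm_sqrt) auto
    also have "W s * (2 * l) / (2 * q) = (q / M) * W s"
    proof -
      have "l / q = q / M" using qq q0 M by (simp add: field_simps)
      then have "W s * (l / q) = W s * (q / M)" by simp
      then show ?thesis by (simp add: mult.commute)
    qed
    finally show ?thesis using qq by simp
  qed
  have kb: "0 \<le> kstep S PP v s" "kstep S PP v s \<le> M" if "s < S" for s
    using kstep_bounds[OF PP that, of v M] v by auto
  have m0: "0 \<le> (1 - \<gamma>) * m" using \<gamma> m by simp
  \<comment> \<open>An upper bound on \<open>v - P v\<close> suffices, because it is multiplied by
    the nonnegative \<open>v + P v\<close>. The constant 1 bounds the reward.\<close>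
  have drift: "v s - kstep S PP v s \<le> 1 + D s + e" if s: "s < S" for s
  proof -
    have "\<gamma> * (\<Sum>s'<S. Q s (d s) s' * v s') \<le> \<gamma> * (kstep S PP v s + D s)"
      unfolding D_def using \<gamma> by (intro mult_left_mono) auto
    also have "\<dots> \<le> 1 * (kstep S PP v s + D s)"
      using \<gamma> kb[OF s] by (intro mult_right_mono) (auto simp: D_def)
    finally have *: "\<gamma> * (\<Sum>s'<S. Q s (d s) s' * v s') \<le> kstep S PP v s + D s" by simp
    have "v s \<le> r s (d s) + \<gamma> * (\<Sum>s'<S. Q s (d s) s' * v s') + e"
      by (rule order.trans[OF _ sub[OF s]]) (use m0 in simp)
    with * show ?thesis using rd(2)[OF s] by argo
  qed
  define x where "x = E D"
  have D0: "0 \<le> D s" for s by (simp add: D_def)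
  have x0: "0 \<le> x" using Emono[of "\<lambda>_. 0" D] D0 by (simp add: x_def Econst)
  have "E W \<le> 2 * M * (1 + x + e)"
  proof -
    have "E W = E (\<lambda>s. (v s)\<^sup>2 + (- 1) * (kstep S PP v s)\<^sup>2)"
      unfolding W_def Eadd Ek ..
    also have "\<dots> \<le> E (\<lambda>s. (2 * M) * (1 + D s + e))"
    proof (rule Emono)
      fix s assume s: "s < S"
      have "(v s)\<^sup>2 + (- 1) * (kstep S PP v s)\<^sup>2 = (v s - kstep S PP v s) * (v s + kstep S PP v s)"
        by (simp add: power2_eq_square algebra_simps)
      also have "\<dots> \<le> (1 + D s + e) * (v s + kstep S PP v s)"
        using drift[OF s] kb[OF s] v[OF s] by (intro mult_right_mono) auto
      also have "\<dots> \<le> (1 + D s + e) * (2 * M)"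
        using kb[OF s] v[OF s] D0 e by (intro mult_left_mono) auto
      finally show "(v s)\<^sup>2 + (- 1) * (kstep S PP v s)\<^sup>2 \<le> (2 * M) * (1 + D s + e)"
        by (simp add: mult.commute)
    qed
    also have "\<dots> = 2 * M * (1 + x + e)" unfolding Escale Eadd Econst x_def ..
    finally show ?thesis .
  qed
  then have "(q / M) * E W \<le> (q / M) * (2 * M * (1 + x + e))"
    using q0 M by (intro mult_left_mono) auto
  moreover have "x \<le> (q / M) * E W + (2 * q + 3 * (q * q))"
  proof -
    have "E D \<le> E (\<lambda>s. (q / M) * W s + (2 * q + 3 * (q * q)))" by (rule Emono) (rule D_le)
    then show ?thesis unfolding Eadd Escale Econst x_def .
  qed
  ultimately have x1: "x \<le> 2 * q * (1 + x + e) + (2 * q + 3 * (q * q))" using M by (simp add: algebra_simps)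
  have "q * x \<le> (1 / 96) * x" "q * e \<le> (1 / 96) * q" "q * q \<le> (1 / 96) * q"
    using mult_right_mono[OF q(2) x0] mult_right_mono[OF q(2), of q] q0
      order.trans[OF mult_left_mono[OF e(2), of q] mult_right_mono[OF q(2), of q]] by auto
  moreover have "x \<le> 4 * q + 2 * (q * x) + 2 * (q * e) + 3 * (q * q)"
    using x1 by (simp add: algebra_simps)
  \<comment> \<open>\<open>q \<le> 1 / 96\<close> absorbs the product \<open>q * x\<close> into the
    left side. The bound is generous; its 7 and the 1 from \<open>e\<close> make up the 8 of the
    conclusion.\<close>
  ultimately have x: "x \<le> 7 * q" using q0 by linarith
  have "(1 - \<gamma>) * m \<le> E (\<lambda>s. pol_reward A r (det_policy d) s + (\<gamma> * kstep S PP v s + ((- 1) * v s + (D s + e))))"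
  proof -
    have "E (\<lambda>_. (1 - \<gamma>) * m) \<le> E (\<lambda>s. pol_reward A r (det_policy d) s + (\<gamma> * kstep S PP v s + ((- 1) * v s + (D s + e))))"
    proof (rule Emono)
      fix s assume s: "s < S"
      have "\<gamma> * (\<Sum>s'<S. Q s (d s) s' * v s') \<le> \<gamma> * (kstep S PP v s + D s)"
        unfolding D_def using \<gamma> by (intro mult_left_mono) auto
      moreover have "\<gamma> * D s \<le> 1 * D s" using \<gamma> D0 by (intro mult_right_mono) auto
      ultimately show "(1 - \<gamma>) * m \<le> pol_reward A r (det_policy d) s + (\<gamma> * kstep S PP v s + ((- 1) * v s + (D s + e)))"
        using sub[OF s] pol_reward_det[of d s A, OF d[OF s]] by (simp add: algebra_simps)
    qed
    then show ?thesis unfolding Econst .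
  qed
  also have "\<dots> = gain S A P r (det_policy d) s + (\<gamma> * E v + (- 1 * E v + (x + e)))"
    unfolding Eadd Escale Ek Econst x_def gain_eq_cesaro by (simp add: E_def PP_def)
  also have "\<dots> \<le> gain S A P r (det_policy d) s + 8 * q"
  proof -
    have "0 \<le> E v" using Emono[of "\<lambda>_. 0" v] v by (simp add: Econst)
    then have "\<gamma> * E v \<le> 1 * E v" using \<gamma> by (intro mult_right_mono) auto
    then show ?thesis using x e by simp
  qed
  finally show ?thesis by simp
qed

section \<open>Discounted value of a comparison policy\<close>

definition disc :: "nat \<Rightarrow> (nat \<Rightarrow> nat \<Rightarrow> real) \<Rightarrow> real \<Rightarrow> (nat \<Rightarrow> real) \<Rightarrow> nat \<Rightarrow> real" where
  "disc S Pm \<gamma> f s = (\<Sum>t. \<gamma> ^ t * kpow S Pm t f s)"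

context
  fixes S :: nat and Pm :: "nat \<Rightarrow> nat \<Rightarrow> real" and \<gamma> :: real
  assumes Pm: "stoch S Pm" and \<gamma>: "0 \<le> \<gamma>" "\<gamma> < 1"
begin

lemma disc_summable:
  assumes "s < S"
  shows "summable (\<lambda>t. \<gamma> ^ t * kpow S Pm t f s)"
proof -
  obtain b where b: "b \<ge> 0" "\<And>s t. s < S \<Longrightarrow> \<bar>kpow S Pm t f s\<bar> \<le> b"
    using kpow_bounded[OF Pm, of f] by blast
  show ?thesis
  proof (rule summable_comparison_test')
    show "summable (\<lambda>t. \<gamma> ^ t * b)"
      using \<gamma> by (intro summable_mult2 summable_geometric) simp
    show "norm (\<gamma> ^ t * kpow S Pm t f s) \<le> \<gamma> ^ t * b" for t
      using b(2)[OF assms] \<gamma> by (auto simp: abs_mult intro!: mult_left_mono)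
  qed
qed

lemma disc_add: "s < S \<Longrightarrow> disc S Pm \<gamma> (\<lambda>s. f s + g s) s = disc S Pm \<gamma> f s + disc S Pm \<gamma> g s"
  unfolding disc_def by (subst suminf_add) (simp_all add: disc_summable kpow_add distrib_left)

lemma disc_scale: "s < S \<Longrightarrow> disc S Pm \<gamma> (\<lambda>s. c * f s) s = c * disc S Pm \<gamma> f s"
  unfolding disc_def
  by (subst suminf_mult[symmetric]) (simp_all add: disc_summable kpow_scale mult.left_commute)

lemma disc_mono:
  assumes "s < S" "\<And>s. s < S \<Longrightarrow> f s \<le> g s"
  shows "disc S Pm \<gamma> f s \<le> disc S Pm \<gamma> g s"
  unfolding disc_def using assms \<gamma>
  by (intro suminf_le disc_summable mult_left_mono kpow_mono[OF Pm]) auto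

lemma disc_const: "s < S \<Longrightarrow> disc S Pm \<gamma> (\<lambda>_. c) s = c / (1 - \<gamma>)"
  unfolding disc_def using \<gamma>
  by (simp add: kpow_const[OF Pm] suminf_mult2[symmetric] summable_geometric suminf_geometric)

lemma disc_eq_kstep_disc:
  assumes "s < S"
  shows "disc S Pm \<gamma> f s = f s + \<gamma> * kstep S Pm (disc S Pm \<gamma> f) s"
proof -
  have "disc S Pm \<gamma> f s = f s + (\<Sum>t. \<gamma> ^ Suc t * kpow S Pm (Suc t) f s)"
    using suminf_split_head[OF disc_summable[OF assms, of f]] by (simp add: disc_def)
  also have "(\<Sum>t. \<gamma> ^ Suc t * kpow S Pm (Suc t) f s)
      = (\<Sum>t. \<gamma> * (\<Sum>s'<S. Pm s s' * (\<gamma> ^ t * kpow S Pm t f s')))"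
    by (simp add: kpow_Suc kstep_def sum_distrib_left mult.assoc mult.left_commute)
  also have "\<dots> = \<gamma> * (\<Sum>t. \<Sum>s'<S. Pm s s' * (\<gamma> ^ t * kpow S Pm t f s'))"
    by (intro suminf_mult summable_sum summable_mult disc_summable) simp
  also have "(\<Sum>t. \<Sum>s'<S. Pm s s' * (\<gamma> ^ t * kpow S Pm t f s')) = (\<Sum>s'<S. \<Sum>t. Pm s s' * (\<gamma> ^ t * kpow S Pm t f s'))"
    by (intro suminf_sum summable_mult disc_summable) simp
  also have "\<dots> = kstep S Pm (disc S Pm \<gamma> f) s"
    unfolding kstep_def disc_def by (intro sum.cong refl suminf_mult disc_summable) simp
  finally show ?thesis .
qed

text \<open>Here the kernel acts on the argument. With \<open>R\<close> for the discounted sum it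
  reads \<open>R (P f) - R f = (1 - \<gamma>) * R (P f) - f\<close>, the discounted counterpart of
  telescoping; \<open>disc_eq_kstep_disc\<close> is instead the fixed-point equation of a value
  function.\<close>

lemma disc_eq_disc_kstep:
  assumes "s < S"
  shows "disc S Pm \<gamma> f s = f s + \<gamma> * disc S Pm \<gamma> (kstep S Pm f) s"
proof -
  have "disc S Pm \<gamma> f s = f s + (\<Sum>t. \<gamma> ^ Suc t * kpow S Pm (Suc t) f s)"
    using suminf_split_head[OF disc_summable[OF assms, of f]] by (simp add: disc_def)
  also have "(\<Sum>t. \<gamma> ^ Suc t * kpow S Pm (Suc t) f s) = \<gamma> * disc S Pm \<gamma> (kstep S Pm f) s"
    unfolding disc_def by (simp add: kpow_Suc2 mult.assoc suminf_mult disc_summable[OF assms])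
  finally show ?thesis .
qed

end

lemma pvar_le_any_center:
  assumes "(\<Sum>x<S. p x) = 1"
  shows "pvar S p f \<le> (\<Sum>x<S. p x * (f x - c)\<^sup>2)"
proof -
  define m where "m = (\<Sum>x<S. p x * f x)"
  have "(\<Sum>x<S. p x * (f x - c)\<^sup>2) = (\<Sum>x<S. p x * (f x)\<^sup>2) - 2 * c * (\<Sum>x<S. p x * f x) + c\<^sup>2 * (\<Sum>x<S. p x)"
    by (simp add: power2_diff algebra_simps sum.distrib sum_subtractf sum_distrib_left sum_distrib_right)
  also have "\<dots> = pvar S p f + (m - c)\<^sup>2"
    using assms by (simp add: pvar_def m_def power2_diff)
  finally show ?thesis by simp
qed

text \<open>Squaring is \<open>2 * B\<close>-Lipschitz on [0, B], and the variance of
  \<open>f^2\<close> is at most its mean squared distance from \<open>m^2\<close>, with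
  \<open>m\<close> the mean of \<open>f\<close>.\<close>

lemma pvar_square_le:
  assumes p: "\<And>x. x < S \<Longrightarrow> 0 \<le> p x" "(\<Sum>x<S. p x) = 1" and f: "\<And>x. x < S \<Longrightarrow> 0 \<le> f x \<and> f x \<le> B"
  shows "pvar S p (\<lambda>x. (f x)\<^sup>2) \<le> 4 * B\<^sup>2 * pvar S p f"
proof -
  define m where "m = (\<Sum>x<S. p x * f x)"
  have m: "0 \<le> m" "m \<le> B"
  proof -
    show "0 \<le> m" unfolding m_def using p f by (intro sum_nonneg mult_nonneg_nonneg) auto
    have "m \<le> (\<Sum>x<S. p x * B)" unfolding m_def using p f by (intro sum_mono mult_left_mono) auto
    then show "m \<le> B" using p(2) by (simp flip: sum_distrib_right)
  qed
  have "pvar S p (\<lambda>x. (f x)\<^sup>2) \<le> (\<Sum>x<S. p x * ((f x)\<^sup>2 - m\<^sup>2)\<^sup>2)"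
    by (rule pvar_le_any_center[OF p(2)])
  also have "\<dots> \<le> (\<Sum>x<S. p x * ((2 * B)\<^sup>2 * (f x - m)\<^sup>2))"
  proof (intro sum_mono mult_left_mono)
    fix x assume x: "x \<in> {..<S}"
    have "((f x)\<^sup>2 - m\<^sup>2)\<^sup>2 = (f x + m)\<^sup>2 * (f x - m)\<^sup>2"
      by (simp add: power_mult_distrib[symmetric] square_diff_square_factored power2_eq_square)
    also have "\<dots> \<le> (2 * B)\<^sup>2 * (f x - m)\<^sup>2"
      using f[of x] x m by (intro mult_right_mono power_mono) auto
    finally show "((f x)\<^sup>2 - m\<^sup>2)\<^sup>2 \<le> (2 * B)\<^sup>2 * (f x - m)\<^sup>2" .
  qed (use p in auto)
  also have "\<dots> = (2 * B)\<^sup>2 * pvar S p f"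
    unfolding pvar_eq[OF p(2) m_def] by (simp add: sum_distrib_left mult.left_commute)
  finally show ?thesis by (simp add: power_mult_distrib)
qed

lemma average_le_bellman:
  assumes "is_policy S A pol" "s < S" "A \<ge> 1"
  shows "(\<Sum>a<A. pol s a * (r s a + \<gamma> * (\<Sum>s'<S. K s a s' * V s'))) \<le> bellman S A K r \<gamma> V s"
proof -
  have "(\<Sum>a<A. pol s a * (r s a + \<gamma> * (\<Sum>s'<S. K s a s' * V s'))) \<le> (\<Sum>a<A. pol s a * bellman S A K r \<gamma> V s)"
    using assms(1,2) unfolding bellman_def is_policy_def
    by (intro sum_mono mult_left_mono Max_image_ge[of _ A "\<lambda>a. r s a + \<gamma> * (\<Sum>s'<S. K s a s' * V s')"]) auto
  also have "\<dots> = bellman S A K r \<gamma> V s"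
    using assms(1,2) by (simp add: is_policy_def flip: sum_distrib_right)
  finally show ?thesis .
qed

text \<open>Both the variance of \<open>h\<close> and its drift are controlled under the true
  kernel, where \<open>h\<close> solves the Poisson equation; the deviation bound for \<open>h\<^sup>2\<close> transfers the
  second moment to \<open>Q\<close>.\<close>

lemma discounted_value_near_gain:
  fixes q \<gamma> B l \<rho> :: real
  assumes A: "A \<ge> 1" and P: "\<And>a. a < A \<Longrightarrow> stoch S (\<lambda>s. P s a)" and Q: "\<And>a. a < A \<Longrightarrow> stoch S (\<lambda>s. Q s a)"
    and r: "\<And>s a. s < S \<Longrightarrow> a < A \<Longrightarrow> 0 \<le> r s a \<and> r s a \<le> 1"
    and pol: "is_policy S A pol"
    and \<gamma>: "0 \<le> \<gamma>" "\<gamma> < 1" and \<rho>: "0 \<le> \<rho>" "\<rho> \<le> 1"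
    and h: "\<And>s. s < S \<Longrightarrow> 0 \<le> h s \<and> h s \<le> B"
    and poisson: "\<And>s. s < S \<Longrightarrow> h s - kstep S (pol_kernel A P pol) h s = pol_reward A r pol s - \<rho>"
    and dev1: "\<And>s a. s < S \<Longrightarrow> a < A \<Longrightarrow> \<bar>(\<Sum>s'<S. Q s a s' * h s') - (\<Sum>s'<S. P s a s' * h s')\<bar>
       \<le> 2 * sqrt (pvar S (P s a) h * l) + 2 * B * l"
    and dev2: "\<And>s a. s < S \<Longrightarrow> a < A \<Longrightarrow> \<bar>(\<Sum>s'<S. Q s a s' * (h s')\<^sup>2) - (\<Sum>s'<S. P s a s' * (h s')\<^sup>2)\<bar>
       \<le> 2 * sqrt (pvar S (P s a) (\<lambda>s. (h s)\<^sup>2) * l) + 2 * B\<^sup>2 * l"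
    and l: "0 < l" and B: "0 < B" "(1 - \<gamma>) * B \<le> 1" and q: "q = sqrt (B * l)" "q \<le> 1 / 5"
  obtains U where "\<And>s. s < S \<Longrightarrow> U s \<le> bellman S A Q r \<gamma> U s"
    "\<And>s. s < S \<Longrightarrow> \<rho> - (1 - \<gamma>) * B - 6 * q \<le> (1 - \<gamma>) * U s"
    "\<And>s. s < S \<Longrightarrow> (1 - \<gamma>) * U s \<le> \<rho> + (1 - \<gamma>) * B + 6 * q"
    "\<And>s. s < S \<Longrightarrow> (1 - \<gamma>) * U s \<le> 1"
proof -
  define PP where "PP = pol_kernel A P pol"
  define QQ where "QQ = pol_kernel A Q pol"
  define rw where "rw = pol_reward A r pol"
  have PP: "stoch S PP" and QQ: "stoch S QQ"
    unfolding PP_def QQ_def by (intro stoch_pol_kernel P Q pol; assumption)+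
  have kP: "kstep S PP f s = (\<Sum>a<A. pol s a * (\<Sum>s'<S. P s a s' * f s'))"
    and kQ: "kstep S QQ f s = (\<Sum>a<A. pol s a * (\<Sum>s'<S. Q s a s' * f s'))" for f s
    unfolding PP_def QQ_def kstep_pol_kernel unfolding kstep_def by (rule refl)+
  have pl: "\<And>a. a < A \<Longrightarrow> 0 \<le> pol s a" "(\<Sum>a<A. pol s a) = 1" if "s < S" for s
    using pol that by (auto simp: is_policy_def)
  have q0: "q > 0" using q l B by simp
  have qq: "q * q = B * l" using q(1) l B by simp
  have q2: "q * q \<le> (1 / 5) * q" "q * q \<le> 1 / 25"
    using q0 q(2) mult_mono[of q "1/5" q "1/5"] by (auto intro!: mult_right_mono)
  define Vr where "Vr = (\<lambda>s a. pvar S (P s a) h)"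
  have Vr0: "0 \<le> Vr s a" if "s < S" "a < A" for s a
    unfolding Vr_def using P[OF that(2)] that by (intro pvar_nonneg) (auto simp: stoch_def)
  define VV where "VV = (\<lambda>s. \<Sum>a<A. pol s a * Vr s a)"
  define D where "D = (\<lambda>s. \<bar>kstep S QQ h s - kstep S PP h s\<bar>)"
  have D: "D s \<le> (q / (2 * B)) * VV s + (2 * q + 2 * (q * q))" if s: "s < S" for s
  proof -
    have "D s = \<bar>\<Sum>a<A. pol s a * ((\<Sum>s'<S. Q s a s' * h s') - (\<Sum>s'<S. P s a s' * h s'))\<bar>"
      by (simp add: D_def kP kQ sum_subtractf right_diff_distrib)
    also have "\<dots> \<le> (\<Sum>a<A. \<bar>pol s a * ((\<Sum>s'<S. Q s a s' * h s') - (\<Sum>s'<S. P s a s' * h s'))\<bar>)"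
      by (rule sum_abs)
    also have "\<dots> \<le> (\<Sum>a<A. pol s a * ((q / (2 * B)) * Vr s a + (2 * q + 2 * (q * q))))"
    proof (rule sum_mono)
      fix a assume a: "a \<in> {..<A}"
      have "\<bar>(\<Sum>s'<S. Q s a s' * h s') - (\<Sum>s'<S. P s a s' * h s')\<bar> \<le> 2 * sqrt (Vr s a * l) + 2 * B * l"
        using dev1[OF s, of a] a by (simp add: Vr_def)
      also have "2 * sqrt (Vr s a * l) \<le> Vr s a * l / (2 * q) + 2 * q"
        using Vr0[OF s] a l q0 by (intro am_gm_sqrt) auto
      also have "Vr s a * l / (2 * q) = (q / (2 * B)) * Vr s a"
      proof -
        have "l / q = q / B" using qq q0 B by (simp add: field_simps)
        moreover have "Vr s a * l / (2 * q) = Vr s a * (l / q) / 2" by simp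
        ultimately have "Vr s a * l / (2 * q) = Vr s a * (q / B) / 2" by simp
        then show ?thesis by (simp add: mult.commute)
      qed
      finally have "\<bar>(\<Sum>s'<S. Q s a s' * h s') - (\<Sum>s'<S. P s a s' * h s')\<bar>
        \<le> (q / (2 * B)) * Vr s a + (2 * q + 2 * (q * q))" using qq by simp
      then show "\<bar>pol s a * ((\<Sum>s'<S. Q s a s' * h s') - (\<Sum>s'<S. P s a s' * h s'))\<bar>
        \<le> pol s a * ((q / (2 * B)) * Vr s a + (2 * q + 2 * (q * q)))"
        using pl(1)[OF s, of a] a by (simp add: abs_mult mult_left_mono)
    qed
    also have "\<dots> = (q / (2 * B)) * (\<Sum>a<A. pol s a * Vr s a) + (\<Sum>a<A. pol s a) * (2 * q + 2 * (q * q))"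
      by (simp add: distrib_left sum.distrib sum_distrib_left sum_distrib_right mult.left_commute)
    finally show ?thesis using pl(2)[OF s] by (simp add: VV_def)
  qed
  \<comment> \<open>Self-bounding: the transfer of \<open>h^2\<close> to \<open>Q\<close>, with
    weight \<open>8 * B^2 * l\<close> in \<open>am_gm_sqrt\<close>, costs half of the variance
    itself, and moving it to the left produces the factor 2. The \<open>5 * B\<close> consists of
    \<open>4 * B\<close> from replacing \<open>P h\<close> by \<open>h\<close> and at most
    \<open>B\<close> from \<open>20 * B * (q * q)\<close>.\<close>
  have VV: "VV s \<le> 2 * (kstep S QQ (\<lambda>s. (h s)\<^sup>2) s + (- 1) * (h s)\<^sup>2) + 5 * B" if s: "s < S" for s
  proof -
    have Pa: "(\<Sum>s'<S. P s a s' * (h s')\<^sup>2) \<le> (\<Sum>s'<S. Q s a s' * (h s')\<^sup>2) + Vr s a / 2 + 10 * B * (q * q)"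
      if a: "a < A" for a
    proof -
      have "\<bar>(\<Sum>s'<S. Q s a s' * (h s')\<^sup>2) - (\<Sum>s'<S. P s a s' * (h s')\<^sup>2)\<bar>
          \<le> 2 * sqrt (pvar S (P s a) (\<lambda>s. (h s)\<^sup>2) * l) + 2 * B\<^sup>2 * l"
        by (rule dev2[OF s a])
      also have "sqrt (pvar S (P s a) (\<lambda>s. (h s)\<^sup>2) * l) \<le> sqrt (Vr s a * (4 * B\<^sup>2 * l))"
      proof -
        have "pvar S (P s a) (\<lambda>s. (h s)\<^sup>2) \<le> 4 * B\<^sup>2 * Vr s a"
          unfolding Vr_def using P[OF a] s h by (intro pvar_square_le) (auto simp: stoch_def)
        from mult_right_mono[OF this, of l] l show ?thesis by (simp add: mult.commute mult.left_commute)
      qed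
      also have "2 * sqrt (Vr s a * (4 * B\<^sup>2 * l)) \<le> Vr s a * (4 * B\<^sup>2 * l) / (8 * B\<^sup>2 * l) + 8 * B\<^sup>2 * l"
        using Vr0[OF s a] l B by (intro am_gm_sqrt) auto
      also have "Vr s a * (4 * B\<^sup>2 * l) / (8 * B\<^sup>2 * l) = Vr s a / 2"
        using l B by simp
      finally have "\<bar>(\<Sum>s'<S. Q s a s' * (h s')\<^sup>2) - (\<Sum>s'<S. P s a s' * (h s')\<^sup>2)\<bar> \<le> Vr s a / 2 + 10 * B\<^sup>2 * l"
        by (simp add: mult.commute mult.left_commute)
      moreover have "B\<^sup>2 * l = B * (q * q)" using qq by (simp add: power2_eq_square)
      ultimately show ?thesis by linarith
    qed
    \<comment> \<open>The variance averaged over actions contains the squares of the per-action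
      means; convexity passes to the mean under the policy kernel, which the Poisson equation
      controls.\<close>
    have jensen: "(kstep S PP h s)\<^sup>2 \<le> (\<Sum>a<A. pol s a * (\<Sum>s'<S. P s a s' * h s')\<^sup>2)"
      using pvar_nonneg[of A "pol s" "\<lambda>a. \<Sum>s'<S. P s a s' * h s'"] pl[OF s] by (simp add: pvar_def kP)
    have "VV s = (\<Sum>a<A. pol s a * (\<Sum>s'<S. P s a s' * (h s')\<^sup>2)) - (\<Sum>a<A. pol s a * (\<Sum>s'<S. P s a s' * h s')\<^sup>2)"
      by (simp add: VV_def Vr_def pvar_def right_diff_distrib sum_subtractf)
    also have "\<dots> \<le> (\<Sum>a<A. pol s a * ((\<Sum>s'<S. Q s a s' * (h s')\<^sup>2) + Vr s a / 2 + 10 * B * (q * q))) - (kstep S PP h s)\<^sup>2"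
      using pl(1)[OF s] Pa jensen by (intro diff_mono sum_mono mult_left_mono) auto
    also have "\<dots> = kstep S QQ (\<lambda>s. (h s)\<^sup>2) s + VV s / 2 + (\<Sum>a<A. pol s a) * (10 * B * (q * q)) - (kstep S PP h s)\<^sup>2"
      by (simp add: kQ VV_def distrib_left sum.distrib sum_divide_distrib sum_distrib_right)
    finally have 1: "VV s \<le> 2 * (kstep S QQ (\<lambda>s. (h s)\<^sup>2) s - (kstep S PP h s)\<^sup>2) + 20 * B * (q * q)"
      using pl(2)[OF s] by simp
    have hb: "0 \<le> kstep S PP h s" "kstep S PP h s \<le> B" by (rule kstep_bounds[OF PP s]; use h in auto)+
    have "(h s)\<^sup>2 - (kstep S PP h s)\<^sup>2 = (h s - kstep S PP h s) * (h s + kstep S PP h s)"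
      by (simp add: power2_eq_square algebra_simps)
    also have "\<dots> \<le> 1 * (2 * B)"
    proof (rule mult_mono)
      have "rw s \<le> (\<Sum>a<A. pol s a * 1)" unfolding rw_def pol_reward_def
        using pl(1)[OF s] r[OF s] by (intro sum_mono mult_left_mono) auto
      then show "h s - kstep S PP h s \<le> 1"
        using poisson[OF s] pl(2)[OF s] \<rho> by (simp add: PP_def rw_def)
    qed (use h[OF s] hb in auto)
    finally have 2: "(h s)\<^sup>2 - (kstep S PP h s)\<^sup>2 \<le> 2 * B" by simp
    have "20 * B * (q * q) \<le> 20 * B * (1 / 25)" using q2(2) B(1) by (intro mult_left_mono) auto
    then have "20 * B * (q * q) \<le> B" using B(1) by linarith
    with 1 2 show ?thesis by (simp only: distrib_left right_diff_distrib)
  qed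
  define R where "R = disc S QQ \<gamma>"
  note disc = disc_add[OF QQ \<gamma>, folded R_def] disc_scale[OF QQ \<gamma>, folded R_def] disc_const[OF QQ \<gamma>, folded R_def]
  note R_mono = disc_mono[OF QQ \<gamma>, folded R_def]
  have hQ: "(1 - \<gamma>) * R (kstep S QQ f) s \<le> b" "0 \<le> R (kstep S QQ f) s" 
    if s: "s < S" and f: "\<And>s. s < S \<Longrightarrow> 0 \<le> f s \<and> f s \<le> b" for s f b
  proof -
    have "R (kstep S QQ f) s \<le> R (\<lambda>_. b) s" "R (\<lambda>_. 0) s \<le> R (kstep S QQ f) s"
      using kstep_bounds[OF QQ _ f] by (intro R_mono[OF s]; simp)+
    then show "(1 - \<gamma>) * R (kstep S QQ f) s \<le> b" "0 \<le> R (kstep S QQ f) s" 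
      using \<gamma> by (simp_all add: disc[OF s] field_simps)
  qed
  have x: "(1 - \<gamma>) * R D s \<le> 6 * q" if s: "s < S" for s
  proof -
    define c0 where "c0 = (5 / 2) * q + (2 * q + 2 * (q * q))"
    have "R D s \<le> R (\<lambda>s. (q / B) * (kstep S QQ (\<lambda>s. (h s)\<^sup>2) s + (- 1) * (h s)\<^sup>2) + c0) s"
    proof (rule R_mono[OF s])
      fix s assume s: "s < S"
      have "(q / (2 * B)) * VV s \<le> (q / (2 * B)) * (2 * (kstep S QQ (\<lambda>s. (h s)\<^sup>2) s + (- 1) * (h s)\<^sup>2) + 5 * B)"
        using VV[OF s] q0 B by (intro mult_left_mono) auto
      also have "\<dots> = (q / B) * (kstep S QQ (\<lambda>s. (h s)\<^sup>2) s + (- 1) * (h s)\<^sup>2) + (5 / 2) * q"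
        using B by (simp add: field_simps)
      finally show "D s \<le> (q / B) * (kstep S QQ (\<lambda>s. (h s)\<^sup>2) s + (- 1) * (h s)\<^sup>2) + c0"
        using D[OF s] by (simp add: c0_def)
    qed
    also have "\<dots> = (q / B) * (R (kstep S QQ (\<lambda>s. (h s)\<^sup>2)) s - R (\<lambda>s. (h s)\<^sup>2) s)
        + c0 / (1 - \<gamma>)"
      unfolding disc[OF s] by simp
    \<comment> \<open>Telescoping of \<open>R (Q h^2) - R (h^2)\<close>: what survives is at most
      \<open>(1 - \<gamma>) * R (Q h^2)\<close>, and that is at most \<open>B^2\<close>.\<close>
    also have "R (\<lambda>s. (h s)\<^sup>2) s = (h s)\<^sup>2 + \<gamma> * R (kstep S QQ (\<lambda>s. (h s)\<^sup>2)) s"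
      unfolding R_def by (rule disc_eq_disc_kstep[OF QQ \<gamma> s])
    finally have "R D s \<le> (q / B) * ((1 - \<gamma>) * R (kstep S QQ (\<lambda>s. (h s)\<^sup>2)) s - (h s)\<^sup>2)
        + c0 / (1 - \<gamma>)" by (simp add: algebra_simps)
    also have "\<dots> \<le> (q / B) * B\<^sup>2 + c0 / (1 - \<gamma>)"
    proof (intro add_right_mono mult_left_mono)
      have "(1 - \<gamma>) * R (kstep S QQ (\<lambda>s. (h s)\<^sup>2)) s \<le> B\<^sup>2"
        by (rule hQ(1)[OF s]) (use h in \<open>auto intro!: power_mono\<close>)
      then show "(1 - \<gamma>) * R (kstep S QQ (\<lambda>s. (h s)\<^sup>2)) s - (h s)\<^sup>2 \<le> B\<^sup>2"
        using zero_le_power2[of "h s"] by linarith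
    qed (use q0 B in simp)
    finally have "(1 - \<gamma>) * R D s \<le> (1 - \<gamma>) * ((q / B) * B\<^sup>2 + c0 / (1 - \<gamma>))"
      using \<gamma> by (intro mult_left_mono) auto
    also have "\<dots> = q * ((1 - \<gamma>) * B) + c0"
      using \<gamma> B by (simp add: field_simps power2_eq_square)
    also have "\<dots> \<le> q * 1 + c0"
      using B(2) q0 by (intro add_right_mono mult_left_mono) auto
    \<comment> \<open>The coefficients of \<open>q\<close> are 1 + 5/2 + 2 and at most 2/5, the last
      because \<open>q \<le> 1 / 5\<close>.\<close>
    also have "\<dots> \<le> 6 * q" unfolding c0_def using q2(1) q0 by argo
    finally show ?thesis .
  qed
  \<comment> \<open>The discounted value of \<open>pol\<close> under \<open>Q\<close>. The Poisson
    equation rewrites its reward as \<open>\<rho> + (h - Q h) + (Q h - P h)\<close>, where the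
    middle difference telescopes and the last one is the error bounded by \<open>D\<close>.\<close>
  define U where "U = R rw"
  have U: "U s = \<rho> / (1 - \<gamma>) + h s + R (\<lambda>s. kstep S QQ h s - kstep S PP h s) s - (1 - \<gamma>) * R (kstep S QQ h) s"
    if s: "s < S" for s
  proof -
    have "U s = R (\<lambda>s. \<rho> + (h s + ((kstep S QQ h s - kstep S PP h s) + (- 1) * kstep S QQ h s))) s"
    proof -
      have "rw s = \<rho> + (h s + ((kstep S QQ h s - kstep S PP h s) + (- 1) * kstep S QQ h s))" if "s < S" for s
        using poisson[OF that] by (simp add: PP_def rw_def)
      then show ?thesis unfolding U_def by (intro antisym R_mono[OF s]) auto
    qed
    also have "\<dots> = \<rho> / (1 - \<gamma>) + R h s + R (\<lambda>s. kstep S QQ h s - kstep S PP h s) s - R (kstep S QQ h) s"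
      unfolding disc[OF s] by simp
    also have "R h s = h s + \<gamma> * R (kstep S QQ h) s"
      unfolding R_def by (rule disc_eq_disc_kstep[OF QQ \<gamma> s])
    finally show ?thesis by (simp add: algebra_simps)
  qed
  have dev: "(1 - \<gamma>) * R (\<lambda>s. kstep S QQ h s - kstep S PP h s) s \<le> 6 * q"
    "- 6 * q \<le> (1 - \<gamma>) * R (\<lambda>s. kstep S QQ h s - kstep S PP h s) s" if s: "s < S" for s
  proof -
    have "R (\<lambda>s. kstep S QQ h s - kstep S PP h s) s \<le> R D s"
      "R (\<lambda>s. (- 1) * D s) s \<le> R (\<lambda>s. kstep S QQ h s - kstep S PP h s) s"
      by (rule R_mono[OF s]; simp add: D_def)+
    moreover have "R (\<lambda>s. (- 1) * D s) s = - R D s" using disc(2)[OF s, of "- 1" D] by simp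
    ultimately have "R (\<lambda>s. kstep S QQ h s - kstep S PP h s) s \<le> R D s"
      "- R D s \<le> R (\<lambda>s. kstep S QQ h s - kstep S PP h s) s" by (simp_all only:)
    then have "(1 - \<gamma>) * R (\<lambda>s. kstep S QQ h s - kstep S PP h s) s \<le> (1 - \<gamma>) * R D s"
      "(1 - \<gamma>) * (- R D s) \<le> (1 - \<gamma>) * R (\<lambda>s. kstep S QQ h s - kstep S PP h s) s"
      using \<gamma> by (intro mult_left_mono; simp)+
    then show "(1 - \<gamma>) * R (\<lambda>s. kstep S QQ h s - kstep S PP h s) s \<le> 6 * q"
      "- 6 * q \<le> (1 - \<gamma>) * R (\<lambda>s. kstep S QQ h s - kstep S PP h s) s" using x[OF s] by simp_all
  qed
  have Uexp: "(1 - \<gamma>) * U s = \<rho> + (1 - \<gamma>) * h s + (1 - \<gamma>) * R (\<lambda>s. kstep S QQ h s - kstep S PP h s) s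
      - (1 - \<gamma>) * ((1 - \<gamma>) * R (kstep S QQ h) s)" if s: "s < S" for s
  proof -
    have "(1 - \<gamma>) * (\<rho> / (1 - \<gamma>)) = \<rho>" using \<gamma> by simp
    then show ?thesis unfolding U[OF s] by (simp only: distrib_left right_diff_distrib)
  qed
  show ?thesis
  proof (rule that[of U])
    fix s assume s: "s < S"
    have hs: "0 \<le> (1 - \<gamma>) * h s" "(1 - \<gamma>) * h s \<le> (1 - \<gamma>) * B"
      using h[OF s] \<gamma> by (auto intro: mult_left_mono)
    have kh: "0 \<le> (1 - \<gamma>) * ((1 - \<gamma>) * R (kstep S QQ h) s)"
      "(1 - \<gamma>) * ((1 - \<gamma>) * R (kstep S QQ h) s) \<le> (1 - \<gamma>) * B"
      using hQ[OF s h] \<gamma> by (auto intro!: mult_left_mono)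
    show "\<rho> - (1 - \<gamma>) * B - 6 * q \<le> (1 - \<gamma>) * U s" "(1 - \<gamma>) * U s \<le> \<rho> + (1 - \<gamma>) * B + 6 * q"
      unfolding Uexp[OF s] using dev[OF s] hs kh by linarith+
    have "U s \<le> R (\<lambda>_. 1) s" unfolding U_def
    proof (rule R_mono[OF s])
      fix s assume s: "s < S"
      have "rw s \<le> (\<Sum>a<A. pol s a * 1)" unfolding rw_def pol_reward_def
        using pl(1)[OF s] r[OF s] by (intro sum_mono mult_left_mono) auto
      then show "rw s \<le> 1" using pl(2)[OF s] by simp
    qed
    then show "(1 - \<gamma>) * U s \<le> 1" using \<gamma> by (simp add: disc[OF s] field_simps)
    have "U s = rw s + \<gamma> * kstep S QQ U s"
      unfolding U_def R_def by (rule disc_eq_kstep_disc[OF QQ \<gamma> s])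
    also have "\<dots> = (\<Sum>a<A. pol s a * (r s a + \<gamma> * (\<Sum>s'<S. Q s a s' * U s')))"
      unfolding rw_def pol_reward_def kQ by (simp add: distrib_left sum.distrib sum_distrib_left mult.left_commute)
    also have "\<dots> \<le> bellman S A Q r \<gamma> U s" by (rule average_le_bellman[OF pol s A])
    finally show "U s \<le> bellman S A Q r \<gamma> U s" .
  qed
qed

section \<open>Probability of the good event\<close>

text \<open>Moves a Bernstein bound from the leave-one-out value \<open>W\<close> to
  \<open>V\<close>. The two expectations cost \<open>2 * e\<close>; the variance of \<open>W\<close>
  is at most \<open>2 * pvar S p V + 2 * e^2\<close>, which yields the 8 under the root and, as
  \<open>8 * l \<le> 1\<close>, the third \<open>e\<close>.\<close>

lemma deviation_perturb:
  fixes p p' V W :: "nat \<Rightarrow> real"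
  assumes p: "\<And>x. x < S \<Longrightarrow> 0 \<le> p x" "(\<Sum>x<S. p x) = 1"
    and p': "\<And>x. x < S \<Longrightarrow> 0 \<le> p' x" "(\<Sum>x<S. p' x) = 1"
    and near: "\<And>x. x < S \<Longrightarrow> \<bar>V x - W x\<bar> \<le> e" and e: "0 \<le> e" and l: "0 \<le> l" "8 * l \<le> 1"
    and dev: "\<bar>(\<Sum>x<S. p' x * W x) - (\<Sum>x<S. p x * W x)\<bar> \<le> 2 * sqrt (pvar S p W * l) + b"
  shows "\<bar>(\<Sum>x<S. p' x * V x) - (\<Sum>x<S. p x * V x)\<bar> \<le> sqrt (8 * pvar S p V * l) + b + 3 * e"
proof -
  have close: "\<bar>(\<Sum>x<S. c x * V x) - (\<Sum>x<S. c x * W x)\<bar> \<le> e"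
    if c: "\<And>x. x < S \<Longrightarrow> 0 \<le> c x" "(\<Sum>x<S. c x) = 1" for c
  proof -
    have "\<bar>(\<Sum>x<S. c x * V x) - (\<Sum>x<S. c x * W x)\<bar> = \<bar>\<Sum>x<S. c x * (V x - W x)\<bar>"
      by (simp add: right_diff_distrib sum_subtractf)
    also have "\<dots> \<le> (\<Sum>x<S. \<bar>c x * (V x - W x)\<bar>)" by (rule sum_abs)
    also have "\<dots> \<le> (\<Sum>x<S. c x * e)"
      using c near by (intro sum_mono) (auto simp: abs_mult intro!: mult_left_mono)
    finally show ?thesis using c(2) by (simp flip: sum_distrib_right)
  qed
  define m where "m = (\<Sum>x<S. p x * V x)"
  have "pvar S p W \<le> (\<Sum>x<S. p x * (W x - m)\<^sup>2)" by (rule pvar_le_any_center[OF p(2)])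
  also have "\<dots> \<le> (\<Sum>x<S. p x * (2 * (V x - m)\<^sup>2 + 2 * e\<^sup>2))"
  proof (intro sum_mono mult_left_mono)
    fix x assume x: "x \<in> {..<S}"
    have "(W x - m)\<^sup>2 \<le> 2 * (V x - m)\<^sup>2 + 2 * (V x - W x)\<^sup>2"
    proof -
      have "0 \<le> ((V x - m) + (V x - W x))\<^sup>2" by simp
      also have "\<dots> = 2 * (V x - m)\<^sup>2 + 2 * (V x - W x)\<^sup>2 - (W x - m)\<^sup>2"
        by (simp add: power2_eq_square algebra_simps)
      finally show ?thesis by simp
    qed
    moreover have "(V x - W x)\<^sup>2 \<le> e\<^sup>2" using near[of x] x e by (simp add: abs_le_square_iff[symmetric])
    ultimately show "(W x - m)\<^sup>2 \<le> 2 * (V x - m)\<^sup>2 + 2 * e\<^sup>2" by linarith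
  qed (use p in auto)
  also have "\<dots> = 2 * pvar S p V + 2 * e\<^sup>2 * (\<Sum>x<S. p x)"
    unfolding pvar_eq[OF p(2) m_def]
    by (simp add: distrib_left sum.distrib sum_distrib_left sum_distrib_right mult.commute mult.left_commute)
  finally have "pvar S p W * l \<le> (2 * pvar S p V + 2 * e\<^sup>2) * l"
    using p(2) l by (intro mult_right_mono) auto
  then have "2 * sqrt (pvar S p W * l) \<le> 2 * sqrt (2 * pvar S p V * l + 2 * e\<^sup>2 * l)"
    by (simp add: algebra_simps)
  also have "sqrt (2 * pvar S p V * l + 2 * e\<^sup>2 * l) \<le> sqrt (2 * pvar S p V * l) + sqrt (2 * e\<^sup>2 * l)"
    using pvar_nonneg[OF p] l by (intro sqrt_add_le_add_sqrt) auto
  also have "2 * (sqrt (2 * pvar S p V * l) + sqrt (2 * e\<^sup>2 * l)) \<le> sqrt (8 * pvar S p V * l) + e"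
  proof -
    have "2 * sqrt (2 * pvar S p V * l) = sqrt (8 * pvar S p V * l)"
      by (subst real_sqrt_four[symmetric], subst real_sqrt_mult[symmetric]) (simp add: mult.assoc)
    moreover have "2 * sqrt (2 * e\<^sup>2 * l) = sqrt (8 * l * e\<^sup>2)"
      by (subst real_sqrt_four[symmetric], subst real_sqrt_mult[symmetric]) (simp add: mult.assoc mult.commute)
    moreover have "8 * l * e\<^sup>2 \<le> 1 * e\<^sup>2" using l by (intro mult_right_mono) auto
    then have "sqrt (8 * l * e\<^sup>2) \<le> sqrt (e\<^sup>2)" by (intro real_sqrt_le_mono) simp
    ultimately show ?thesis using e by simp
  qed
  finally show ?thesis using dev close[OF p] close[OF p'] by linarith
qed

locale esp_setting =
  fixes S A n :: nat and P :: "nat \<Rightarrow> nat \<Rightarrow> nat pmf" and r :: "nat \<Rightarrow> nat \<Rightarrow> real" and \<delta> :: real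
  assumes S: "1 \<le> S" and A: "1 \<le> A" and n: "1 \<le> n"
    and P: "\<And>s a. s < S \<Longrightarrow> a < A \<Longrightarrow> set_pmf (P s a) \<subseteq> {..<S}"
    and r: "\<And>s a. s < S \<Longrightarrow> a < A \<Longrightarrow> 0 \<le> r s a \<and> r s a \<le> 1"
    and \<delta>: "0 < \<delta>" "\<delta> < 1"
begin

definition L where "L = ln (24 * real S * real A * real n ^ 5 / \<delta>)"

abbreviation \<alpha> where "\<alpha> \<equiv> alpha S A \<delta> n"
abbreviation \<gamma> where "\<gamma> \<equiv> esp_gamma S A \<delta> n"
abbreviation M where "M \<equiv> esp_M"
abbreviation Q where "Q \<equiv> emp_kernel n"
abbreviation V where "V i X \<equiv> plan_V S A (Q X) r (\<gamma> i) (M i) (1 / real n)"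
abbreviation steps where "steps i \<equiv> plan_iters (\<gamma> i) (1 / real n)"

lemma L_ge_3: "3 \<le> L"
proof -
  have "1 \<le> real S * real A * real n ^ 5"
    using S A n mult_mono[of 1 "real S" 1 "real A"] mult_mono[of 1 "real S * real A" 1 "real n ^ 5"] by auto
  then have "24 \<le> 24 * real S * real A * real n ^ 5" by simp
  also have "\<dots> \<le> 24 * real S * real A * real n ^ 5 / \<delta>"
    using \<delta> calculation by (simp add: pos_le_divide_eq mult_left_le)
  finally have 24: "24 \<le> 24 * real S * real A * real n ^ 5 / \<delta>" .
  have "exp (3 :: real) = exp 1 ^ 3" by (simp flip: exp_of_nat_mult)
  also have "\<dots> \<le> (272 / 100) ^ 3" using e_less_272 by (intro power_mono) auto
  also have "\<dots> \<le> (24 :: real)" by (simp add: power3_eq_cube)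
  finally show ?thesis unfolding L_def using 24 by (subst ln_ge_iff) auto
qed

lemma exp_minus_L: "exp (- L) = \<delta> / (24 * real S * real A * real n ^ 5)"
  unfolding L_def using S A n \<delta> by (simp add: exp_minus)

text \<open>Since \<open>n + 4\<close> is at least 4, the iterated logarithm in \<open>alpha\<close>
  is at least 1.\<close>

lemma alpha_ge: "96 * sqrt L \<le> \<alpha>"
proof -
  have "2 = log 2 (2 powr 2 :: real)" by (rule log_powr_cancel[symmetric]) simp_all
  also have "(2 powr 2 :: real) = 4" by simp
  also have "log 2 4 \<le> log 2 (real n + 4)" by simp
  finally have "log 2 2 \<le> log 2 (log 2 (real n + 4))" by (subst log_le_cancel_iff) auto
  then have "96 * sqrt L * 1 \<le> 96 * sqrt L * log 2 (log 2 (real n + 4))"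
    using L_ge_3 by (intro mult_left_mono) auto
  then show ?thesis by (simp add: alpha_def L_def)
qed

lemma alpha_ge_96: "96 \<le> \<alpha>"
proof -
  have "1 \<le> sqrt L" using L_ge_3 by simp
  then show ?thesis using alpha_ge by linarith
qed

definition horizon :: "nat \<Rightarrow> real" where
  "horizon i = max (sqrt (real n * M i) / (2 * sqrt 2 * \<alpha>)) 1"

lemma gamma_horizon: "1 - \<gamma> i = 1 / horizon i" "1 \<le> horizon i"
  by (simp_all add: esp_gamma_def horizon_def)

lemma gamma_range: "0 \<le> \<gamma> i" "\<gamma> i < 1"
proof -
  have "0 < 1 / horizon i" "1 / horizon i \<le> 1" using gamma_horizon(2)[of i] by auto
  then show "0 \<le> \<gamma> i" "\<gamma> i < 1" using gamma_horizon(1)[of i] by linarith+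
qed

lemma M_ge: "2 \<le> i \<Longrightarrow> 4 \<le> M i"
  using power_increasing[of 2 i "2 :: real"] by (simp add: esp_M_def)

lemma M_le: "i \<in> esp_index_set n \<Longrightarrow> M i \<le> 2 * real n"
proof -
  assume "i \<in> esp_index_set n"
  then have "real i \<le> log 2 (real n) + 1"
    unfolding esp_index_set_def by (simp add: le_nat_iff) linarith
  then have "2 powr real i \<le> 2 powr (log 2 (real n) + 1)" by (intro powr_mono) auto
  also have "\<dots> = 2 * real n" using n by (simp add: powr_add)
  finally show ?thesis by (simp add: esp_M_def powr_realpow)
qed

text \<open>\<open>M i \<le> 2 * n\<close> bounds the root by \<open>2 * n\<close>, and \<alpha> is
  large. Values up to \<open>n\<close> and an error amplification up to \<open>n\<close> are what
  fix the size and the spacing of the grid for \<open>u\<close>.\<close>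

lemma horizon_le: "i \<in> esp_index_set n \<Longrightarrow> horizon i \<le> real n"
proof -
  assume i: "i \<in> esp_index_set n"
  have "sqrt (real n * M i) \<le> sqrt ((2 * real n)\<^sup>2)"
    using M_le[OF i] n by (intro real_sqrt_le_mono) (auto simp: power2_eq_square intro!: mult_mono)
  also have "\<dots> = 2 * real n" by (subst real_sqrt_abs) simp
  also have "\<dots> \<le> real n * (2 * sqrt 2 * \<alpha>)"
  proof -
    have "1 * 1 \<le> sqrt 2 * \<alpha>" using alpha_ge_96 by (intro mult_mono) auto
    then have "real n * 2 * 1 \<le> real n * 2 * (sqrt 2 * \<alpha>)" by (intro mult_left_mono) auto
    then show ?thesis by (simp add: mult.assoc)
  qed
  finally have "sqrt (real n * M i) / (2 * sqrt 2 * \<alpha>) \<le> real n"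
    using alpha_ge_96 by (subst pos_divide_le_eq) auto
  then show ?thesis using n by (simp add: horizon_def)
qed

lemma card_index_set: "card (esp_index_set n) \<le> n"
proof -
  have "log 2 (real n) \<le> real n"
    using n less_exp[of n] by (simp add: log_le_iff powr_realpow)
  then have "nat \<lceil>log 2 (real n)\<rceil> \<le> n" by (simp add: nat_le_iff ceiling_le_iff)
  then show ?thesis unfolding esp_index_set_def card_atLeastAtMost by linarith
qed

lemma stoch_P: "a < A \<Longrightarrow> stoch S (\<lambda>s. kernel_of P s a)"
  using P by (auto simp: stoch_def kernel_of_def intro!: sum_pmf_eq_1)

lemma stoch_Q:
  assumes X: "X \<in> set_pmf (sample_pmf S A n P)" and a: "a < A"
  shows "stoch S (\<lambda>s. Q X s a)"
  unfolding stoch_def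
proof (intro allI impI conjI)
  fix s assume s: "s < S"
  show "(\<Sum>s'<S. Q X s a s') = 1"
    using emp_kernel_average[OF n, of X s a S "\<lambda>_. 1"] sample_pmf_range[OF X P s a] n by simp
qed (simp add: emp_kernel_def)

lemma planning_Q:
  assumes "X \<in> set_pmf (sample_pmf S A n P)"
  shows "span_planning S A (Q X) (\<gamma> i) (M i)"
  using S A stoch_Q[OF assms] gamma_range by unfold_locales (auto simp: stoch_def esp_M_def)

text \<open>\<open>k / n^2\<close> with \<open>k \<le> n^3\<close> runs through a grid of [0, n],
  which contains the empirical expectations of \<open>V\<close> at every admissible level.\<close>

definition loo_V :: "nat \<Rightarrow> nat \<Rightarrow> nat \<Rightarrow> nat \<Rightarrow> (nat \<times> nat \<times> nat \<Rightarrow> nat) \<Rightarrow> nat \<Rightarrow> real" where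
  "loo_V i s a k X = (plan_op S A (zero_row s a (Q X)) (add_reward s a (\<gamma> i * (real k / (real n)\<^sup>2)) r) (\<gamma> i) (M i)
     ^^ steps i) (\<lambda>_. 0)"

definition dev_ok :: "(nat \<times> nat \<times> nat \<Rightarrow> nat) \<Rightarrow> nat \<Rightarrow> nat \<Rightarrow> (nat \<Rightarrow> real) \<Rightarrow> real \<Rightarrow> bool" where
  "dev_ok X s a f B \<longleftrightarrow> \<bar>(\<Sum>x<S. Q X s a x * f x) - (\<Sum>x<S. kernel_of P s a x * f x)\<bar>
     \<le> 2 * sqrt (pvar S (kernel_of P s a) f * (L / n)) + 2 * B * (L / n)"

text \<open>Membership in the support ensures that the empirical rows are stochastic. The functions
  \<open>h i\<close> stand for shifted biases fixed before sampling, hence Bernstein applies to them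
  directly; their range \<open>M i / 4\<close> is that of the policies in
  \<open>level i\<close>.\<close>

definition good :: "(nat \<Rightarrow> nat \<Rightarrow> real) \<Rightarrow> (nat \<times> nat \<times> nat \<Rightarrow> nat) \<Rightarrow> bool" where
  "good h X \<longleftrightarrow> X \<in> set_pmf (sample_pmf S A n P) \<and>
     (\<forall>i\<in>esp_index_set n. \<forall>s<S. \<forall>a<A. (\<forall>k\<le>n ^ 3. dev_ok X s a (loo_V i s a k X) (M i)) \<and>
        dev_ok X s a (h i) (M i / 4) \<and> dev_ok X s a (\<lambda>x. (h i x)\<^sup>2) ((M i / 4)\<^sup>2))"

lemma loo_V_indep:
  assumes "\<And>s' a' j. (s', a') \<noteq> (s, a) \<Longrightarrow> X (s', a', j) = X' (s', a', j)"
  shows "loo_V i s a k X = loo_V i s a k X'"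
proof -
  have "zero_row s a (Q X) = zero_row s a (Q X')"
    using assms by (intro ext) (auto simp: zero_row_def emp_kernel_def)
  then show ?thesis by (simp add: loo_V_def)
qed

lemma prob_not_dev_ok:
  assumes "s < S" "a < A" "0 < B"
    and "\<And>X x y. x < S \<Longrightarrow> y < S \<Longrightarrow> X \<in> set_pmf (sample_pmf S A n P) \<Longrightarrow> G X x - G X y \<le> B"
    and "\<And>X X'. (\<And>s' a' j. (s', a') \<noteq> (s, a) \<Longrightarrow> X (s', a', j) = X' (s', a', j)) \<Longrightarrow> G X = G X'"
  shows "measure_pmf.prob (sample_pmf S A n P) {X. \<not> dev_ok X s a (G X) B} \<le> 2 * exp (- L)"
proof -
  have "kernel_of P s a = pmf (P s a)" by (rule ext) (simp add: kernel_of_def)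
  then show ?thesis
    using bernstein_leave_one_out[of S A P s a n L B G, OF P assms(1,2) n _ assms(3,4,5)] L_ge_3
    by (simp add: dev_ok_def not_le)
qed

lemma prob_good:
  assumes h: "\<And>i s. i \<in> esp_index_set n \<Longrightarrow> s < S \<Longrightarrow> 0 \<le> h i s \<and> h i s \<le> M i / 4"
  shows "measure_pmf.prob (sample_pmf S A n P) {X. good h X} \<ge> 1 - \<delta>"
proof -
  let ?M = "sample_pmf S A n P"
  \<comment> \<open>\<open>k \<le> n^3\<close> indexes grid values, \<open>n^3 + 1\<close> the
    function \<open>h i\<close> and \<open>n^3 + 2\<close> its square.\<close>
  define J where "J = esp_index_set n \<times> {..<S} \<times> {..<A} \<times> {..n ^ 3 + 2}"
  define G where "G = (\<lambda>(i, s, a, k) X. if k \<le> n ^ 3 then loo_V i s a k X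
     else if k = n ^ 3 + 1 then h i else (\<lambda>x. (h i x)\<^sup>2))"
  define B where "B = (\<lambda>(i :: nat, s :: nat, a :: nat, k). if k \<le> n ^ 3 then M i
     else if k = n ^ 3 + 1 then M i / 4 else (M i / 4)\<^sup>2)"
  define Bad where "Bad = (\<lambda>(i, s, a, k). {X. \<not> dev_ok X s a (G (i, s, a, k) X) (B (i, s, a, k))})"
  have Mpos: "0 < M i" for i by (simp add: esp_M_def)
  have J: "finite J" by (auto simp: J_def esp_index_set_def)
  have prob_Bad: "measure_pmf.prob ?M (Bad j) \<le> 2 * exp (- L)" if j: "j \<in> J" for j
  proof -
    obtain i s a k where j_eq: "j = (i, s, a, k)" by (cases j) auto
    have i: "i \<in> esp_index_set n" and s: "s < S" and a: "a < A" using j by (auto simp: j_eq J_def)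
    show ?thesis unfolding Bad_def j_eq prod.case
    proof (rule prob_not_dev_ok[OF s a])
      show "0 < B (i, s, a, k)" using Mpos[of i] by (simp add: B_def)
      show "G (i, s, a, k) X x - G (i, s, a, k) X y \<le> B (i, s, a, k)"
        if x: "x < S" and y: "y < S" and X: "X \<in> set_pmf ?M" for X x y
      proof -
        have 1: "loo_V i s a k X x - loo_V i s a k X y \<le> M i"
          using span_planning.F_pow_span[OF planning_zero_row[OF planning_Q[OF X]] x y]
          unfolding loo_V_def by (simp add: algebra_simps)
        have 2: "h i x - h i y \<le> M i / 4" using h[OF i x] h[OF i y] by linarith
        have "(h i x)\<^sup>2 \<le> (M i / 4)\<^sup>2" using h[OF i x] by (intro power_mono) auto
        then have 3: "(h i x)\<^sup>2 - (h i y)\<^sup>2 \<le> (M i / 4)\<^sup>2" using zero_le_power2[of "h i y"] by linarith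
        show ?thesis using 1 2 3 by (simp add: G_def B_def)
      qed
      show "G (i, s, a, k) X = G (i, s, a, k) X'"
        if X: "\<And>s' a' j. (s', a') \<noteq> (s, a) \<Longrightarrow> X (s', a', j) = X' (s', a', j)" for X X'
      proof -
        have "loo_V i s a k X = loo_V i s a k X'" by (rule loo_V_indep) (rule X)
        then show ?thesis by (simp add: G_def)
      qed
    qed
  qed
  \<comment> \<open>At most \<open>4 * S * A * n^4\<close> events, each of probability at most
    \<open>2 * exp (- L)\<close>; the argument \<open>24 * S * A * n^5 / \<delta>\<close> of the
    logarithm in \<open>L\<close> more than covers the product.\<close>
  have card: "real (card J) * (2 * exp (- L)) \<le> \<delta>"
  proof -
    have "card J = card (esp_index_set n) * (S * (A * (n ^ 3 + 3)))"
      by (simp add: J_def card_cartesian_product algebra_simps)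
    also have "\<dots> \<le> n * (S * (A * (4 * n ^ 3)))"
      using card_index_set n by (intro mult_mono order.refl) auto
    finally have "real (card J) \<le> real (n * (S * (A * (4 * n ^ 3))))" by (simp only: of_nat_le_iff)
    also have "\<dots> = 4 * real S * real A * real n ^ 4" by (simp add: power3_eq_cube power4_eq_xxxx)
    also have "\<dots> \<le> 4 * real S * real A * real n ^ 5"
      using n by (intro mult_left_mono power_increasing) auto
    finally have "real (card J) * (2 * exp (- L)) \<le> (4 * real S * real A * real n ^ 5) * (2 * exp (- L))"
      by (intro mult_right_mono) auto
    also have "\<dots> \<le> \<delta>" unfolding exp_minus_L using S A n \<delta> by simp
    finally show ?thesis .
  qed
  have "measure_pmf.prob ?M (\<Union>j\<in>J. Bad j) \<le> (\<Sum>j\<in>J. measure_pmf.prob ?M (Bad j))"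
    by (rule measure_UNION_le[OF J]) simp
  also have "\<dots> \<le> real (card J) * (2 * exp (- L))"
    using sum_bounded_above[of J "\<lambda>j. measure_pmf.prob ?M (Bad j)" "2 * exp (- L)"] prob_Bad by simp
  also note card
  finally have bad: "measure_pmf.prob ?M (\<Union>j\<in>J. Bad j) \<le> \<delta>" .
  have "1 - measure_pmf.prob ?M (\<Union>j\<in>J. Bad j) = measure_pmf.prob ?M (UNIV - (\<Union>j\<in>J. Bad j))"
    using measure_pmf.prob_compl[of "\<Union>j\<in>J. Bad j" ?M] by simp
  also have "\<dots> = measure_pmf.prob ?M ((UNIV - (\<Union>j\<in>J. Bad j)) \<inter> set_pmf ?M)"
    by (rule measure_Int_set_pmf[symmetric])
  also have "\<dots> \<le> measure_pmf.prob ?M {X. good h X}"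
  proof (rule measure_pmf.finite_measure_mono)
    show "(UNIV - (\<Union>j\<in>J. Bad j)) \<inter> set_pmf ?M \<subseteq> {X. good h X}"
    proof safe
      fix X assume X: "X \<in> set_pmf ?M" and nb: "X \<notin> (\<Union>j\<in>J. Bad j)"
      have ok: "dev_ok X s a (G (i, s, a, k) X) (B (i, s, a, k))"
        if "i \<in> esp_index_set n" "s < S" "a < A" "k \<le> n ^ 3 + 2" for i s a k
        using nb that by (auto simp: J_def Bad_def)
      show "good h X"
        unfolding good_def
      proof (intro conjI ballI allI impI)
        fix i s a assume *: "i \<in> esp_index_set n" "s < S" "a < A"
        show "dev_ok X s a (loo_V i s a k X) (M i)" if "k \<le> n ^ 3" for k
          using ok[OF *, of k] that by (simp add: G_def B_def)
        show "dev_ok X s a (h i) (M i / 4)" using ok[OF *, of "n ^ 3 + 1"] by (simp add: G_def B_def)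
        show "dev_ok X s a (\<lambda>x. (h i x)\<^sup>2) ((M i / 4)\<^sup>2)"
          using ok[OF *, of "n ^ 3 + 2"] by (simp add: G_def B_def)
      qed (rule X)
    qed
  qed simp
  finally show ?thesis using bad by linarith
qed

end

section \<open>Bounds for a single level on the good event\<close>

context esp_setting
begin

abbreviation d where "d sel i X \<equiv> plan_pol sel S A (Q X) r (\<gamma> i) (M i) (1 / real n)"

lemma plan_pol_greedy:
  assumes sel: "\<And>s X. X \<noteq> {} \<Longrightarrow> sel s X \<in> X"
  shows "d sel i X s < A"
    "b < A \<Longrightarrow> r s b + \<gamma> i * (\<Sum>s'<S. Q X s b s' * V i X s')
      \<le> r s (d sel i X s) + \<gamma> i * (\<Sum>s'<S. Q X s (d sel i X s) s' * V i X s')"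
proof -
  define q where "q = (\<lambda>a. r s a + \<gamma> i * (\<Sum>s'<S. Q X s a s' * V i X s'))"
  have "Max (q ` {..<A}) \<in> q ` {..<A}" using lessThan_nonempty[OF A] by (intro Max_in) auto
  then obtain a where a: "a < A" "q a = Max (q ` {..<A})" by auto
  then have "a \<in> {a. a < A \<and> (\<forall>b<A. q b \<le> q a)}"
    using Max_image_ge[of _ A q] by auto
  then have "sel s {a. a < A \<and> (\<forall>b<A. q b \<le> q a)} \<in> {a. a < A \<and> (\<forall>b<A. q b \<le> q a)}"
    by (intro sel) blast
  moreover have "d sel i X s = sel s {a. a < A \<and> (\<forall>b<A. q b \<le> q a)}"
    by (simp add: plan_pol_def Let_def q_def)
  ultimately have *: "d sel i X s \<in> {a. a < A \<and> (\<forall>b<A. q b \<le> q a)}" by simp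
  then show "d sel i X s < A" by blast
  show "r s b + \<gamma> i * (\<Sum>s'<S. Q X s b s' * V i X s')
      \<le> r s (d sel i X s) + \<gamma> i * (\<Sum>s'<S. Q X s (d sel i X s) s' * V i X s')" if "b < A"
    using * that unfolding q_def by blast
qed

lemma stoch_pol: "is_policy S A pol \<Longrightarrow> stoch S (pol_kernel A (kernel_of P) pol)"
  using stoch_P by (intro stoch_pol_kernel)

lemma pol_reward_bounds:
  assumes "is_policy S A pol" "s < S"
  shows "0 \<le> pol_reward A r pol s" "pol_reward A r pol s \<le> 1"
proof -
  have pl: "\<And>a. a < A \<Longrightarrow> 0 \<le> pol s a" "(\<Sum>a<A. pol s a) = 1"
    using assms by (auto simp: is_policy_def)
  show "0 \<le> pol_reward A r pol s" unfolding pol_reward_def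
    using pl r[OF assms(2)] by (intro sum_nonneg mult_nonneg_nonneg) auto
  have "pol_reward A r pol s \<le> (\<Sum>a<A. pol s a * 1)" unfolding pol_reward_def
    using pl r[OF assms(2)] by (intro sum_mono mult_left_mono) auto
  then show "pol_reward A r pol s \<le> 1" using pl by simp
qed

lemma gain_range:
  assumes "is_policy S A pol" "s < S"
  shows "0 \<le> gain S A (kernel_of P) r pol s" "gain S A (kernel_of P) r pol s \<le> 1"
  using gain_nonneg[OF stoch_pol[OF assms(1)] assms(2)] gain_le_1[OF stoch_pol[OF assms(1)] assms(2)]
    pol_reward_bounds[OF assms(1)] by blast+

text \<open>Two precisions of the same quantity: the sharp one survives the division by
  \<open>1 - \<gamma> i\<close> in the leave-one-out estimate, the coarse one measures the effect of
  stopping the iteration.\<close>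

lemma error_le: "\<gamma> i ^ steps i \<le> (1 - \<gamma> i)\<^sup>2 / (3 * n)" "\<gamma> i ^ steps i \<le> 1 / n"
proof -
  show 1: "\<gamma> i ^ steps i \<le> (1 - \<gamma> i)\<^sup>2 / (3 * n)"
    using plan_iters_error[OF gamma_range[of i], of "1 / real n"] n by (simp add: field_simps)
  have "(1 - \<gamma> i)\<^sup>2 \<le> 1" using gamma_range[of i] by (intro power_le_one) auto
  then have "(1 - \<gamma> i)\<^sup>2 / (3 * n) \<le> 1 / n" using n by (simp add: field_simps)
  with 1 show "\<gamma> i ^ steps i \<le> 1 / n" by linarith
qed

lemma V_bounds:
  assumes "X \<in> set_pmf (sample_pmf S A n P)" "s < S"
  shows "0 \<le> V i X s \<and> V i X s \<le> 1 / (1 - \<gamma> i)"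
  unfolding plan_V_eq by (rule span_planning.F_pow_bounds[OF planning_Q[OF assms(1)] r assms(2)])

text \<open>Rounding the data-dependent \<open>u\<close> down to the grid selects a leave-one-out
  value controlled by \<open>good\<close>. The rounding error \<open>1 / n^2\<close> is amplified by
  the horizon, at most \<open>n\<close>, and the truncated iteration contributes at most
  \<open>1 / n\<close>; the resulting \<open>3 * (2 / n)\<close> is absorbed because
  \<open>M i * L\<close> exceeds 6.\<close>

lemma V_deviation:
  assumes good: "good h X" and i: "i \<in> esp_index_set n" and s: "s < S" and a: "a < A"
    and small: "8 * (L / n) \<le> 1"
  shows "\<bar>(\<Sum>x<S. Q X s a x * V i X x) - (\<Sum>x<S. kernel_of P s a x * V i X x)\<bar>
    \<le> sqrt (8 * pvar S (kernel_of P s a) (V i X) * (L / n)) + 3 * M i * (L / n)"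
proof -
  have X: "X \<in> set_pmf (sample_pmf S A n P)" using good by (simp add: good_def)
  interpret span_planning S A "Q X" r "\<gamma> i" "M i" by (rule planning_Q[OF X])
  have Pa: "\<And>x. x < S \<Longrightarrow> 0 \<le> kernel_of P s a x" "(\<Sum>x<S. kernel_of P s a x) = 1"
    and Qa: "\<And>x. x < S \<Longrightarrow> 0 \<le> Q X s a x" "(\<Sum>x<S. Q X s a x) = 1"
    using stoch_P[OF a] stoch_Q[OF X a] s by (auto simp: stoch_def)
  define u where "u = (\<Sum>x<S. Q X s a x * V i X x)"
  have u: "0 \<le> u" "u \<le> n"
  proof -
    have Vn: "V i X x \<le> n" if "x < S" for x
      using V_bounds[OF X that, of i] gamma_horizon[of i] horizon_le[OF i] by simp
    show "0 \<le> u" unfolding u_def using V_bounds[OF X] Qa by (intro sum_nonneg mult_nonneg_nonneg) auto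
    have "u \<le> (\<Sum>x<S. Q X s a x * n)" unfolding u_def using Vn Qa by (intro sum_mono mult_left_mono) auto
    then show "u \<le> n" using Qa(2) by (simp flip: sum_distrib_right)
  qed
  define k where "k = nat \<lfloor>u * (real n)\<^sup>2\<rfloor>"
  have un: "0 \<le> u * (real n)\<^sup>2" using u by simp
  have k: "real k \<le> u * (real n)\<^sup>2" "u * (real n)\<^sup>2 < real k + 1"
    using un unfolding k_def by linarith+
  have "u * (real n)\<^sup>2 \<le> n * (real n)\<^sup>2" using u by (intro mult_right_mono) auto
  then have "real k \<le> real n ^ 3" using k(1) by (simp add: power2_eq_square power3_eq_cube)
  then have kn: "k \<le> n ^ 3" by (simp flip: of_nat_power)
  have n2: "0 < (real n)\<^sup>2" using n by simp
  have uk: "\<bar>u - real k / (real n)\<^sup>2\<bar> \<le> 1 / (real n)\<^sup>2"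
  proof -
    have "u - real k / (real n)\<^sup>2 = (u * (real n)\<^sup>2 - k) / (real n)\<^sup>2" using n2 by (simp add: field_simps)
    moreover have "0 \<le> (u * (real n)\<^sup>2 - k) / (real n)\<^sup>2" "(u * (real n)\<^sup>2 - k) / (real n)\<^sup>2 \<le> 1 / (real n)\<^sup>2"
      using k n2 by (auto intro: divide_right_mono)
    ultimately show ?thesis by simp
  qed
  have near: "\<bar>V i X x - loo_V i s a k X x\<bar> \<le> 2 / n" if x: "x < S" for x
  proof -
    have "\<bar>V i X x - loo_V i s a k X x\<bar> \<le> (2 * \<gamma> i ^ steps i + 1 / (real n)\<^sup>2) / (1 - \<gamma> i)"
      using planning_Q[OF X] s a r plan_V_eq loo_V_def uk[unfolded u_def] x by (rule leave_one_out_near)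
    also have "\<dots> \<le> (2 * ((1 - \<gamma> i)\<^sup>2 / (3 * n)) + 1 / (real n)\<^sup>2) / (1 - \<gamma> i)"
      using error_le(1)[of i] gamma_range[of i] by (intro divide_right_mono) auto
    also have "\<dots> = 2 * (1 - \<gamma> i) / (3 * n) + horizon i / (real n)\<^sup>2"
    proof -
      have "(2 * (g\<^sup>2 / (3 * n)) + c) / g = 2 * g / (3 * n) + (1 / g) * c" if "0 < g" for g c :: real
        using that n by (simp add: field_simps power2_eq_square)
      from this[of "1 - \<gamma> i" "1 / (real n)\<^sup>2"] show ?thesis
        using gamma_range[of i] gamma_horizon[of i] by simp
    qed
    also have "\<dots> \<le> 1 / n + n / (real n)\<^sup>2"
    proof (intro add_mono divide_right_mono)
      show "2 * (1 - \<gamma> i) / (3 * n) \<le> 1 / n" using gamma_range[of i] n by (simp add: field_simps)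
    qed (use horizon_le[OF i] in auto)
    also have "\<dots> = 2 / n" using n by (simp add: power2_eq_square)
    finally show ?thesis .
  qed
  have "dev_ok X s a (loo_V i s a k X) (M i)" using good i s a kn by (auto simp: good_def)
  then have "\<bar>(\<Sum>x<S. Q X s a x * V i X x) - (\<Sum>x<S. kernel_of P s a x * V i X x)\<bar>
    \<le> sqrt (8 * pvar S (kernel_of P s a) (V i X) * (L / n)) + 2 * M i * (L / n) + 3 * (2 / n)"
    unfolding dev_ok_def using L_ge_3 small near
    by (intro deviation_perturb[where W = "loo_V i s a k X"] Pa Qa) auto
  moreover have "3 * (2 / n) \<le> M i * (L / n)"
  proof -
    have "4 \<le> M i" using i by (intro M_ge) (simp add: esp_index_set_def)
    then have "4 * 3 \<le> M i * L" using L_ge_3 by (intro mult_mono) auto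
    then have "6 / n \<le> M i * L / n" by (intro divide_right_mono) auto
    then show ?thesis by simp
  qed
  ultimately show ?thesis by (simp add: mult.assoc)
qed

abbreviation Phi where "Phi X i \<equiv> esp_Phi S A r \<delta> n X i"

lemma Phi_eq: "Phi X i = (1 - \<gamma> i) * Min (V i X ` {..<S}) - \<alpha> * sqrt ((M i + 1) / n)"
  by (simp add: esp_Phi_def Let_def)

text \<open>A nonpositive \<open>Phi\<close> is covered by nonnegative rewards. A positive one
  bounds its own penalty: \<open>(1 - \<gamma> i) * m \<le> 1\<close> forces \<open>y < 1\<close>,
  and the constant 96 in \<open>alpha\<close> turns this into \<open>q \<le> 1 / 96\<close>, so no
  lower bound on \<open>n\<close> has to be assumed.\<close>

lemma gain_ge_Phi:
  assumes good: "good h X" and i: "i \<in> esp_index_set n" and s: "s < S"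
    and sel: "\<And>s X. X \<noteq> {} \<Longrightarrow> sel s X \<in> X"
  shows "max (Phi X i) 0 \<le> gain S A (kernel_of P) r (det_policy (d sel i X)) s"
proof (cases "Phi X i > 0")
  case False
  have "is_policy S A (det_policy (d sel i X))"
    using plan_pol_greedy(1)[OF sel] by (intro is_policy_det)
  then show ?thesis using gain_range(1)[OF _ s] False by simp
next
  case True
  have X: "X \<in> set_pmf (sample_pmf S A n P)" using good by (simp add: good_def)
  interpret span_planning S A "Q X" r "\<gamma> i" "M i" by (rule planning_Q[OF X])
  define m where "m = Min (V i X ` {..<S})"
  \<comment> \<open>Subtracting the minimum leaves deviations and variances unchanged, as all rows
    have mass one, and brings the range down to [0, M].\<close>
  define v where "v = (\<lambda>s. V i X s - m)"
  obtain s0 where s0: "s0 < S" "m = V i X s0" using Min_image_attained[OF S] unfolding m_def by blast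
  have m: "0 \<le> m" "(1 - \<gamma> i) * m \<le> 1"
    using V_bounds[OF X s0(1), of i] gamma_range[of i] unfolding s0(2)[symmetric] by (auto simp: field_simps)
  have M4: "4 \<le> M i" using i by (intro M_ge) (simp add: esp_index_set_def)
  define l where "l = L / real n"
  have l: "0 < l" using L_ge_3 n by (simp add: l_def)
  define y where "y = \<alpha> * sqrt ((M i + 1) / n)"
  have y: "y < 1" using True m(2) unfolding Phi_eq y_def m_def by simp
  have y96: "96 * sqrt (M i * l) \<le> y"
  proof -
    have "96 * sqrt L * sqrt (M i / n) \<le> \<alpha> * sqrt ((M i + 1) / n)"
      using alpha_ge alpha_ge_96 L_ge_3 M4 by (intro mult_mono real_sqrt_le_mono divide_right_mono) auto
    moreover have "sqrt (M i * l) = sqrt L * sqrt (M i / n)"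
      unfolding real_sqrt_mult[symmetric] by (simp add: l_def mult.commute)
    ultimately show ?thesis by (simp add: y_def)
  qed
  define q where "q = sqrt (M i * l)"
  have q96: "q \<le> 1 / 96" using y96 y by (simp add: q_def)
  have q0: "0 < q" using l M4 by (simp add: q_def)
  have qq: "q * q = M i * l" using l M4 by (simp add: q_def)
  have qqq: "q * q \<le> q * (1 / 96)" using q0 q96 by (intro mult_left_mono) auto
  have "4 * l \<le> M i * l" using M4 l by (intro mult_right_mono) auto
  then have l8: "8 * l \<le> 1" using qq qqq q96 by linarith
  have e: "\<gamma> i ^ steps i \<le> q"
  proof -
    have "1 / real n \<le> M i * l"
    proof -
      have "1 * 1 \<le> M i * L" using M4 L_ge_3 by (intro mult_mono) auto
      then have "1 / n \<le> M i * L / n" using n by (intro divide_right_mono) auto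
      then show ?thesis by (simp add: l_def)
    qed
    then show ?thesis using error_le(2)[of i] qq qqq q0 by linarith
  qed
  have Vv: "V i X s = v s + m" for s by (simp add: v_def)
  have "(1 - \<gamma> i) * m - 8 * q \<le> gain S A (kernel_of P) r (det_policy (d sel i X)) s"
  proof (rule gain_ge_value[where v = v and Q = "Q X" and e = "\<gamma> i ^ steps i" and l = l and M = "M i" and q = q])
    show "0 \<le> v s \<and> v s \<le> M i" if "s < S" for s
    proof -
      have "m \<le> V i X s" unfolding m_def by (rule Min_image_le[OF that])
      moreover have "V i X s \<le> V i X s0 + M i" unfolding plan_V_eq by (rule F_pow_span[OF that s0(1)])
      ultimately show ?thesis using s0(2) unfolding v_def by linarith
    qed
    fix s assume s: "s < S"
    let ?a = "d sel i X s"
    have a: "?a < A" by (rule plan_pol_greedy(1)[OF sel])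
    have Pa: "\<And>x. x < S \<Longrightarrow> 0 \<le> kernel_of P s ?a x" "(\<Sum>x<S. kernel_of P s ?a x) = 1"
      and Qa: "(\<Sum>x<S. Q X s ?a x) = 1"
      using stoch_P[OF a] stoch_Q[OF X a] s by (auto simp: stoch_def)
    have QV: "(\<Sum>x<S. Q X s ?a x * V i X x) = (\<Sum>x<S. Q X s ?a x * v x) + m"
      and PV: "(\<Sum>x<S. kernel_of P s ?a x * V i X x) = (\<Sum>x<S. kernel_of P s ?a x * v x) + m"
      using Qa Pa by (simp_all add: Vv distrib_left sum.distrib flip: sum_distrib_right)
    have var: "pvar S (kernel_of P s ?a) (V i X) = pvar S (kernel_of P s ?a) v"
      unfolding pvar_eq[OF Pa(2) refl] PV unfolding Vv by simp
    show "v s + (1 - \<gamma> i) * m \<le> r s ?a + \<gamma> i * (\<Sum>s'<S. Q X s ?a s' * v s') + \<gamma> i ^ steps i"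
    proof -
      have "V i X s \<le> F (V i X) s + \<gamma> i ^ steps i"
        using F_pow_residual[OF r s, of "steps i"] unfolding plan_V_eq by linarith
      also have "F (V i X) s \<le> r s ?a + \<gamma> i * (\<Sum>s'<S. Q X s ?a s' * V i X s')"
        by (rule F_le_backup[OF s]) (rule plan_pol_greedy(2)[OF sel])
      finally show ?thesis unfolding QV by (simp add: Vv algebra_simps)
    qed
    show "\<bar>(\<Sum>s'<S. Q X s ?a s' * v s') - (\<Sum>s'<S. kernel_of P s ?a s' * v s')\<bar>
      \<le> sqrt (8 * pvar S (kernel_of P s ?a) v * l) + 3 * M i * l"
      using V_deviation[OF good i s a] l8 unfolding l_def[symmetric] var QV PV by simp
  qed (use stoch_P plan_pol_greedy(1)[OF sel] r gamma_range[of i] m l M4 q96 e s in \<open>auto simp: q_def\<close>)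
  \<comment> \<open>The penalty exceeds the estimation error with a factor 12 to spare.\<close>
  moreover have "8 * q \<le> y" using y96 q0 unfolding q_def[symmetric] by linarith
  ultimately show ?thesis using True unfolding Phi_eq y_def m_def by simp
qed

text \<open>The hypothesis \<open>1225 \<alpha>\<^sup>2 M \<le> n\<close> excludes the levels at which the claimed bound is trivial.
  It gives \<open>(1 - \<gamma>) M = 2 \<surd>2 y\<close> with \<open>y = \<alpha> \<surd>(M / n)\<close>, which dominates the estimation error, so clipping at span \<open>M\<close> does
  not cut the discounted value of the comparison policy.\<close>

lemma Phi_ge_gain:
  assumes good: "good h X" and i: "i \<in> esp_index_set n"
    and pol: "is_policy S A pol" and const: "\<And>s. s < S \<Longrightarrow> gain S A (kernel_of P) r pol s = \<rho>"
    and h: "h i = (\<lambda>s. bias S A (kernel_of P) r pol s - c)" "\<And>s. s < S \<Longrightarrow> 0 \<le> h i s \<and> h i s \<le> M i / 4"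
    and small: "1225 * (\<alpha>\<^sup>2 * M i) \<le> n"
  shows "\<rho> - 4 * (\<alpha> * sqrt (M i / n)) \<le> Phi X i"
proof -
  have X: "X \<in> set_pmf (sample_pmf S A n P)" using good by (simp add: good_def)
  interpret span_planning S A "Q X" r "\<gamma> i" "M i" by (rule planning_Q[OF X])
  have M4: "4 \<le> M i" using i by (intro M_ge) (simp add: esp_index_set_def)
  define B where "B = M i / 4"
  define l where "l = L / real n"
  define y where "y = \<alpha> * sqrt (M i / n)"
  define q where "q = sqrt (B * l)"
  have l: "0 < l" using L_ge_3 n by (simp add: l_def)
  have y0: "0 < y" using alpha_ge_96 M4 n by (simp add: y_def)
  have y: "y \<le> 1 / 35"
  proof -
    have "y\<^sup>2 = \<alpha>\<^sup>2 * M i / n" using M4 n by (simp add: y_def power_mult_distrib)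
    also have "\<dots> \<le> (1 / 35)\<^sup>2" using small n by (simp add: power2_eq_square[of 35] power_divide field_simps)
    finally show ?thesis by (rule power2_le_imp_le) simp
  qed
  have yn: "1 / n \<le> y"
  proof -
    have "1 * 1 \<le> M i * real n" using n M4 by (intro mult_mono) auto
    then have "sqrt ((1 / real n)\<^sup>2) \<le> sqrt (M i / n)"
      using n by (intro real_sqrt_le_mono) (simp add: power2_eq_square divide_simps)
    then have "1 / n \<le> 1 * sqrt (M i / n)" by simp
    also have "\<dots> \<le> y" unfolding y_def using alpha_ge_96 M4 by (intro mult_right_mono) auto
    finally show ?thesis .
  qed
  \<comment> \<open>The 192 is twice the 96 of \<open>alpha\<close>: replacing \<open>M\<close> by
    \<open>B = M / 4\<close> halves the square root.\<close>
  have q: "192 * q \<le> y"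
  proof -
    have q_eq: "q = sqrt L * sqrt (M i / n) / 2"
    proof -
      have "B * l = (L * (M i / n)) / 2\<^sup>2" by (simp add: B_def l_def mult.commute)
      then have "q = sqrt (L * (M i / n)) / sqrt (2\<^sup>2)" unfolding q_def by (simp only: real_sqrt_divide)
      moreover have "sqrt (L * (M i / n)) = sqrt L * sqrt (M i / n)" by (rule real_sqrt_mult)
      moreover have "sqrt (2\<^sup>2) = (2 :: real)" by simp
      ultimately show ?thesis by (simp only:)
    qed
    have "192 * q = 96 * (sqrt L * sqrt (M i / n))" unfolding q_eq by simp
    also have "\<dots> = 96 * sqrt L * sqrt (M i / n)" by (simp only: mult.assoc)
    also have "\<dots> \<le> y" unfolding y_def using alpha_ge M4 by (intro mult_right_mono) auto
    finally show ?thesis .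
  qed
  \<comment> \<open>Under the smallness hypothesis \<open>n * M\<close> is at least
    \<open>8 * \<alpha>^2\<close>, so the first argument of the maximum in \<open>horizon\<close> is
    the active one.\<close>
  have \<gamma>M: "(1 - \<gamma> i) * M i = 2 * sqrt 2 * y"
  proof -
    have a0: "0 < \<alpha>" using alpha_ge_96 by simp
    have nM: "0 < real n * M i" using n M4 by simp
    have "(2 * sqrt 2 * \<alpha>)\<^sup>2 \<le> real n * M i"
    proof -
      have "(2 * sqrt 2 * \<alpha>)\<^sup>2 = 8 * \<alpha>\<^sup>2 * 1" by (simp add: power_mult_distrib)
      also have "\<dots> \<le> 1225 * \<alpha>\<^sup>2 * M i" using M4 a0 by (intro mult_mono) auto
      also have "\<dots> \<le> real n * 1" using small by simp
      also have "\<dots> \<le> real n * M i" using M4 by (intro mult_left_mono) auto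
      finally show ?thesis .
    qed
    then have "2 * sqrt 2 * \<alpha> \<le> sqrt (real n * M i)" by (rule real_le_rsqrt)
    then have "horizon i = sqrt (real n * M i) / (2 * sqrt 2 * \<alpha>)"
      unfolding horizon_def using a0 by (simp add: max_def field_simps)
    then have "(1 - \<gamma> i) * M i = 2 * sqrt 2 * (\<alpha> * (M i / sqrt (real n * M i)))"
      unfolding gamma_horizon(1) by simp
    also have "M i / sqrt (real n * M i) = sqrt (M i / n)"
    proof -
      have "sqrt ((M i)\<^sup>2) = sqrt (M i / n) * sqrt (real n * M i)"
        unfolding real_sqrt_mult[symmetric] using n by (simp add: power2_eq_square)
      moreover have "sqrt ((M i)\<^sup>2) = M i" using M4 by (intro real_sqrt_unique) auto
      ultimately have "M i = sqrt (M i / n) * sqrt (real n * M i)" by (simp only:)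
      moreover have "sqrt (real n * M i) \<noteq> 0" using n M4 by simp
      ultimately show ?thesis by (intro divide_eq_imp)
    qed
    finally show ?thesis by (simp add: y_def)
  qed
  have sqrt2: "1 \<le> sqrt 2" "sqrt 2 \<le> (3 / 2 :: real)"
    by (simp, rule real_le_lsqrt) (auto simp: power2_eq_square)
  have \<gamma>B: "(1 - \<gamma> i) * B \<le> y" "(1 - \<gamma> i) * M i = 4 * ((1 - \<gamma> i) * B)" "y \<le> 2 * ((1 - \<gamma> i) * B)"
  proof -
    show 4: "(1 - \<gamma> i) * M i = 4 * ((1 - \<gamma> i) * B)" by (simp add: B_def)
    have "1 * y \<le> sqrt 2 * y" "sqrt 2 * y \<le> (3 / 2) * y" using sqrt2 y0 by (intro mult_right_mono; simp)+
    then show "(1 - \<gamma> i) * B \<le> y" "y \<le> 2 * ((1 - \<gamma> i) * B)" using \<gamma>M y0 unfolding 4 by linarith+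
  qed
  have \<rho>: "0 \<le> \<rho>" "\<rho> \<le> 1" using gain_range[OF pol, of 0] const[of 0] S by auto
  have poisson: "h i s - kstep S (pol_kernel A (kernel_of P) pol) (h i) s = pol_reward A r pol s - \<rho>" if s: "s < S" for s
    unfolding h(1) kstep_diff
    using poisson_equation[OF stoch_pol[OF pol] const s] kstep_const[OF stoch_pol[OF pol] s] by simp
  obtain U where U: "\<And>s. s < S \<Longrightarrow> U s \<le> bellman S A (Q X) r (\<gamma> i) U s"
    "\<And>s. s < S \<Longrightarrow> \<rho> - (1 - \<gamma> i) * B - 6 * q \<le> (1 - \<gamma> i) * U s"
    "\<And>s. s < S \<Longrightarrow> (1 - \<gamma> i) * U s \<le> \<rho> + (1 - \<gamma> i) * B + 6 * q"
    "\<And>s. s < S \<Longrightarrow> (1 - \<gamma> i) * U s \<le> 1"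
  proof (rule discounted_value_near_gain[where S = S and A = A and P = "kernel_of P" and Q = "Q X" and r = r and pol = pol
        and \<gamma> = "\<gamma> i" and \<rho> = \<rho> and h = "h i" and B = B and l = l and q = q])
    show "\<bar>(\<Sum>s'<S. Q X s a s' * h i s') - (\<Sum>s'<S. kernel_of P s a s' * h i s')\<bar>
       \<le> 2 * sqrt (pvar S (kernel_of P s a) (h i) * l) + 2 * B * l" if "s < S" "a < A" for s a
      using good i that unfolding good_def dev_ok_def B_def l_def by blast
    show "\<bar>(\<Sum>s'<S. Q X s a s' * (h i s')\<^sup>2) - (\<Sum>s'<S. kernel_of P s a s' * (h i s')\<^sup>2)\<bar>
       \<le> 2 * sqrt (pvar S (kernel_of P s a) (\<lambda>s. (h i s)\<^sup>2) * l) + 2 * B\<^sup>2 * l" if "s < S" "a < A" for s a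
      using good i that unfolding good_def dev_ok_def B_def l_def by blast
    show "(1 - \<gamma> i) * B \<le> 1" using \<gamma>B(1) y by linarith
    show "q \<le> 1 / 5" using q y by linarith
    show "0 < B" using M4 by (simp add: B_def)
    show "0 \<le> h i s \<and> h i s \<le> B" if "s < S" for s using h(2)[OF that] by (simp add: B_def)
  qed (use A stoch_P stoch_Q[OF X] r pol gamma_range[of i] \<rho> poisson l q_def in \<open>auto\<close>)
  have g0: "0 < 1 - \<gamma> i" using gamma_range[of i] by simp
  have "U s \<le> F U s" if s: "s < S" for s
  proof (rule subsolution_F[OF U(1) _ s])
    \<comment> \<open>After scaling by \<open>1 - \<gamma>\<close>, the two-sided bound on
      \<open>U\<close> allows a spread of \<open>2 * (1 - \<gamma>) * B + 12 * q\<close>. The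
      available room is \<open>4 * (1 - \<gamma>) * B\<close>, and
      \<open>12 * q \<le> y / 16\<close> fits into its other half.\<close>
    show "U s \<le> U s' + M i" if "s < S" "s' < S" for s s'
    proof -
      have "(1 - \<gamma> i) * U s \<le> (1 - \<gamma> i) * U s' + (1 - \<gamma> i) * M i"
        using U(3)[OF that(1)] U(2)[OF that(2)] \<gamma>B(2,3) q y0 by linarith
      then have "(1 - \<gamma> i) * U s \<le> (1 - \<gamma> i) * (U s' + M i)" by (simp only: distrib_left)
      then show ?thesis using g0 by (simp only: mult_le_cancel_left_pos)
    qed
  qed
  \<comment> \<open>The planning iteration starts from 0, the subsolution argument from
    \<open>U\<close>; \<open>U\<close> is at most the horizon, and this initial gap decays with
    \<open>\<gamma> ^ steps\<close>.\<close>
  then have U_le: "U s \<le> V i X s + \<gamma> i ^ steps i * (1 / (1 - \<gamma> i))" if s: "s < S" for s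
  proof -
    have "U s \<le> (F ^^ steps i) U s" using \<open>\<And>s. s < S \<Longrightarrow> U s \<le> F U s\<close> s by (rule subsolution_F_pow)
    also have "\<dots> \<le> V i X s + \<gamma> i ^ steps i * (1 / (1 - \<gamma> i))"
      unfolding plan_V_eq
    proof (rule F_pow_shift[OF _ _ s])
      show "U s \<le> 0 + 1 / (1 - \<gamma> i)" if "s < S" for s
        using U(4)[OF that] g0 by (simp add: field_simps)
    qed (use g0 in simp)
    finally show ?thesis .
  qed
  obtain s0 where s0: "s0 < S" "Min (V i X ` {..<S}) = V i X s0" using Min_image_attained[OF S] by blast
  have "(1 - \<gamma> i) * U s0 \<le> (1 - \<gamma> i) * (V i X s0 + \<gamma> i ^ steps i * (1 / (1 - \<gamma> i)))"
    using U_le[OF s0(1)] g0 by (intro mult_left_mono) auto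
  also have "\<dots> = (1 - \<gamma> i) * V i X s0 + \<gamma> i ^ steps i" using g0 by (simp add: field_simps)
  finally have "\<rho> - (1 - \<gamma> i) * B - 6 * q - 1 / n \<le> (1 - \<gamma> i) * V i X s0"
    using U(2)[OF s0(1)] error_le(2)[of i] by linarith
  moreover have "\<alpha> * sqrt ((M i + 1) / n) \<le> (5 / 4) * y"
  proof -
    have "sqrt ((M i + 1) / n) \<le> sqrt ((5 / 4)\<^sup>2 * (M i / n))"
    proof (rule real_sqrt_le_mono)
      have "(M i + 1) / n \<le> ((5 / 4)\<^sup>2 * M i) / n"
        using M4 by (intro divide_right_mono) (auto simp: power2_eq_square)
      then show "(M i + 1) / n \<le> (5 / 4)\<^sup>2 * (M i / n)" by simp
    qed
    also have "\<dots> = (5 / 4) * sqrt (M i / n)" by (subst real_sqrt_mult) simp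
    finally have "\<alpha> * sqrt ((M i + 1) / n) \<le> \<alpha> * ((5 / 4) * sqrt (M i / n))"
      using alpha_ge_96 by (intro mult_left_mono) auto
    then show ?thesis by (simp add: y_def)
  qed
  \<comment> \<open>Losses in multiples of \<open>y\<close>: 1 from
    \<open>(1 - \<gamma>) * B\<close>, 1/32 from \<open>6 * q\<close>, 1 from \<open>1 / n\<close>
    and 5/4 from the penalty.\<close>
  ultimately show ?thesis unfolding Phi_eq s0(2) y_def[symmetric] using \<gamma>B(1) q y0 yn by linarith
qed

end

section \<open>Comparison with policies of constant gain\<close>

context esp_setting
begin

lemma esp_ihat_argmax:
  assumes isel: "\<And>X. X \<noteq> {} \<Longrightarrow> isel X \<in> X" and ne: "esp_index_set n \<noteq> {}"
  shows "esp_ihat isel S A r \<delta> n X \<in> esp_index_set n"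
    "j \<in> esp_index_set n \<Longrightarrow> Phi X j \<le> Phi X (esp_ihat isel S A r \<delta> n X)"
proof -
  let ?I = "esp_index_set n"
  have fin: "finite ?I" by (simp add: esp_index_set_def)
  have "Max (Phi X ` ?I) \<in> Phi X ` ?I" using fin ne by (intro Max_in) auto
  then obtain i where "i \<in> ?I" "Phi X i = Max (Phi X ` ?I)" by auto
  then have "i \<in> {i \<in> ?I. \<forall>j\<in>?I. Phi X j \<le> Phi X i}" using fin by auto
  then have "isel {i \<in> ?I. \<forall>j\<in>?I. Phi X j \<le> Phi X i} \<in> {i \<in> ?I. \<forall>j\<in>?I. Phi X j \<le> Phi X i}"
    by (intro isel) blast
  moreover have "esp_ihat isel S A r \<delta> n X = isel {i \<in> ?I. \<forall>j\<in>?I. Phi X j \<le> Phi X i}"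
    using ne by (simp add: esp_ihat_def Let_def)
  ultimately have *: "esp_ihat isel S A r \<delta> n X \<in> {i \<in> ?I. \<forall>j\<in>?I. Phi X j \<le> Phi X i}" by simp
  then show "esp_ihat isel S A r \<delta> n X \<in> ?I" by blast
  show "j \<in> ?I \<Longrightarrow> Phi X j \<le> Phi X (esp_ihat isel S A r \<delta> n X)" using * by blast
qed

lemma esp_rho_nonneg: "0 \<le> esp_rho isel S A r \<delta> n X"
  by (simp add: esp_rho_def)

lemma gain_ge_esp_rho:
  assumes good: "good h X" and isel: "\<And>X. X \<noteq> {} \<Longrightarrow> isel X \<in> X"
    and asel: "\<And>i s X. X \<noteq> {} \<Longrightarrow> asel i s X \<in> X" and s: "s < S"
  shows "esp_rho isel S A r \<delta> n X
    \<le> gain S A (kernel_of P) r (det_policy (esp_policy asel isel S A r \<delta> n X)) s"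
proof -
  let ?i = "esp_ihat isel S A r \<delta> n X"
  have pol: "esp_policy asel isel S A r \<delta> n X = d (asel ?i) ?i X"
    by (simp add: esp_policy_def Let_def)
  show ?thesis
  proof (cases "esp_index_set n = {}")
    \<comment> \<open>No level exists when \<open>n \<le> 2\<close>; the estimate is then 0.\<close>
    case True
    have "is_policy S A (det_policy (d (asel ?i) ?i X))"
      using plan_pol_greedy(1)[OF asel] by (intro is_policy_det)
    then show ?thesis unfolding pol using gain_range(1)[OF _ s] True by (simp add: esp_rho_def)
  next
    case False
    have "max (Phi X ?i) 0 \<le> gain S A (kernel_of P) r (det_policy (d (asel ?i) ?i X)) s"
      using good esp_ihat_argmax(1)[OF isel False] s asel by (rule gain_ge_Phi)
    then show ?thesis unfolding pol using False by (simp add: esp_rho_def)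
  qed
qed

definition const_gain :: "(nat \<Rightarrow> nat \<Rightarrow> real) \<Rightarrow> bool" where
  "const_gain pol \<longleftrightarrow> (\<forall>s<S. \<forall>s'<S. gain S A (kernel_of P) r pol s = gain S A (kernel_of P) r pol s')"

abbreviation bias_span where "bias_span pol \<equiv> span S (bias S A (kernel_of P) r pol)"

text \<open>Admitting only biases whose span is below a quarter of \<open>M i\<close> leaves the
  room in which the discounted value of such a policy escapes clipping.\<close>

definition level :: "nat \<Rightarrow> (nat \<Rightarrow> nat \<Rightarrow> real) set" where
  "level i = {pol. is_policy S A pol \<and> const_gain pol \<and> 4 * (bias_span pol + 1) \<le> M i}"

lemma span_nonneg: "0 \<le> span S f"
proof -
  have "0 < S" using S by simp
  from Min_image_le[OF this, of f] Max_image_ge[OF this, of f] show ?thesis by (simp add: span_def)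
qed

text \<open>The supremum over the level is finite, gains being at most 1, but need not be attained;
  the slack \<open>1 / n\<close> stays below the claimed error. State 0 represents all states
  because gains in the level are constant.\<close>

lemma near_optimal:
  assumes "level i \<noteq> {}"
  shows "\<exists>p\<in>level i. \<forall>pol\<in>level i. gain S A (kernel_of P) r pol 0 - 1 / n \<le> gain S A (kernel_of P) r p 0"
proof -
  let ?G = "(\<lambda>pol. gain S A (kernel_of P) r pol 0) ` level i"
  have bdd: "bdd_above ?G"
    using gain_range(2)[of _ 0] S by (intro bdd_aboveI[of _ 1]) (auto simp: level_def)
  have "Sup ?G - 1 / n < Sup ?G" using n by simp
  then obtain p where p: "p \<in> level i" "Sup ?G - 1 / n < gain S A (kernel_of P) r p 0"
    using less_cSup_iff[of ?G] assms bdd by auto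
  have "gain S A (kernel_of P) r pol 0 \<le> Sup ?G" if "pol \<in> level i" for pol
    using that by (intro cSup_upper bdd) simp
  with p show ?thesis by (intro bexI[of _ p]) force+
qed

text \<open>The comparison class is uncountable; it suffices to control one nearly optimal policy per
  level \<open>i\<close>, whose shifted bias does not depend on the samples.\<close>

lemma comparison:
  assumes "\<forall>X. X \<noteq> {} \<longrightarrow> isel X \<in> X"
  obtains h where "\<And>i s. s < S \<Longrightarrow> 0 \<le> h i s \<and> h i s \<le> M i / 4"
    "\<And>X pol s. good h X \<Longrightarrow> is_policy S A pol \<Longrightarrow> const_gain pol \<Longrightarrow> s < S \<Longrightarrow>
       gain S A (kernel_of P) r pol s - 100 * \<alpha> * sqrt ((bias_span pol + 1) / n) \<le> esp_rho isel S A r \<delta> n X"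
proof -
  have isel: "isel X \<in> X" if "X \<noteq> {}" for X using assms that by simp
  obtain best where best: "\<And>i. level i \<noteq> {} \<Longrightarrow> best i \<in> level i"
    "\<And>i pol. level i \<noteq> {} \<Longrightarrow> pol \<in> level i \<Longrightarrow>
      gain S A (kernel_of P) r pol 0 - 1 / n \<le> gain S A (kernel_of P) r (best i) 0"
    using near_optimal by metis
  have S0: "0 < S" using S by simp
  let ?b = "\<lambda>i. bias S A (kernel_of P) r (best i)"
  \<comment> \<open>Subtracting the minimum makes the bias nonnegative and keeps the Poisson
    equation; empty levels get the default 0, which meets the range condition.\<close>
  define h where "h = (\<lambda>i s. if level i = {} then 0 else ?b i s - Min (?b i ` {..<S}))"
  have h: "0 \<le> h i s \<and> h i s \<le> M i / 4" if s: "s < S" for i s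
  proof (cases "level i = {}")
    case False
    have "4 * (bias_span (best i) + 1) \<le> M i" using best(1)[OF False] by (simp add: level_def)
    then show ?thesis
      using Min_image_le[OF s, of "?b i"] Max_image_ge[OF s, of "?b i"] False
      by (simp add: h_def span_def)
  qed (simp add: h_def esp_M_def)
  have "gain S A (kernel_of P) r pol s - 100 * \<alpha> * sqrt ((bias_span pol + 1) / n) \<le> esp_rho isel S A r \<delta> n X"
    if good: "good h X" and pol: "is_policy S A pol" and cg: "const_gain pol" and s: "s < S" for X pol s
  proof -
    define H where "H = bias_span pol + 1"
    define z where "z = \<alpha> * sqrt (H / n)"
    have H: "1 \<le> H" using span_nonneg by (simp add: H_def)
    have z0: "0 \<le> z" using alpha_ge_96 H by (simp add: z_def)
    show ?thesis
    \<comment> \<open>If \<open>100 * z \<ge> 1\<close> the claim is trivial, since gains are at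
      most 1 and the estimate is nonnegative. The other case makes \<open>n\<close> large relative
      to \<open>\<alpha>^2 * H\<close>.\<close>
    proof (cases "100 * z \<ge> 1")
      case True
      then show ?thesis using gain_range(2)[OF pol s] esp_rho_nonneg[of isel X] unfolding H_def[symmetric] z_def
        by (simp add: mult.assoc)
    next
      case False
      have z2: "10000 * (\<alpha>\<^sup>2 * H) \<le> n"
      proof -
        have "(100 * z)\<^sup>2 \<le> 1\<^sup>2" using False z0 by (intro power_mono) auto
        moreover have "(100 * z)\<^sup>2 = 10000 * (\<alpha>\<^sup>2 * H) / n" using H n by (simp add: z_def power_mult_distrib)
        ultimately show ?thesis using n by simp
      qed
      have ex: "\<exists>i. 2 \<le> i \<and> 4 * H \<le> M i"
      proof -
        obtain k :: nat where "4 * H < 2 ^ k" using real_arch_pow[of 2 "4 * H"] by auto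
        also have "(2 :: real) ^ k \<le> 2 ^ (k + 2)" by (intro power_increasing) auto
        finally show ?thesis by (intro exI[of _ "k + 2"]) (simp add: esp_M_def)
      qed
      \<comment> \<open>The least admissible level overshoots by at most a factor 2; at the smallest
        level, 2, this comes from \<open>1 \<le> H\<close> instead of minimality.\<close>
      define i where "i = (LEAST i. 2 \<le> i \<and> 4 * H \<le> M i)"
      have i: "2 \<le> i" "4 * H \<le> M i" using LeastI_ex[OF ex] unfolding i_def by auto
      have iH: "M i \<le> 8 * H"
      proof (cases "i = 2")
        case True
        then show ?thesis using H by (simp add: esp_M_def)
      next
        case False
        then have "2 \<le> i - 1" "i = Suc (i - 1)" using i(1) by auto
        moreover have "\<not> (2 \<le> i - 1 \<and> 4 * H \<le> M (i - 1))"
          using i(1) unfolding i_def by (intro not_less_Least) simp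
        ultimately have "M (i - 1) < 4 * H" by simp
        moreover have "M i = 2 * M (i - 1)" by (subst \<open>i = Suc (i - 1)\<close>) (simp add: esp_M_def)
        ultimately show ?thesis by simp
      qed
      \<comment> \<open>Origin of the 100: its square 10000 must exceed
        \<open>8 * 1225 = 9800\<close>, the 8 stemming from \<open>M i \<le> 8 * H\<close>.\<close>
      have small: "1225 * (\<alpha>\<^sup>2 * M i) \<le> n"
      proof -
        have "\<alpha>\<^sup>2 * M i \<le> \<alpha>\<^sup>2 * (8 * H)" using iH by (intro mult_left_mono) auto
        then show ?thesis using z2 H zero_le_power2[of \<alpha>] by (simp add: mult.left_commute)
      qed
      have i_in: "i \<in> esp_index_set n"
      proof -
        have "1 * M i \<le> \<alpha>\<^sup>2 * M i"
          using alpha_ge_96 power_mono[of 1 \<alpha> 2] by (intro mult_right_mono) (auto simp: esp_M_def)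
        moreover have "0 < M i" by (simp add: esp_M_def)
        ultimately have "M i \<le> n" using small by linarith
        then have "2 powr real i \<le> n" by (simp add: esp_M_def powr_realpow)
        then have "real i \<le> log 2 n" using n by (simp add: le_log_iff)
        then have "i \<le> nat \<lceil>log 2 n\<rceil>" by linarith
        then show ?thesis using i(1) by (simp add: esp_index_set_def)
      qed
      have lev: "pol \<in> level i" using pol cg i(2) by (simp add: level_def H_def)
      then have ne: "level i \<noteq> {}" by blast
      have b: "is_policy S A (best i)" "const_gain (best i)" using best(1)[OF ne] by (auto simp: level_def)
      have 1: "gain S A (kernel_of P) r (best i) 0 - 4 * (\<alpha> * sqrt (M i / n)) \<le> Phi X i"
      proof (rule Phi_ge_gain[OF good i_in b(1)])
        show "gain S A (kernel_of P) r (best i) s = gain S A (kernel_of P) r (best i) 0" if "s < S" for s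
          using b(2) that S0 unfolding const_gain_def by blast
        show "h i = (\<lambda>s. ?b i s - Min (?b i ` {..<S}))" using ne by (simp add: h_def)
      qed (use h small in auto)
      have 2: "gain S A (kernel_of P) r pol s - 1 / n \<le> gain S A (kernel_of P) r (best i) 0"
      proof -
        have "gain S A (kernel_of P) r pol s = gain S A (kernel_of P) r pol 0"
          using cg s S0 unfolding const_gain_def by blast
        then show ?thesis using best(2)[OF ne lev] by simp
      qed
      have 3: "\<alpha> * sqrt (M i / n) \<le> 3 * z"
      proof -
        have "sqrt (M i / n) \<le> sqrt (3\<^sup>2 * (H / n))"
        proof (rule real_sqrt_le_mono)
          have "M i / n \<le> (9 * H) / n" using iH H by (intro divide_right_mono) auto
          then show "M i / n \<le> 3\<^sup>2 * (H / n)" by simp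
        qed
        also have "\<dots> = 3 * sqrt (H / n)" by (subst real_sqrt_mult) simp
        finally have "\<alpha> * sqrt (M i / n) \<le> \<alpha> * (3 * sqrt (H / n))"
          using alpha_ge_96 by (intro mult_left_mono) auto
        then show ?thesis by (simp add: z_def)
      qed
      have 4: "1 / n \<le> z"
      proof -
        have "sqrt ((1 / real n)\<^sup>2) \<le> sqrt (H / n)"
          using H n mult_mono[of 1 H 1 "real n"]
          by (intro real_sqrt_le_mono) (simp add: power2_eq_square divide_simps)
        then have "1 / n \<le> 1 * sqrt (H / n)" by simp
        also have "\<dots> \<le> z" unfolding z_def using alpha_ge_96 H by (intro mult_right_mono) auto
        finally show ?thesis .
      qed
      have "Phi X i \<le> esp_rho isel S A r \<delta> n X"
      proof -
        have "esp_index_set n \<noteq> {}" using i_in by blast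
        with esp_ihat_argmax(2)[OF isel this i_in, of X] show ?thesis by (simp add: esp_rho_def)
      qed
      \<comment> \<open>The losses add up to at most \<open>13 * z\<close>.\<close>
      then have "gain S A (kernel_of P) r pol s - 100 * z \<le> esp_rho isel S A r \<delta> n X"
        using 1 2 3 4 z0 by linarith
      then show ?thesis unfolding z_def H_def by (simp add: mult.assoc)
    qed
  qed
  with h show thesis by (rule that)
qed

end

theorem theorem4:
  "\<exists>C4::real. \<forall>(S::nat) (A::nat) (P::nat \<Rightarrow> nat \<Rightarrow> nat pmf) (r::nat \<Rightarrow> nat \<Rightarrow> real)
      (\<delta>::real) (n::nat) (asel::nat \<Rightarrow> nat \<Rightarrow> nat set \<Rightarrow> nat) (isel::nat set \<Rightarrow> nat).
     1 \<le> S \<and> 1 \<le> A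
     \<and> (\<forall>s<S. \<forall>a<A. set_pmf (P s a) \<subseteq> {..<S})
     \<and> (\<forall>s<S. \<forall>a<A. 0 \<le> r s a \<and> r s a \<le> 1)
     \<and> weakly_communicating S A (kernel_of P)
     \<and> 0 < \<delta> \<and> \<delta> < 1 \<and> 1 \<le> n
     \<and> (\<forall>i s X. X \<noteq> {} \<longrightarrow> asel i s X \<in> X)
     \<and> (\<forall>X. X \<noteq> {} \<longrightarrow> isel X \<in> X)
     \<longrightarrow> measure_pmf.prob (sample_pmf S A n P)
           {X. (\<forall>s<S.
                  gain S A (kernel_of P) r (det_policy (esp_policy asel isel S A r \<delta> n X)) s
                    \<ge> esp_rho isel S A r \<delta> n X)
             \<and> (\<forall>pol. is_policy S A pol
                  \<and> (\<forall>s<S. \<forall>s'<S. gain S A (kernel_of P) r pol s = gain S A (kernel_of P) r pol s')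
                  \<longrightarrow> (\<forall>s<S. esp_rho isel S A r \<delta> n X
                        \<ge> gain S A (kernel_of P) r pol s
                          - C4 * alpha S A \<delta> n
                              * sqrt ((span S (bias S A (kernel_of P) r pol) + 1) / real n)))}
         \<ge> 1 - \<delta>"
proof (intro exI[of _ 100] allI impI)
  fix S A :: nat and P :: "nat \<Rightarrow> nat \<Rightarrow> nat pmf" and r :: "nat \<Rightarrow> nat \<Rightarrow> real" and \<delta> :: real and n :: nat
    and asel :: "nat \<Rightarrow> nat \<Rightarrow> nat set \<Rightarrow> nat" and isel :: "nat set \<Rightarrow> nat"
  assume "1 \<le> S \<and> 1 \<le> A
     \<and> (\<forall>s<S. \<forall>a<A. set_pmf (P s a) \<subseteq> {..<S})
     \<and> (\<forall>s<S. \<forall>a<A. 0 \<le> r s a \<and> r s a \<le> 1)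
     \<and> weakly_communicating S A (kernel_of P)
     \<and> 0 < \<delta> \<and> \<delta> < 1 \<and> 1 \<le> n
     \<and> (\<forall>i s X. X \<noteq> {} \<longrightarrow> asel i s X \<in> X)
     \<and> (\<forall>X. X \<noteq> {} \<longrightarrow> isel X \<in> X)"
  then have P: "\<forall>s<S. \<forall>a<A. set_pmf (P s a) \<subseteq> {..<S}"
    and r: "\<forall>s<S. \<forall>a<A. 0 \<le> r s a \<and> r s a \<le> 1"
    and pos: "1 \<le> S" "1 \<le> A" "1 \<le> n" "0 < \<delta>" "\<delta> < 1"
    and sel: "\<forall>i s X. X \<noteq> {} \<longrightarrow> asel i s X \<in> X" "\<forall>X. X \<noteq> {} \<longrightarrow> isel X \<in> X"
    by - (elim conjE, assumption)+
  interpret esp_setting S A n P r \<delta>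
    by unfold_locales (use pos P r in \<open>simp_all only:\<close>)
  have isel: "isel X \<in> X" if "X \<noteq> {}" for X using sel(2) that by simp
  have asel: "asel i s X \<in> X" if "X \<noteq> {}" for i s X using sel(1) that by simp
  show "1 - \<delta> \<le> measure_pmf.prob (sample_pmf S A n P)
           {X. (\<forall>s<S.
                  gain S A (kernel_of P) r (det_policy (esp_policy asel isel S A r \<delta> n X)) s
                    \<ge> esp_rho isel S A r \<delta> n X)
             \<and> (\<forall>pol. is_policy S A pol
                  \<and> (\<forall>s<S. \<forall>s'<S. gain S A (kernel_of P) r pol s = gain S A (kernel_of P) r pol s')
                  \<longrightarrow> (\<forall>s<S. esp_rho isel S A r \<delta> n X
                        \<ge> gain S A (kernel_of P) r pol s
                          - 100 * alpha S A \<delta> n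
                              * sqrt ((span S (bias S A (kernel_of P) r pol) + 1) / real n)))}"
    (is "_ \<le> measure_pmf.prob _ ?E")
  \<comment> \<open>The test functions are obtained before the event is formed, so one sample event
    serves all comparison policies simultaneously.\<close>
  proof (rule comparison[OF sel(2)])
    fix h assume h: "\<And>i s. s < S \<Longrightarrow> 0 \<le> h i s \<and> h i s \<le> M i / 4"
      "\<And>X pol s. good h X \<Longrightarrow> is_policy S A pol \<Longrightarrow> const_gain pol \<Longrightarrow> s < S \<Longrightarrow>
         gain S A (kernel_of P) r pol s - 100 * \<alpha> * sqrt ((bias_span pol + 1) / n) \<le> esp_rho isel S A r \<delta> n X"
    have "1 - \<delta> \<le> measure_pmf.prob (sample_pmf S A n P) {X. good h X}"
      by (rule prob_good) (rule h(1))
    also have "\<dots> \<le> measure_pmf.prob (sample_pmf S A n P) ?E"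
    proof (rule measure_pmf.finite_measure_mono)
      show "{X. good h X} \<subseteq> ?E"
      proof (intro subsetI CollectI conjI allI impI)
        fix X s assume "X \<in> {X. good h X}" and "s < S"
        then show "esp_rho isel S A r \<delta> n X
            \<le> gain S A (kernel_of P) r (det_policy (esp_policy asel isel S A r \<delta> n X)) s"
          using isel asel by (intro gain_ge_esp_rho[of h]) (simp_all only: mem_Collect_eq)
      next
        fix X pol s assume X: "X \<in> {X. good h X}" and s: "s < S" and pol: "is_policy S A pol
            \<and> (\<forall>s<S. \<forall>s'<S. gain S A (kernel_of P) r pol s = gain S A (kernel_of P) r pol s')"
        have "const_gain pol" unfolding const_gain_def using pol by (rule conjunct2)
        with X s conjunct1[OF pol] show "gain S A (kernel_of P) r pol s
            - 100 * alpha S A \<delta> n * sqrt ((span S (bias S A (kernel_of P) r pol) + 1) / real n)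
            \<le> esp_rho isel S A r \<delta> n X"
          by (intro h(2)) (simp_all only: mem_Collect_eq)
      qed
    qed (simp only: sets_measure_pmf UNIV_I)
    finally show ?thesis .
  qed
qed

end
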